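(* The following laws hold for quantum programs and binary measurements $M,N$: (1) (Unit and Zero) $\mathbf{skip};P\equiv P;\mathbf{skip}\equiv P$ and $\mathbf{abort};P\equiv P;\mathbf{abort}\equiv\mathbf{abort}$. (2) (Commutativity) If $qv(P_1)\cap qv(P_2)=\emptyset$, then $P_1;P_2\equiv P_2;P_1$. (3) (Associativity) $(P;Q);R\equiv P;(Q;R)$. (4) (Sequentiality) If $M$ is a projective measurement and $\bar q\cap qv(P_0)=\bar q\cap qv(P_1)=\emptyset$, then $$(P_0\vartriangleleft M[\bar q]\vartriangleright P_1);(Q_0\vartriangleleft M[\bar q]\vartriangleright Q_1)\equiv(P_0;Q_0)\vartriangleleft M[\bar q]\vartriangleright(P_1;Q_1).$$ (5) (Right-Distributivity) $(P_0\vartriangleleft M\vartriangleright P_1);P\equiv(P_0;P)\vartriangleleft M\vartriangleright(P_1;P)$. (6) (Left-Distributivity-I) If $\bar q\cap qv(P)=\emptyset$, then $P;(P_0\vartriangleleft M[\bar q]\vartriangleright P_1)\equiv(P;P_0)\vartriangleleft M[\bar q]\vartriangleright(P;P_1)$. (7) (Left-Distributivity-II) If $P;[M)\equiv[N);P'$ and $P;(M]\equiv(N];P'$, then $$P;(P_0\vartriangleleft M\vartriangleright P_1)\equiv(P';P_0)\vartriangleleft N\vartriangleright(P';P_1).$$ In particular, if $U$ is a unitary operator and $U(M)=\{M_0',M_1'\}$ is the binary measurement with $M_i'=M_iU$ for $i=0,1$, then $U[q];(P_0\vartriangleleft M[q]\vartriangleright P_1)\equiv P_0\vartriangleleft U(M)[q]\vartriangleright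 P_1$.
   Context: Each quantum variable $q$ has a Hilbert space $\mathcal H_q$; a register $\bar q$ is a finite sequence of distinct variables (identified with its set) with space $\mathcal H_{\bar q}=\bigotimes_i\mathcal H_{q_i}$. $QVar$ is a finite set of variables containing all variables in play, $\mathcal H_{QVar}=\bigotimes_{q\in QVar}\mathcal H_q$; operators on $\mathcal H_{\bar q}$ are identified with their extensions by the identity. $\mathcal D(\mathcal H_{QVar})$: positive (trace-class) operators of trace $\le1$. Circuits: $C::=\mathbf{skip}\mid U[\bar q]\mid C_1;C_2\mid \mathbf{qif}\,[\bar q](\square_{i=1}^d|\psi_i\rangle\to C_i)\,\mathbf{fiq}$ ($U$ a unitary constant from a fixed set, $\{|\psi_i\rangle\}$ an orthonormal basis of $\mathcal H_{\bar q}$, $\bar q$ disjoint from the variables of all $C_i$), with unitary semantics $I$, $U_{\bar q}$, $[\![C_2]\!][\![C_1]\!]$, $\sum_i|\psi_i\rangle_{\bar q}\langle\psi_i|\otimes[\![C_i]\!]$. A measurement on $\bar q$ is a family $M=\{M_m\}$ with $\sum_mM_m^\dagger M_m=I$; binary if the outcomes are $0,1$; projective if the $M_m$ are mutually orthogonal projections. Programs: $P::=\mathbf{skip}\mid\mathbf{abort}\mid\bar q:=|\psi\rangle\mid C\mid P_1;P_2\mid\mathbf{if}\,M[\bar q](\square m\to P_m)\,\mathbf{fi}\mid\mathbf{while}\,M[\bar q]=1\,\mathbf{do}\,P\,\mathbf{od}$; $qv(P)$ is the set of variables occurring in $P$. Semantics on $\mathcal D(\mathcal H_{QVar})$: $[\![\mathbf{skip}]\!](\rho)=\rho$;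 $[\![\mathbf{abort}]\!](\rho)=0$; $[\![\bar q:=|\psi\rangle]\!](\rho)=\sum_n|\psi\rangle_{\bar q}\langle n|\rho|n\rangle_{\bar q}\langle\psi|$ ($\{|n\rangle\}$ an orthonormal basis); $[\![C]\!](\rho)=[\![C]\!]\rho[\![C]\!]^\dagger$; $[\![P_1;P_2]\!]=[\![P_2]\!]\circ[\![P_1]\!]$; $[\![\mathbf{if}\,M[\bar q](\square m\to P_m)\,\mathbf{fi}]\!](\rho)=\sum_m[\![P_m]\!](M_m\rho M_m^\dagger)$; $[\![\mathbf{while}\,M[\bar q]=1\,\mathbf{do}\,P\,\mathbf{od}]\!]=\sum_{n\ge0}\mathcal E_0\circ([\![P]\!]\circ\mathcal E_1)^n$, $\mathcal E_i(\rho)=M_i\rho M_i^\dagger$. $P\equiv Q$ iff $[\![P]\!]=[\![Q]\!]$. Notation, for binary $M$: $P_0\vartriangleleft M[\bar q]\vartriangleright P_1$ (or $P_0\vartriangleleft M\vartriangleright P_1$ with the register omitted) is the if-statement executing $P_0$ on outcome $0$ and $P_1$ on outcome $1$; $(M]$ abbreviates $\mathbf{abort}\vartriangleleft M\vartriangleright\mathbf{skip}$; $[M)$ abbreviates $\mathbf{skip}\vartriangleleft M\vartriangleright\mathbf{abort}$. *)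

theory Defs
  imports "HOL-Analysis.Analysis"
begin

section \<open>Hilbert spaces and operators\<close>

text \<open>
  Every Hilbert space is, up to isomorphism, the space \<open>\<ell>\<^sup>2\<close> over an index set of an orthonormal
  basis, of arbitrary cardinality. Vectors are complex functions vanishing outside the index set;
  operators are functions on vectors, and bounded operators are made extensional (value 0 outside
  the space), so that equality of operators is equality of functions.
\<close>

type_synonym 'i vec = "'i \<Rightarrow> complex"
type_synonym 'i oper = "'i vec \<Rightarrow> 'i vec"

definition ell2 :: "'i set \<Rightarrow> 'i vec set" where
  "ell2 I = {f. (\<forall>x. x \<notin> I \<longrightarrow> f x = 0) \<and> (\<lambda>x. (cmod (f x))\<^sup>2) summable_on I}"

definition ip :: "'i vec \<Rightarrow> 'i vec \<Rightarrow> complex" where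
  "ip f g = (\<Sum>\<^sub>\<infinity>x. cnj (f x) * g x)"

definition l2norm :: "'i vec \<Rightarrow> real" where
  "l2norm f = sqrt (\<Sum>\<^sub>\<infinity>x. (cmod (f x))\<^sup>2)"

definition ket :: "'i \<Rightarrow> 'i vec" where
  "ket n = (\<lambda>x. if x = n then 1 else 0)"

definition bop :: "'i set \<Rightarrow> 'i oper set" where
  "bop I = {A. (\<forall>f\<in>ell2 I. A f \<in> ell2 I)
     \<and> (\<forall>f\<in>ell2 I. \<forall>g\<in>ell2 I. \<forall>a. A (\<lambda>x. a * f x + g x) = (\<lambda>x. a * A f x + A g x))
     \<and> (\<exists>K. \<forall>f\<in>ell2 I. l2norm (A f) \<le> K * l2norm f)
     \<and> (\<forall>f. f \<notin> ell2 I \<longrightarrow> A f = (\<lambda>_. 0))}"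

definition idop :: "'i set \<Rightarrow> 'i oper" where
  "idop I = (\<lambda>f. if f \<in> ell2 I then f else (\<lambda>_. 0))"

definition adj :: "'i set \<Rightarrow> 'i oper \<Rightarrow> 'i oper" where
  "adj I A = (THE A'. A' \<in> bop I \<and> (\<forall>f\<in>ell2 I. \<forall>g\<in>ell2 I. ip (A' f) g = ip f (A g)))"

text \<open>The rank-one operator \<open>|\<psi>\<rangle>\<langle>\<phi>|\<close>.\<close>

definition outer :: "'i set \<Rightarrow> 'i vec \<Rightarrow> 'i vec \<Rightarrow> 'i oper" where
  "outer I \<psi> \<phi> = (\<lambda>f. if f \<in> ell2 I then (\<lambda>x. ip \<phi> f * \<psi> x) else (\<lambda>_. 0))"

text \<open>
  Possibly infinite sums of operators are taken entrywise. On the sums occurring below (positive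
  operators with bounded total trace) this is the same as convergence in trace norm.
\<close>

definition op_sum :: "'n set \<Rightarrow> ('n \<Rightarrow> 'i oper) \<Rightarrow> 'i oper" where
  "op_sum J F = (\<lambda>f x. \<Sum>\<^sub>\<infinity>n\<in>J. F n f x)"

definition unitary :: "'i set \<Rightarrow> 'i oper \<Rightarrow> bool" where
  "unitary I U \<longleftrightarrow> U \<in> bop I \<and> adj I U \<circ> U = idop I \<and> U \<circ> adj I U = idop I"

definition positive :: "'i set \<Rightarrow> 'i oper \<Rightarrow> bool" where
  "positive I A \<longleftrightarrow> A \<in> bop I \<and> (\<forall>f\<in>ell2 I. ip f (A f) \<in> \<real> \<and> 0 \<le> Re (ip f (A f)))"

text \<open>A positive operator is trace-class iff the sum of its diagonal entries converges.\<close>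

definition density :: "'i set \<Rightarrow> 'i oper set" where
  "density I = {\<rho>. positive I \<rho> \<and> (\<lambda>n. ip (ket n) (\<rho> (ket n))) summable_on I
     \<and> Re (\<Sum>\<^sub>\<infinity>n\<in>I. ip (ket n) (\<rho> (ket n))) \<le> 1}"

definition onb :: "'i set \<Rightarrow> nat \<Rightarrow> (nat \<Rightarrow> 'i vec) \<Rightarrow> bool" where
  "onb I d \<psi> \<longleftrightarrow> (\<forall>i\<in>{1..d}. \<psi> i \<in> ell2 I)
     \<and> (\<forall>i\<in>{1..d}. \<forall>j\<in>{1..d}. ip (\<psi> i) (\<psi> j) = (if i = j then 1 else 0))
     \<and> (\<forall>f\<in>ell2 I. f = (\<lambda>x. \<Sum>i=1..d. ip (\<psi> i) f * \<psi> i x))"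

text \<open>
  A measurement with set of outcomes \<open>J\<close>, finite or not. The completeness relation
  \<open>\<Sum>\<^sub>m M\<^sub>m\<^sup>\<dagger> M\<^sub>m = I\<close> uses \<open>has_sum\<close> because \<open>infsum\<close> is 0 on divergent sums.
\<close>

definition measurement :: "'i set \<Rightarrow> nat set \<Rightarrow> (nat \<Rightarrow> 'i oper) \<Rightarrow> bool" where
  "measurement I J M \<longleftrightarrow> (\<forall>m\<in>J. M m \<in> bop I)
     \<and> (\<forall>f\<in>ell2 I. \<forall>x. ((\<lambda>m. (adj I (M m) \<circ> M m) f x) has_sum f x) J)"

abbreviation binary_measurement :: "'i set \<Rightarrow> (nat \<Rightarrow> 'i oper) \<Rightarrow> bool" where
  "binary_measurement I M \<equiv> measurement I {0, 1} M"

definition projective :: "'i set \<Rightarrow> nat set \<Rightarrow> (nat \<Rightarrow> 'i oper) \<Rightarrow> bool" where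
  "projective I J M \<longleftrightarrow> (\<forall>m\<in>J. M m \<circ> M m = M m \<and> adj I (M m) = M m)
     \<and> (\<forall>m\<in>J. \<forall>n\<in>J. m \<noteq> n \<longrightarrow> M m \<circ> M n = (\<lambda>_ _. 0))"

section \<open>Registers\<close>

text \<open>
  \<open>B q\<close> indexes an orthonormal basis of the space of the variable \<open>q\<close>. The tensor product over the
  variables in a finite set \<open>Q\<close> is \<open>\<ell>\<^sup>2\<close> over the product of these index sets.
\<close>

abbreviation idx :: "('v \<Rightarrow> 'b set) \<Rightarrow> 'v set \<Rightarrow> ('v \<Rightarrow> 'b) set" where
  "idx B Q \<equiv> PiE Q B"

text \<open>
  The extension of \<open>A\<close> on the register \<open>Q\<close> by the identity on \<open>V - Q\<close>: for each fixed value of the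
  variables outside \<open>Q\<close>, \<open>A\<close> acts on the resulting function of the variables in \<open>Q\<close>.
\<close>

definition ext ::
  "('v \<Rightarrow> 'b set) \<Rightarrow> 'v set \<Rightarrow> 'v set \<Rightarrow> ('v \<Rightarrow> 'b) oper \<Rightarrow> ('v \<Rightarrow> 'b) oper" where
  "ext B V Q A = (\<lambda>f x. if f \<in> ell2 (idx B V) \<and> x \<in> idx B V
     then A (\<lambda>y. if y \<in> idx B Q then f (override_on x y Q) else 0) (restrict x Q)
     else 0)"

definition sandwich :: "'i set \<Rightarrow> 'i oper \<Rightarrow> 'i oper \<Rightarrow> 'i oper" where
  "sandwich I A \<rho> = A \<circ> \<rho> \<circ> adj I A"

section \<open>Circuits\<close>

datatype ('v, 'b) circuit =
    CSkip
  | Gate "'v set" "('v \<Rightarrow> 'b) oper"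
  | CSeq "('v, 'b) circuit" "('v, 'b) circuit"
  | QIf "'v set" nat "nat \<Rightarrow> ('v \<Rightarrow> 'b) vec" "nat \<Rightarrow> ('v, 'b) circuit"

primrec cqv :: "('v, 'b) circuit \<Rightarrow> 'v set" where
  "cqv CSkip = {}"
| "cqv (Gate Q U) = Q"
| "cqv (CSeq C D) = cqv C \<union> cqv D"
| "cqv (QIf Q d \<psi> C) = Q \<union> (\<Union>i\<in>{1..d}. cqv (C i))"

text \<open>\<open>G Q\<close> is the set of unitary constants that are available on the register \<open>Q\<close>.\<close>

primrec wf_circuit ::
  "('v \<Rightarrow> 'b set) \<Rightarrow> 'v set \<Rightarrow> ('v set \<Rightarrow> ('v \<Rightarrow> 'b) oper set) \<Rightarrow> ('v, 'b) circuit \<Rightarrow> bool" where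
  "wf_circuit B V G CSkip \<longleftrightarrow> True"
| "wf_circuit B V G (Gate Q U) \<longleftrightarrow> Q \<subseteq> V \<and> U \<in> G Q"
| "wf_circuit B V G (CSeq C D) \<longleftrightarrow> wf_circuit B V G C \<and> wf_circuit B V G D"
| "wf_circuit B V G (QIf Q d \<psi> C) \<longleftrightarrow> Q \<subseteq> V \<and> onb (idx B Q) d \<psi>
     \<and> (\<forall>i\<in>{1..d}. wf_circuit B V G (C i) \<and> Q \<inter> cqv (C i) = {})"

text \<open>
  Since \<open>C i\<close> does not involve \<open>Q\<close>, the tensor product \<open>|\<psi> i\<rangle>\<langle>\<psi> i| \<otimes> [[C i]]\<close> is the product of the
  extensions of the two factors to \<open>V\<close>.
\<close>

primrec csem ::
  "('v \<Rightarrow> 'b set) \<Rightarrow> 'v set \<Rightarrow> ('v, 'b) circuit \<Rightarrow> ('v \<Rightarrow> 'b) oper" where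
  "csem B V CSkip = idop (idx B V)"
| "csem B V (Gate Q U) = ext B V Q U"
| "csem B V (CSeq C D) = csem B V D \<circ> csem B V C"
| "csem B V (QIf Q d \<psi> C) =
     (\<lambda>f x. \<Sum>i=1..d. ext B V Q (outer (idx B Q) (\<psi> i) (\<psi> i)) (csem B V (C i) f) x)"

section \<open>Programs\<close>

datatype ('v, 'b) prog =
    Skip
  | Abort
  | Init "'v set" "('v \<Rightarrow> 'b) vec"
  | Circ "('v, 'b) circuit"
  | Seq "('v, 'b) prog" "('v, 'b) prog"  (infixr ";;" 60)
  | IfM "nat set" "nat \<Rightarrow> ('v \<Rightarrow> 'b) oper" "'v set" "nat \<Rightarrow> ('v, 'b) prog"
  | WhileM "nat \<Rightarrow> ('v \<Rightarrow> 'b) oper" "'v set" "('v, 'b) prog"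

primrec qv :: "('v, 'b) prog \<Rightarrow> 'v set" where
  "qv Skip = {}"
| "qv Abort = {}"
| "qv (Init Q \<psi>) = Q"
| "qv (Circ C) = cqv C"
| "qv (P ;; R) = qv P \<union> qv R"
| "qv (IfM J M Q P) = Q \<union> (\<Union>m\<in>J. qv (P m))"
| "qv (WhileM M Q P) = Q \<union> qv P"

primrec wf_prog ::
  "('v \<Rightarrow> 'b set) \<Rightarrow> 'v set \<Rightarrow> ('v set \<Rightarrow> ('v \<Rightarrow> 'b) oper set) \<Rightarrow> ('v, 'b) prog \<Rightarrow> bool" where
  "wf_prog B V G Skip \<longleftrightarrow> True"
| "wf_prog B V G Abort \<longleftrightarrow> True"
| "wf_prog B V G (Init Q \<psi>) \<longleftrightarrow> Q \<subseteq> V \<and> \<psi> \<in> ell2 (idx B Q) \<and> l2norm \<psi> = 1"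
| "wf_prog B V G (Circ C) \<longleftrightarrow> wf_circuit B V G C"
| "wf_prog B V G (P ;; R) \<longleftrightarrow> wf_prog B V G P \<and> wf_prog B V G R"
| "wf_prog B V G (IfM J M Q P) \<longleftrightarrow>
     Q \<subseteq> V \<and> measurement (idx B Q) J M \<and> (\<forall>m\<in>J. wf_prog B V G (P m))"
| "wf_prog B V G (WhileM M Q P) \<longleftrightarrow>
     Q \<subseteq> V \<and> binary_measurement (idx B Q) M \<and> wf_prog B V G P"

text \<open>
  Initialisation is written with the canonical orthonormal basis of the register; its semantics
  does not depend on this choice.
\<close>

primrec sem ::
  "('v \<Rightarrow> 'b set) \<Rightarrow> 'v set \<Rightarrow> ('v, 'b) prog \<Rightarrow> ('v \<Rightarrow> 'b) oper \<Rightarrow> ('v \<Rightarrow> 'b) oper" where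
  "sem B V Skip = (\<lambda>\<rho>. \<rho>)"
| "sem B V Abort = (\<lambda>\<rho> _ _. 0)"
| "sem B V (Init Q \<psi>) = (\<lambda>\<rho>. op_sum (idx B Q) (\<lambda>n.
     ext B V Q (outer (idx B Q) \<psi> (ket n)) \<circ> \<rho> \<circ> ext B V Q (outer (idx B Q) (ket n) \<psi>)))"
| "sem B V (Circ C) = sandwich (idx B V) (csem B V C)"
| "sem B V (P ;; R) = sem B V R \<circ> sem B V P"
| "sem B V (IfM J M Q P) =
     (\<lambda>\<rho>. op_sum J (\<lambda>m. sem B V (P m) (sandwich (idx B V) (ext B V Q (M m)) \<rho>)))"
| "sem B V (WhileM M Q P) = (\<lambda>\<rho>. op_sum UNIV (\<lambda>n. (sandwich (idx B V) (ext B V Q (M 0))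
     \<circ> (sem B V P \<circ> sandwich (idx B V) (ext B V Q (M 1))) ^^ n) \<rho>))"

definition prog_equiv ::
  "('v \<Rightarrow> 'b set) \<Rightarrow> 'v set \<Rightarrow> ('v, 'b) prog \<Rightarrow> ('v, 'b) prog \<Rightarrow> bool"
  ("_, _ \<turnstile> _ \<cong> _" [51, 51, 51, 51] 50) where
  "B, V \<turnstile> P \<cong> R \<longleftrightarrow> (\<forall>\<rho>\<in>density (idx B V). sem B V P \<rho> = sem B V R \<rho>)"

abbreviation cond ::
  "('v, 'b) prog \<Rightarrow> (nat \<Rightarrow> ('v \<Rightarrow> 'b) oper) \<Rightarrow> 'v set \<Rightarrow> ('v, 'b) prog \<Rightarrow> ('v, 'b) prog"
  ("(_ \<triangleleft> _\<langle>_\<rangle> \<triangleright> _)" [71, 1000, 0, 71] 70) where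
  "P0 \<triangleleft> M\<langle>Q\<rangle> \<triangleright> P1 \<equiv> IfM {0, 1} M Q (\<lambda>m. if m = 0 then P0 else P1)"

text \<open>\<open>guard0\<close> is \<open>[M)\<close> and \<open>guard1\<close> is \<open>(M]\<close>.\<close>

abbreviation guard0 :: "(nat \<Rightarrow> ('v \<Rightarrow> 'b) oper) \<Rightarrow> 'v set \<Rightarrow> ('v, 'b) prog" where
  "guard0 M Q \<equiv> Skip \<triangleleft> M\<langle>Q\<rangle> \<triangleright> Abort"

abbreviation guard1 :: "(nat \<Rightarrow> ('v \<Rightarrow> 'b) oper) \<Rightarrow> 'v set \<Rightarrow> ('v, 'b) prog" where
  "guard1 M Q \<equiv> Abort \<triangleleft> M\<langle>Q\<rangle> \<triangleright> Skip"

end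

(*
  Call a superoperator a map on positive trace-class operators that is additive and does not
  increase the trace. Such a map automatically preserves infinite sums of bounded total trace,
  since the trace of a tail tends to 0. Programs denote superoperators, so the distributivity laws
  are additivity. For the laws about disjoint registers, every program is built by composition and
  summation from sandwiches with local operators; local operators on disjoint registers commute
  (check this on basis vectors), and the sums are preserved, so two inductions on programs give
  commutativity.

  All trace estimates come from one inequality: if the vectors g_j satisfy Bessel's inequality,
  then the sum of <g_j|rho g_j> is at most the trace of rho. A few steps of a Cholesky
  decomposition split rho into finitely many rank-one terms, for which this is Bessel's inequality,
  and a remainder that kills many basis vectors, whose contribution to the left side is small. In
  this way neither square roots nor cyclicity of the trace are needed.
*)

theory Submission
  imports Defs
begin

section \<open>Square-summable vectors\<close>

text \<open>The obstacle is that infinite sums of operators are only entrywise and that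
  \<open>infsum\<close> returns 0 on divergence, so no exchange of sums is free. The bridge from
  traces to entries is \<open>l2norm_le_tr\<close>: the operator norm of a positive operator is at
  most its trace. Hence a tail of small trace still has small entries after any trace-nonincreasing
  map has been applied to it. For commutativity, a circuit is never shown to be the extension of an
  operator on its own variables; only its commutation with extensions on other registers is proved,
  so circuits stand beside local operators as building blocks of programs. Both inductions on
  programs are one lemma, \<open>sem_commute\<close>, about an abstract map \<open>T\<close>: it is
  first a sandwich and then the semantics of the other program, for which the first round has
  supplied the hypotheses.\<close>

lemma has_sum_finite_sum:
  fixes f :: "'k \<Rightarrow> 'a \<Rightarrow> 'b :: topological_comm_monoid_add"
  assumes "\<And>k. k \<in> F \<Longrightarrow> (f k has_sum s k) A"
  shows "((\<lambda>x. \<Sum>k\<in>F. f k x) has_sum (\<Sum>k\<in>F. s k)) A"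
  using assms by (induction F rule: infinite_finite_induct) (auto intro: has_sum_add)

lemma infsum_finite_sum:
  fixes f :: "'k \<Rightarrow> 'a \<Rightarrow> 'b :: {topological_comm_monoid_add, t2_space}"
  assumes "\<And>k. k \<in> F \<Longrightarrow> f k summable_on A"
  shows "(\<Sum>\<^sub>\<infinity>x\<in>A. \<Sum>k\<in>F. f k x) = (\<Sum>k\<in>F. \<Sum>\<^sub>\<infinity>x\<in>A. f k x)"
  by (rule infsumI[OF has_sum_finite_sum]) (simp add: assms)

lemma summable_on_finite_sum:
  fixes f :: "'k \<Rightarrow> 'a \<Rightarrow> 'b :: {topological_comm_monoid_add, t2_space}"
  assumes "\<And>k. k \<in> F \<Longrightarrow> f k summable_on A"
  shows "(\<lambda>x. \<Sum>k\<in>F. f k x) summable_on A"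
  by (rule has_sum_imp_summable[OF has_sum_finite_sum]) (rule has_sum_infsum[OF assms])

text \<open>Membership is defined by a sum over \<open>I\<close>, while \<open>ip\<close> and
  \<open>l2norm\<close> sum over the whole type; vanishing outside \<open>I\<close> makes the two
  agree, and the form over \<open>UNIV\<close> is the one that the sums below consume.\<close>

lemma ell2_iff:
  "f \<in> ell2 I \<longleftrightarrow> (\<forall>x. x \<notin> I \<longrightarrow> f x = 0) \<and> (\<lambda>x. (cmod (f x))\<^sup>2) summable_on UNIV"
proof -
  have "(\<lambda>x. (cmod (f x))\<^sup>2) summable_on I \<longleftrightarrow> (\<lambda>x. (cmod (f x))\<^sup>2) summable_on UNIV"
    if "\<forall>x. x \<notin> I \<longrightarrow> f x = 0"
    by (rule summable_on_cong_neutral) (use that in auto)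
  then show ?thesis
    unfolding ell2_def by auto
qed

lemma ell2_outside: "f \<in> ell2 I \<Longrightarrow> x \<notin> I \<Longrightarrow> f x = 0"
  by (auto simp: ell2_def)

lemma ell2_summable: "f \<in> ell2 I \<Longrightarrow> (\<lambda>x. (cmod (f x))\<^sup>2) summable_on UNIV"
  by (simp add: ell2_iff)

lemma ell2_comparison:
  assumes "h summable_on UNIV" and "\<And>x. (cmod (f x))\<^sup>2 \<le> h x" and "\<And>x. x \<notin> I \<Longrightarrow> f x = 0"
  shows "f \<in> ell2 I"
proof -
  have "(\<lambda>x. (cmod (f x))\<^sup>2) summable_on UNIV"
    by (rule summable_on_comparison_test[OF assms(1)]) (use assms(2) in auto)
  then show ?thesis
    using assms(3) by (simp add: ell2_iff)
qed

lemma ell2_lin: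
  assumes "f \<in> ell2 I" "g \<in> ell2 I"
  shows "(\<lambda>x. a * f x + g x) \<in> ell2 I"
proof (rule ell2_comparison)
  show "(\<lambda>x. 2 * (cmod a)\<^sup>2 * (cmod (f x))\<^sup>2 + 2 * (cmod (g x))\<^sup>2) summable_on UNIV"
    by (intro summable_on_add summable_on_cmult_right ell2_summable[OF assms(1)]
        ell2_summable[OF assms(2)])
  show "(cmod (a * f x + g x))\<^sup>2 \<le> 2 * (cmod a)\<^sup>2 * (cmod (f x))\<^sup>2 + 2 * (cmod (g x))\<^sup>2" for x
  proof -
    have "(cmod (a * f x + g x))\<^sup>2 \<le> (cmod (a * f x) + cmod (g x))\<^sup>2"
      by (intro power_mono norm_triangle_ineq) auto
    also have "\<dots> \<le> 2 * (cmod (a * f x))\<^sup>2 + 2 * (cmod (g x))\<^sup>2"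
      using sum_squares_bound[of "cmod (a * f x)" "cmod (g x)"] by (simp add: power2_sum)
    finally show ?thesis
      by (simp add: norm_mult power_mult_distrib)
  qed
qed (use assms in \<open>auto simp: ell2_def\<close>)

lemma ell2_zero [simp]: "(\<lambda>_. 0) \<in> ell2 I"
  by (simp add: ell2_def)

lemma ell2_scale: "f \<in> ell2 I \<Longrightarrow> (\<lambda>x. a * f x) \<in> ell2 I"
  using ell2_lin[of f I "\<lambda>_. 0" a] by simp

lemma ell2_add: "f \<in> ell2 I \<Longrightarrow> g \<in> ell2 I \<Longrightarrow> (\<lambda>x. f x + g x) \<in> ell2 I"
  using ell2_lin[of f I g 1] by simp

lemma ell2_diff: "f \<in> ell2 I \<Longrightarrow> g \<in> ell2 I \<Longrightarrow> (\<lambda>x. f x - g x) \<in> ell2 I"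
  using ell2_lin[of g I f "-1"] by simp

lemma ell2_sum:
  assumes "\<And>i. i \<in> X \<Longrightarrow> f i \<in> ell2 I"
  shows "(\<lambda>x. \<Sum>i\<in>X. f i x) \<in> ell2 I"
  using assms by (induction X rule: infinite_finite_induct) (auto intro: ell2_add)

lemma ell2_finite_support:
  assumes "finite F" "F \<subseteq> I"
  shows "(\<lambda>x. if x \<in> F then f x else 0) \<in> ell2 I"
proof -
  have "(\<lambda>x. (cmod (if x \<in> F then f x else 0))\<^sup>2) summable_on UNIV
      \<longleftrightarrow> (\<lambda>x. (cmod (f x))\<^sup>2) summable_on F"
    by (rule summable_on_cong_neutral) auto
  then show ?thesis
    using assms by (auto simp: ell2_iff)
qed

lemma ket_ell2: "n \<in> I \<Longrightarrow> ket n \<in> ell2 I"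
  using ell2_finite_support[of "{n}" I "\<lambda>_. 1"] by (simp add: ket_def cong: if_cong)

section \<open>The inner product\<close>

lemma ip_abs_summable:
  assumes "f \<in> ell2 I" "g \<in> ell2 J"
  shows "(\<lambda>x. cmod (cnj (f x) * g x)) summable_on UNIV"
proof (rule summable_on_comparison_test)
  show "(\<lambda>x. (cmod (f x))\<^sup>2 + (cmod (g x))\<^sup>2) summable_on UNIV"
    by (intro summable_on_add ell2_summable[OF assms(1)] ell2_summable[OF assms(2)])
  show "cmod (cnj (f x) * g x) \<le> (cmod (f x))\<^sup>2 + (cmod (g x))\<^sup>2" for x
  proof -
    have "2 * (cmod (f x) * cmod (g x)) \<le> (cmod (f x))\<^sup>2 + (cmod (g x))\<^sup>2"
      using sum_squares_bound[of "cmod (f x)" "cmod (g x)"] by simp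
    moreover have "0 \<le> cmod (f x) * cmod (g x)"
      by simp
    ultimately show ?thesis
      unfolding norm_mult complex_mod_cnj by linarith
  qed
qed auto

lemma ip_summable: "f \<in> ell2 I \<Longrightarrow> g \<in> ell2 J \<Longrightarrow> (\<lambda>x. cnj (f x) * g x) summable_on UNIV"
  using ip_abs_summable by (blast intro: abs_summable_summable)

lemma ip_lin_right:
  assumes "h \<in> ell2 I" "f \<in> ell2 I" "g \<in> ell2 I"
  shows "ip h (\<lambda>x. a * f x + g x) = a * ip h f + ip h g"
proof -
  have "ip h (\<lambda>x. a * f x + g x) = (\<Sum>\<^sub>\<infinity>x. a * (cnj (h x) * f x) + cnj (h x) * g x)"
    unfolding ip_def by (rule infsum_cong) (simp add: algebra_simps)
  also have "\<dots> = (\<Sum>\<^sub>\<infinity>x. a * (cnj (h x) * f x)) + (\<Sum>\<^sub>\<infinity>x. cnj (h x) * g x)"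
    by (intro infsum_add summable_on_cmult_right ip_summable[OF assms(1,2)]
        ip_summable[OF assms(1,3)])
  also have "\<dots> = a * ip h f + ip h g"
    unfolding ip_def by (simp add: infsum_cmult_right')
  finally show ?thesis .
qed

lemma ip_cnj: "cnj (ip f g) = ip g f"
proof -
  have "cnj (ip f g) = (\<Sum>\<^sub>\<infinity>x. cnj (cnj (f x) * g x))"
    unfolding ip_def by (rule infsum_cnj[symmetric])
  also have "\<dots> = ip g f"
    unfolding ip_def by (rule infsum_cong) (simp add: mult.commute)
  finally show ?thesis .
qed

lemma ip_lin_left:
  assumes "h \<in> ell2 I" "f \<in> ell2 I" "g \<in> ell2 I"
  shows "ip (\<lambda>x. a * f x + g x) h = cnj a * ip f h + ip g h"
  using arg_cong[OF ip_lin_right[OF assms, of a], of cnj] by (simp add: ip_cnj)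

lemma ip_zero [simp]: "ip f (\<lambda>_. 0) = 0" "ip (\<lambda>_. 0) f = 0"
  by (simp_all add: ip_def)

lemma ip_scale_right: "ip h (\<lambda>x. a * f x) = a * ip h f"
  by (simp add: ip_def infsum_cmult_right' mult.left_commute)

lemma ip_scale_left: "ip (\<lambda>x. a * f x) h = cnj a * ip f h"
  using arg_cong[OF ip_scale_right[of h a f], of cnj] by (simp add: ip_cnj)

lemma ip_add_right:
  "h \<in> ell2 I \<Longrightarrow> f \<in> ell2 I \<Longrightarrow> g \<in> ell2 I \<Longrightarrow> ip h (\<lambda>x. f x + g x) = ip h f + ip h g"
  using ip_lin_right[of h I f g 1] by simp

lemma ip_add_left:
  "h \<in> ell2 I \<Longrightarrow> f \<in> ell2 I \<Longrightarrow> g \<in> ell2 I \<Longrightarrow> ip (\<lambda>x. f x + g x) h = ip f h + ip g h"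
  using ip_lin_left[of h I f g 1] by simp

lemma ip_diff_right:
  "h \<in> ell2 I \<Longrightarrow> f \<in> ell2 I \<Longrightarrow> g \<in> ell2 I \<Longrightarrow> ip h (\<lambda>x. f x - g x) = ip h f - ip h g"
  using ip_lin_right[of h I g f "-1"] by simp

lemma ip_sum_right:
  assumes "h \<in> ell2 I" "\<And>i. i \<in> X \<Longrightarrow> f i \<in> ell2 I"
  shows "ip h (\<lambda>x. \<Sum>i\<in>X. f i x) = (\<Sum>i\<in>X. ip h (f i))"
  using assms(2)
proof (induction X rule: infinite_finite_induct)
  case (insert i X)
  have "ip h (\<lambda>x. f i x + (\<Sum>i\<in>X. f i x)) = ip h (f i) + ip h (\<lambda>x. \<Sum>i\<in>X. f i x)"
    by (rule ip_add_right[OF assms(1)]) (auto intro: insert.prems ell2_sum)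
  with insert show ?case
    by simp
qed auto

lemma ip_sum_left:
  assumes "h \<in> ell2 I" "\<And>i. i \<in> X \<Longrightarrow> f i \<in> ell2 I"
  shows "ip (\<lambda>x. \<Sum>i\<in>X. f i x) h = (\<Sum>i\<in>X. ip (f i) h)"
  using arg_cong[where f = cnj, OF ip_sum_right[OF assms]] by (simp add: ip_cnj)

lemma ip_finite_support:
  assumes "finite F" "\<And>x. x \<notin> F \<Longrightarrow> cnj (f x) * g x = 0"
  shows "ip f g = (\<Sum>x\<in>F. cnj (f x) * g x)"
proof -
  have "ip f g = (\<Sum>\<^sub>\<infinity>x\<in>F. cnj (f x) * g x)"
    unfolding ip_def by (rule infsum_cong_neutral) (use assms(2) in auto)
  then show ?thesis
    using assms(1) by simp
qed

lemma ip_ket_left: "ip (ket n) f = f n"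
  using ip_finite_support[of "{n}" "ket n" f] by (simp add: ket_def)

lemma ip_ket_right: "ip f (ket n) = cnj (f n)"
  using ip_finite_support[of "{n}" f "ket n"] by (simp add: ket_def)

lemma ell2_eqI:
  assumes "f \<in> ell2 I" "g \<in> ell2 I" "\<And>h. h \<in> ell2 I \<Longrightarrow> ip h f = ip h g"
  shows "f = g"
proof
  show "f x = g x" for x
    using assms(3)[OF ket_ell2, of x] ell2_outside[OF assms(1), of x] ell2_outside[OF assms(2), of x]
    by (cases "x \<in> I") (auto simp: ip_ket_left)
qed

section \<open>The norm\<close>

lemma l2norm_nonneg [simp]: "0 \<le> l2norm f"
  by (simp add: l2norm_def infsum_nonneg)

lemma l2norm_zero [simp]: "l2norm (\<lambda>_. 0) = 0"
  by (simp add: l2norm_def)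

lemma l2norm_sq: "(l2norm f)\<^sup>2 = (\<Sum>\<^sub>\<infinity>x. (cmod (f x))\<^sup>2)"
  by (simp add: l2norm_def infsum_nonneg)

lemma cmod_sq_eq: "cnj z * z = of_real ((cmod z)\<^sup>2)"
  by (metis complex_norm_square mult.commute)

lemma ip_self:
  assumes "f \<in> ell2 I"
  shows "ip f f = of_real ((l2norm f)\<^sup>2)"
proof -
  have "((\<lambda>x. (cmod (f x))\<^sup>2) has_sum (l2norm f)\<^sup>2) UNIV"
    unfolding l2norm_sq using ell2_summable[OF assms] by simp
  then have "((\<lambda>x. complex_of_real ((cmod (f x))\<^sup>2)) has_sum of_real ((l2norm f)\<^sup>2)) UNIV"
    by (rule has_sum_of_real)
  then show ?thesis
    unfolding ip_def cmod_sq_eq by (rule infsumI)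
qed

lemma l2norm_sq_finite_support:
  assumes "finite F"
  shows "(l2norm (\<lambda>x. if x \<in> F then f x else 0))\<^sup>2 = (\<Sum>x\<in>F. (cmod (f x))\<^sup>2)"
proof -
  have "(\<Sum>\<^sub>\<infinity>x. (cmod (if x \<in> F then f x else 0))\<^sup>2) = (\<Sum>\<^sub>\<infinity>x\<in>F. (cmod (f x))\<^sup>2)"
    by (rule infsum_cong_neutral) auto
  then show ?thesis
    using assms by (simp add: l2norm_sq)
qed

lemma sum_sq_le_l2norm:
  assumes "f \<in> ell2 I" "finite F"
  shows "(\<Sum>x\<in>F. (cmod (f x))\<^sup>2) \<le> (l2norm f)\<^sup>2"
  unfolding l2norm_sq by (rule finite_sum_le_infsum) (use assms ell2_summable in auto)

lemma l2norm_ket [simp]: "l2norm (ket n) = 1"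
proof -
  have "ip (ket n) (ket n) = 1"
    by (simp add: ip_ket_left) (simp add: ket_def)
  then have "(l2norm (ket n))\<^sup>2 = 1"
    by (metis UNIV_I ip_self ket_ell2 of_real_eq_1_iff)
  then show ?thesis
    using l2norm_nonneg[of "ket n"] by (simp add: power2_eq_1_iff)
qed

lemma l2norm_scale: "l2norm (\<lambda>x. a * f x) = cmod a * l2norm f"
proof -
  have "(l2norm (\<lambda>x. a * f x))\<^sup>2 = (cmod a * l2norm f)\<^sup>2"
    by (simp add: l2norm_sq norm_mult power_mult_distrib infsum_cmult_right')
  then show ?thesis
    by simp
qed

text \<open>The discriminant argument, detached from any inner product: \<open>a\<close>,
  \<open>z\<close> and \<open>b\<close> stand for the values of a nonnegative sesquilinear form on
  (f, f), (f, g) and (g, g), and the assumption is its value at t f + g. It is meant for the form of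
  a positive operator, where \<open>a\<close> may vanish at a nonzero vector.\<close>

lemma cauchy_schwarz_aux:
  fixes z :: complex and a b :: real
  assumes "\<And>t. 0 \<le> Re (cnj t * t * a + cnj t * z + t * cnj z + b)" "0 \<le> a" "0 \<le> b"
  shows "(cmod z)\<^sup>2 \<le> a * b"
proof -
  have zz: "z * cnj z = of_real ((cmod z)\<^sup>2)" "cnj z * z = of_real ((cmod z)\<^sup>2)"
    using cmod_sq_eq[of z] by (simp_all add: mult.commute)
  have key: "0 \<le> s\<^sup>2 * (cmod z)\<^sup>2 * a - 2 * s * (cmod z)\<^sup>2 + b" for s :: real
  proof -
    \<comment> \<open>Giving \<open>t\<close> the phase of \<open>z\<close> makes both cross terms
      real, which leaves a real quadratic in \<open>s\<close>.\<close>
    let ?t = "- of_real s * z"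
    have "cnj ?t * ?t * a + cnj ?t * z + ?t * cnj z + b
        = of_real (s\<^sup>2 * a) * (cnj z * z) - of_real s * (cnj z * z) - of_real s * (z * cnj z) + b"
      by (simp add: power2_eq_square)
    also have "\<dots> = of_real (s\<^sup>2 * (cmod z)\<^sup>2 * a - 2 * s * (cmod z)\<^sup>2 + b)"
      unfolding zz by simp
    finally show ?thesis
      using assms(1)[of ?t] by (metis Re_complex_of_real)
  qed
  show ?thesis
  proof (cases "a = 0")
    case True
    have "z = 0"
    proof (rule ccontr)
      assume "z \<noteq> 0"
      \<comment> \<open>With \<open>a = 0\<close> the quadratic is linear in \<open>s\<close> with
        negative slope; at the chosen \<open>s\<close> its value is \<open>- b - 2\<close>.\<close>
      then show False
        using key[of "(b + 1) / (cmod z)\<^sup>2"] True assms(3) by simp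
    qed
    then show ?thesis
      using True by simp
  next
    case False
    \<comment> \<open>The quadratic is minimal at \<open>s = 1 / a\<close>.\<close>
    then show ?thesis
      using key[of "1 / a"] assms(2) by (simp add: field_simps power2_eq_square)
  qed
qed

section \<open>Bounded operators and adjoints\<close>

lemma bop_ell2: "A \<in> bop I \<Longrightarrow> f \<in> ell2 I \<Longrightarrow> A f \<in> ell2 I"
  by (simp add: bop_def)

lemma bop_lin:
  "A \<in> bop I \<Longrightarrow> f \<in> ell2 I \<Longrightarrow> g \<in> ell2 I
    \<Longrightarrow> A (\<lambda>x. a * f x + g x) = (\<lambda>x. a * A f x + A g x)"
  by (simp add: bop_def)

lemma bop_outside: "A \<in> bop I \<Longrightarrow> f \<notin> ell2 I \<Longrightarrow> A f = (\<lambda>_. 0)"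
  by (simp add: bop_def)

lemma bop_bound:
  assumes "A \<in> bop I"
  obtains K where "0 \<le> K" "\<And>f. f \<in> ell2 I \<Longrightarrow> l2norm (A f) \<le> K * l2norm f"
proof -
  obtain K where K: "\<And>f. f \<in> ell2 I \<Longrightarrow> l2norm (A f) \<le> K * l2norm f"
    using assms unfolding bop_def by blast
  have "l2norm (A f) \<le> \<bar>K\<bar> * l2norm f" if "f \<in> ell2 I" for f
    using K[OF that] mult_right_mono[OF abs_ge_self l2norm_nonneg, of K f] by linarith
  then show thesis
    using that[of "\<bar>K\<bar>"] by simp
qed

lemma bopI:
  assumes "\<And>f. f \<in> ell2 I \<Longrightarrow> A f \<in> ell2 I"
    and "\<And>a f g. f \<in> ell2 I \<Longrightarrow> g \<in> ell2 I \<Longrightarrow> A (\<lambda>x. a * f x + g x) = (\<lambda>x. a * A f x + A g x)"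
    and "\<And>f. f \<in> ell2 I \<Longrightarrow> l2norm (A f) \<le> K * l2norm f"
    and "\<And>f. f \<notin> ell2 I \<Longrightarrow> A f = (\<lambda>_. 0)"
  shows "A \<in> bop I"
  using assms unfolding bop_def by blast

lemma bop_eqI:
  assumes "A \<in> bop I" "C \<in> bop I" "\<And>f. f \<in> ell2 I \<Longrightarrow> A f = C f"
  shows "A = C"
proof
  show "A f = C f" for f
    using assms bop_outside[of _ I f] by (cases "f \<in> ell2 I") auto
qed

lemma bop_zero_vec: "A \<in> bop I \<Longrightarrow> A (\<lambda>_. 0) = (\<lambda>_. 0)"
  using bop_lin[of A I "\<lambda>_. 0" "\<lambda>_. 0" "-1"] by simp

lemma bop_scale: "A \<in> bop I \<Longrightarrow> f \<in> ell2 I \<Longrightarrow> A (\<lambda>x. a * f x) = (\<lambda>x. a * A f x)"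
  using bop_lin[of A I f "\<lambda>_. 0" a] by (simp add: bop_zero_vec)

lemma bop_add:
  "A \<in> bop I \<Longrightarrow> f \<in> ell2 I \<Longrightarrow> g \<in> ell2 I \<Longrightarrow> A (\<lambda>x. f x + g x) = (\<lambda>x. A f x + A g x)"
  using bop_lin[of A I f g 1] by simp

lemma bop_diff:
  "A \<in> bop I \<Longrightarrow> f \<in> ell2 I \<Longrightarrow> g \<in> ell2 I \<Longrightarrow> A (\<lambda>x. f x - g x) = (\<lambda>x. A f x - A g x)"
  using bop_lin[of A I g f "-1"] by simp

lemma bop_sum:
  assumes "A \<in> bop I" "\<And>i. i \<in> X \<Longrightarrow> f i \<in> ell2 I"
  shows "A (\<lambda>x. \<Sum>i\<in>X. f i x) = (\<lambda>x. \<Sum>i\<in>X. A (f i) x)"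
  using assms(2)
proof (induction X rule: infinite_finite_induct)
  case (insert i X)
  have "A (\<lambda>x. f i x + (\<Sum>i\<in>X. f i x)) = (\<lambda>x. A (f i) x + A (\<lambda>x. \<Sum>i\<in>X. f i x) x)"
    by (rule bop_add[OF assms(1)]) (auto intro: insert.prems ell2_sum)
  with insert show ?case
    by simp
qed (auto simp: bop_zero_vec[OF assms(1)])

lemma idop_bop: "idop I \<in> bop I"
  by (rule bopI[where K = 1]) (auto simp: idop_def ell2_lin)

lemma zero_bop: "(\<lambda>_ _. 0) \<in> bop I"
  by (rule bopI[where K = 0]) auto

lemma bop_comp:
  assumes "A \<in> bop I" "C \<in> bop I"
  shows "A \<circ> C \<in> bop I"
proof -
  obtain K where K: "0 \<le> K" "\<And>f. f \<in> ell2 I \<Longrightarrow> l2norm (A f) \<le> K * l2norm f"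
    using assms(1) by (rule bop_bound) blast
  obtain L where L: "0 \<le> L" "\<And>f. f \<in> ell2 I \<Longrightarrow> l2norm (C f) \<le> L * l2norm f"
    using assms(2) by (rule bop_bound) blast
  show ?thesis
  proof (rule bopI[where K = "K * L"])
    show "l2norm ((A \<circ> C) f) \<le> K * L * l2norm f" if "f \<in> ell2 I" for f
      using K(2)[OF bop_ell2[OF assms(2) that]] mult_left_mono[OF L(2)[OF that] K(1)]
      by (simp add: mult.assoc)
  qed (use assms in \<open>auto simp: bop_ell2 bop_lin bop_outside bop_zero_vec\<close>)
qed

section \<open>Positive operators and the Cauchy-Schwarz inequality\<close>

lemma positive_bop: "positive I A \<Longrightarrow> A \<in> bop I"
  by (simp add: positive_def)

lemma positive_Im: "positive I A \<Longrightarrow> f \<in> ell2 I \<Longrightarrow> Im (ip f (A f)) = 0"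
  by (auto simp: positive_def complex_is_Real_iff)

lemma positive_Re: "positive I A \<Longrightarrow> f \<in> ell2 I \<Longrightarrow> 0 \<le> Re (ip f (A f))"
  by (auto simp: positive_def)

lemma positive_of_real: "positive I A \<Longrightarrow> f \<in> ell2 I \<Longrightarrow> ip f (A f) = of_real (Re (ip f (A f)))"
  using positive_Im by (simp add: complex_eq_iff)

lemma ip_quadratic:
  assumes "A \<in> bop I" "f \<in> ell2 I" "g \<in> ell2 I"
  shows "ip (\<lambda>x. t * f x + g x) (A (\<lambda>x. t * f x + g x))
    = cnj t * t * ip f (A f) + cnj t * ip f (A g) + t * ip g (A f) + ip g (A g)"
proof -
  note A = bop_ell2[OF assms(1)]
  show ?thesis
    unfolding bop_lin[OF assms] ip_lin_left[OF ell2_lin[OF A[OF assms(2)] A[OF assms(3)]] assms(2,3)]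
      ip_lin_right[OF assms(2) A[OF assms(2)] A[OF assms(3)]]
      ip_lin_right[OF assms(3) A[OF assms(2)] A[OF assms(3)]]
    by (simp add: algebra_simps)
qed

lemma positive_herm:
  assumes "positive I A" "f \<in> ell2 I" "g \<in> ell2 I"
  shows "ip f (A g) = ip (A f) g"
proof -
  have Im0: "Im (cnj t * t * ip f (A f) + cnj t * ip f (A g) + t * ip g (A f) + ip g (A g)) = 0" for t
    using positive_Im[OF assms(1) ell2_lin[OF assms(2,3), of t]]
      ip_quadratic[OF positive_bop[OF assms(1)] assms(2,3), of t] by simp
  \<comment> \<open>Polarisation: the value at \<open>t = 1\<close> compares the imaginary parts,
    the value at \<open>t = \<i>\<close> the real parts.\<close>
  have "ip g (A f) = cnj (ip f (A g))"
    using Im0[of 1] Im0[of \<i>] positive_Im[OF assms(1,2)] positive_Im[OF assms(1,3)]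
    by (simp add: complex_eq_iff)
  then show ?thesis
    by (metis complex_cnj_cnj ip_cnj)
qed

lemma positive_cauchy_schwarz:
  assumes "positive I A" "f \<in> ell2 I" "g \<in> ell2 I"
  shows "(cmod (ip f (A g)))\<^sup>2 \<le> Re (ip f (A f)) * Re (ip g (A g))"
proof (rule cauchy_schwarz_aux)
  fix t
  have "ip g (A f) = cnj (ip f (A g))"
    using positive_herm[OF assms] by (simp add: ip_cnj)
  then have "cnj t * t * of_real (Re (ip f (A f))) + cnj t * ip f (A g) + t * cnj (ip f (A g))
      + of_real (Re (ip g (A g))) = ip (\<lambda>x. t * f x + g x) (A (\<lambda>x. t * f x + g x))"
    using ip_quadratic[OF positive_bop[OF assms(1)] assms(2,3), of t]
      positive_of_real[OF assms(1,2)] positive_of_real[OF assms(1,3)] by simp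
  then show "0 \<le> Re (cnj t * t * of_real (Re (ip f (A f))) + cnj t * ip f (A g)
      + t * cnj (ip f (A g)) + of_real (Re (ip g (A g))))"
    using positive_Re[OF assms(1) ell2_lin[OF assms(2,3)]] by simp
qed (use assms positive_Re in auto)

lemma positive_idop: "positive I (idop I)"
  unfolding positive_def by (auto simp: idop_bop) (simp_all add: idop_def ip_self)

lemma cauchy_schwarz:
  assumes "f \<in> ell2 I" "g \<in> ell2 I"
  shows "cmod (ip f g) \<le> l2norm f * l2norm g"
proof -
  have "(cmod (ip f g))\<^sup>2 \<le> (l2norm f * l2norm g)\<^sup>2"
    using positive_cauchy_schwarz[OF positive_idop assms] assms
    by (simp add: idop_def ip_self power_mult_distrib)
  then show ?thesis
    by (rule power2_le_imp_le) simp
qed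

lemma l2norm_sq_add:
  assumes "f \<in> ell2 I" "g \<in> ell2 I"
  shows "(l2norm (\<lambda>x. f x + g x))\<^sup>2 = (l2norm f)\<^sup>2 + 2 * Re (ip f g) + (l2norm g)\<^sup>2"
proof -
  note fg = ell2_add[OF assms]
  have "complex_of_real ((l2norm (\<lambda>x. f x + g x))\<^sup>2) = ip f f + (ip f g + cnj (ip f g)) + ip g g"
    unfolding ip_self[OF fg, symmetric]
    by (simp add: ip_add_left[OF fg assms] ip_add_right[OF _ assms] assms ip_cnj)
  also have "\<dots> = of_real ((l2norm f)\<^sup>2 + 2 * Re (ip f g) + (l2norm g)\<^sup>2)"
    by (simp add: ip_self[OF assms(1)] ip_self[OF assms(2)] complex_add_cnj)
  finally show ?thesis
    by (simp only: of_real_eq_iff)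
qed

lemma l2norm_triangle:
  assumes "f \<in> ell2 I" "g \<in> ell2 I"
  shows "l2norm (\<lambda>x. f x + g x) \<le> l2norm f + l2norm g"
proof (rule power2_le_imp_le)
  have "Re (ip f g) \<le> l2norm f * l2norm g"
    using complex_Re_le_cmod[of "ip f g"] cauchy_schwarz[OF assms] by linarith
  then show "(l2norm (\<lambda>x. f x + g x))\<^sup>2 \<le> (l2norm f + l2norm g)\<^sup>2"
    unfolding l2norm_sq_add[OF assms] power2_sum by simp
qed simp

lemma cmod_le_l2norm: "f \<in> ell2 I \<Longrightarrow> cmod (f x) \<le> l2norm f"
  using cauchy_schwarz[of "ket x" I f] ell2_outside[of f I x]
  by (cases "x \<in> I") (auto simp: ip_ket_left ket_ell2)

text \<open>Density of the vectors of finite support. The limit is along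
  \<open>finite_subsets_at_top\<close>, the filter behind \<open>infsum\<close>, because the squared
  norm of the difference is the total minus a finite partial sum. Later extensions from finite
  support to arbitrary vectors rest on it.\<close>

lemma truncation_tendsto:
  assumes "f \<in> ell2 I"
  shows "((\<lambda>F. l2norm (\<lambda>x. f x - (if x \<in> F then f x else 0))) \<longlongrightarrow> 0) (finite_subsets_at_top I)"
proof -
  have eq: "(l2norm (\<lambda>x. f x - (if x \<in> F then f x else 0)))\<^sup>2
      = (l2norm f)\<^sup>2 - (\<Sum>x\<in>F. (cmod (f x))\<^sup>2)" if F: "finite F" "F \<subseteq> I" for F
  proof -
    note tr = ell2_finite_support[OF F, of f]
    have "(l2norm f)\<^sup>2 = (\<Sum>\<^sub>\<infinity>x. (cmod (f x - (if x \<in> F then f x else 0)))\<^sup>2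
        + (cmod (if x \<in> F then f x else 0))\<^sup>2)"
      unfolding l2norm_sq by (rule infsum_cong) auto
    also have "\<dots> = (l2norm (\<lambda>x. f x - (if x \<in> F then f x else 0)))\<^sup>2
        + (l2norm (\<lambda>x. if x \<in> F then f x else 0))\<^sup>2"
      unfolding l2norm_sq
      by (intro infsum_add ell2_summable[OF ell2_diff[OF assms tr]] ell2_summable[OF tr])
    finally show ?thesis
      by (simp add: l2norm_sq_finite_support[OF F(1)])
  qed
  have "((\<lambda>F. \<Sum>x\<in>F. (cmod (f x))\<^sup>2) \<longlongrightarrow> (\<Sum>\<^sub>\<infinity>x\<in>I. (cmod (f x))\<^sup>2)) (finite_subsets_at_top I)"
    by (rule infsum_tendsto) (use assms in \<open>simp add: ell2_def\<close>)
  moreover have "(\<Sum>\<^sub>\<infinity>x\<in>I. (cmod (f x))\<^sup>2) = (l2norm f)\<^sup>2"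
    unfolding l2norm_sq by (rule infsum_cong_neutral) (use ell2_outside[OF assms] in auto)
  ultimately have "((\<lambda>F. (l2norm f)\<^sup>2 - (\<Sum>x\<in>F. (cmod (f x))\<^sup>2)) \<longlongrightarrow> (l2norm f)\<^sup>2 - (l2norm f)\<^sup>2)
      (finite_subsets_at_top I)"
    by (intro tendsto_diff tendsto_const) simp
  then have "((\<lambda>F. sqrt ((l2norm f)\<^sup>2 - (\<Sum>x\<in>F. (cmod (f x))\<^sup>2))) \<longlongrightarrow> 0) (finite_subsets_at_top I)"
    using tendsto_real_sqrt by fastforce
  moreover have "\<forall>\<^sub>F F in finite_subsets_at_top I.
      sqrt ((l2norm f)\<^sup>2 - (\<Sum>x\<in>F. (cmod (f x))\<^sup>2)) = l2norm (\<lambda>x. f x - (if x \<in> F then f x else 0))"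
    by (rule eventually_finite_subsets_at_top_weakI) (simp add: eq[symmetric])
  ultimately show ?thesis
    by (rule Lim_transform_eventually)
qed

lemma truncation_ket_sum:
  assumes "finite F"
  shows "(\<lambda>x. if x \<in> F then f x else 0) = (\<lambda>x. \<Sum>y\<in>F. f y * ket y x)"
proof
  show "(if x \<in> F then f x else 0) = (\<Sum>y\<in>F. f y * ket y x)" for x
    using sum.delta'[OF assms, of x f] by (simp add: ket_def if_distrib cong: if_cong)
qed

text \<open>Stated for functionals so that it applies to a single entry of a difference of two
  operators and, in \<open>adjoint_exists\<close>, to a difference of inner products as a function
  of the second argument.\<close>

lemma bounded_functional_zero:
  assumes lin: "\<And>a f g. f \<in> ell2 I \<Longrightarrow> g \<in> ell2 I \<Longrightarrow> \<phi> (\<lambda>x. a * f x + g x) = a * \<phi> f + \<phi> g"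
    and bnd: "\<And>f. f \<in> ell2 I \<Longrightarrow> cmod (\<phi> f) \<le> K * l2norm f"
    and ket: "\<And>n. n \<in> I \<Longrightarrow> \<phi> (ket n) = (0 :: complex)"
    and f: "f \<in> ell2 I"
  shows "\<phi> f = 0"
proof -
  let ?t = "\<lambda>F x. if x \<in> F then f x else 0"
  have zero: "\<phi> (\<lambda>_. 0) = 0"
    using lin[of "\<lambda>_. 0" "\<lambda>_. 0" "-1"] by simp
  have sum0: "\<phi> (?t F) = 0" if F: "finite F" "F \<subseteq> I" for F
    using F
  proof (induction F)
    case empty
    then show ?case
      using zero by simp
  next
    case (insert y F)
    have "(\<lambda>x. if x \<in> insert y F then f x else 0) = (\<lambda>x. f y * ket y x + ?t F x)"
      using insert.hyps(2) by (auto simp: ket_def)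
    moreover have "\<phi> \<dots> = f y * \<phi> (ket y) + \<phi> (?t F)"
      by (rule lin) (use insert in \<open>auto intro: ket_ell2 ell2_finite_support\<close>)
    ultimately show ?case
      using insert ket by simp
  qed
  \<comment> \<open>\<open>\<phi>\<close> vanishes on the truncation, so its value at
    \<open>f\<close> is its value at the tail, which boundedness makes small.\<close>
  have "cmod (\<phi> f) \<le> K * l2norm (\<lambda>x. f x - ?t F x)" if F: "finite F" "F \<subseteq> I" for F
  proof -
    note tr = ell2_finite_support[OF F, of f]
    have "\<phi> (\<lambda>x. f x - ?t F x) = \<phi> f"
      using lin[OF tr f, of "-1"] sum0[OF F] by simp
    then show ?thesis
      using bnd[OF ell2_diff[OF f tr]] by simp
  qed
  then have "\<forall>\<^sub>F F in finite_subsets_at_top I. cmod (\<phi> f) \<le> K * l2norm (\<lambda>x. f x - ?t F x)"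
    by (intro eventually_finite_subsets_at_top_weakI) auto
  moreover have "((\<lambda>F. K * l2norm (\<lambda>x. f x - ?t F x)) \<longlongrightarrow> 0) (finite_subsets_at_top I)"
    using tendsto_mult_right_zero[OF truncation_tendsto[OF f]] .
  ultimately have "cmod (\<phi> f) \<le> 0"
    by (intro tendsto_lowerbound) auto
  then show ?thesis
    by simp
qed

lemma bop_eq_on_kets:
  assumes "A \<in> bop I" "C \<in> bop I" "\<And>n. n \<in> I \<Longrightarrow> A (ket n) = C (ket n)"
  shows "A = C"
proof (rule bop_eqI[OF assms(1,2)], rule ext)
  fix f x
  assume f: "f \<in> ell2 I"
  obtain K where K: "\<And>f. f \<in> ell2 I \<Longrightarrow> l2norm (A f) \<le> K * l2norm f"
    using assms(1) by (rule bop_bound) blast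
  obtain L where L: "\<And>f. f \<in> ell2 I \<Longrightarrow> l2norm (C f) \<le> L * l2norm f"
    using assms(2) by (rule bop_bound) blast
  have "A f x - C f x = 0"
  proof (rule bounded_functional_zero[where \<phi> = "\<lambda>f. A f x - C f x" and K = "K + L", OF _ _ _ f])
    show "cmod (A f x - C f x) \<le> (K + L) * l2norm f" if "f \<in> ell2 I" for f
      using norm_triangle_ineq4[of "A f x" "C f x"] K[OF that] L[OF that]
        cmod_le_l2norm[OF bop_ell2[OF assms(1) that], of x]
        cmod_le_l2norm[OF bop_ell2[OF assms(2) that], of x]
      by (simp add: algebra_simps)
    show "A (\<lambda>x. a * f x + g x) x - C (\<lambda>x. a * f x + g x) x = a * (A f x - C f x) + (A g x - C g x)"
      if "f \<in> ell2 I" "g \<in> ell2 I" for a f g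
      unfolding bop_lin[OF assms(1) that] bop_lin[OF assms(2) that] by (simp add: algebra_simps)
  qed (use assms in auto)
  then show "A f x = C f x"
    by simp
qed

text \<open>A converse of Cauchy-Schwarz, tested only on the truncations of \<open>f\<close> itself,
  since \<open>f\<close> is not yet known to be square-summable. The assumption reads n^2 \<le> C n
  for the norm n of a truncation, hence n \<le> C, and this bound is uniform in the finite
  set.\<close>

lemma ell2_dualI:
  assumes "\<And>x. x \<notin> I \<Longrightarrow> f x = 0" "0 \<le> C"
    and "\<And>X. finite X \<Longrightarrow> X \<subseteq> I \<Longrightarrow>
      (\<Sum>x\<in>X. (cmod (f x))\<^sup>2) \<le> C * l2norm (\<lambda>x. if x \<in> X then f x else 0)"
  shows "f \<in> ell2 I" "l2norm f \<le> C"
proof -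
  have le: "(\<Sum>x\<in>X. (cmod (f x))\<^sup>2) \<le> C\<^sup>2" if X: "finite X" for X
  proof -
    let ?n = "l2norm (\<lambda>x. if x \<in> X \<inter> I then f x else 0)"
    have "?n\<^sup>2 \<le> C * ?n"
      using assms(3)[of "X \<inter> I"] X l2norm_sq_finite_support[of "X \<inter> I" f] by simp
    then have "?n \<le> C"
      using assms(2) l2norm_nonneg[of "\<lambda>x. if x \<in> X \<inter> I then f x else 0"]
      by (metis less_eq_real_def mult_right_le_imp_le power2_eq_square)
    then have "?n\<^sup>2 \<le> C\<^sup>2"
      by (simp add: power_mono)
    moreover have "(\<Sum>x\<in>X. (cmod (f x))\<^sup>2) = (\<Sum>x\<in>X \<inter> I. (cmod (f x))\<^sup>2)"
      by (rule sum.mono_neutral_right) (use X assms(1) in auto)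
    ultimately show ?thesis
      using l2norm_sq_finite_support[of "X \<inter> I" f] X by simp
  qed
  have sm: "(\<lambda>x. (cmod (f x))\<^sup>2) summable_on UNIV"
    by (rule nonneg_bounded_partial_sums_imp_summable_on[where C = "C\<^sup>2"])
      (auto intro!: eventually_finite_subsets_at_top_weakI le)
  then show "f \<in> ell2 I"
    using assms(1) by (simp add: ell2_iff)
  have "(l2norm f)\<^sup>2 \<le> C\<^sup>2"
    unfolding l2norm_sq by (rule infsum_le_finite_sums[OF sm]) (use le in auto)
  then show "l2norm f \<le> C"
    using assms(2) by (rule power2_le_imp_le)
qed

text \<open>The entry of \<open>A' f\<close> at \<open>x\<close> has to be the inner product of
  \<open>A (ket x)\<close> with \<open>f\<close>, so \<open>A'\<close> can be written down; what
  needs proof is that these entries are square-summable. For a truncation \<open>?h\<close> of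
  \<open>A' f\<close>, linearity makes the squared norm of \<open>?h\<close> equal to the inner
  product of \<open>A ?h\<close> with \<open>f\<close>, and then \<open>ell2_dualI\<close>
  applies.\<close>

lemma adjoint_exists:
  assumes A: "A \<in> bop I"
  shows "\<exists>A'. A' \<in> bop I \<and> (\<forall>f\<in>ell2 I. \<forall>g\<in>ell2 I. ip (A' f) g = ip f (A g))"
proof -
  define A' where "A' f = (\<lambda>x. if f \<in> ell2 I \<and> x \<in> I then ip (A (ket x)) f else 0)" for f
  obtain K where K: "0 \<le> K" "\<And>f. f \<in> ell2 I \<Longrightarrow> l2norm (A f) \<le> K * l2norm f"
    using A by (rule bop_bound) blast
  note AI = bop_ell2[OF A]
  have bnd: "A' f \<in> ell2 I" "l2norm (A' f) \<le> K * l2norm f" if f: "f \<in> ell2 I" for f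
  proof -
    have dual: "(\<Sum>x\<in>X. (cmod (A' f x))\<^sup>2) \<le> K * l2norm f * l2norm (\<lambda>x. if x \<in> X then A' f x else 0)"
      if X: "finite X" "X \<subseteq> I" for X
    proof -
      let ?h = "\<lambda>x. if x \<in> X then A' f x else 0"
      note h = ell2_finite_support[OF X, of "A' f"]
      have k: "ket x \<in> ell2 I" if "x \<in> X" for x
        by (rule ket_ell2) (use that X in auto)
      have Ah: "A ?h = (\<lambda>x. \<Sum>y\<in>X. A' f y * A (ket y) x)"
        unfolding truncation_ket_sum[OF X(1)]
        by (subst bop_sum[OF A]) (use k in \<open>auto simp: bop_scale[OF A] intro: ell2_scale\<close>)
      have "complex_of_real (\<Sum>x\<in>X. (cmod (A' f x))\<^sup>2) = (\<Sum>x\<in>X. cnj (A' f x) * ip (A (ket x)) f)"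
        unfolding of_real_sum
        by (rule sum.cong) (use X f in \<open>auto simp: A'_def cmod_sq_eq\<close>)
      also have "\<dots> = ip (A ?h) f"
        unfolding Ah by (subst ip_sum_left[OF f]) (use k in \<open>auto simp: ip_scale_left intro: ell2_scale AI\<close>)
      finally have "(\<Sum>x\<in>X. (cmod (A' f x))\<^sup>2) = Re (ip (A ?h) f)"
        using arg_cong[where f = Re] by (metis Re_complex_of_real)
      also have "\<dots> \<le> cmod (ip (A ?h) f)"
        by (rule complex_Re_le_cmod)
      also have "\<dots> \<le> l2norm (A ?h) * l2norm f"
        by (rule cauchy_schwarz[OF AI[OF h] f])
      also have "\<dots> \<le> K * l2norm ?h * l2norm f"
        by (intro mult_right_mono K(2) h) simp
      finally show ?thesis
        by (simp add: mult_ac)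
    qed
    have out: "A' f x = 0" if "x \<notin> I" for x
      using that by (simp add: A'_def)
    have C: "0 \<le> K * l2norm f"
      using K(1) by simp
    show "A' f \<in> ell2 I"
      by (rule ell2_dualI(1)[OF out C dual])
    show "l2norm (A' f) \<le> K * l2norm f"
      by (rule ell2_dualI(2)[OF out C dual])
  qed
  have "A' \<in> bop I"
  proof (rule bopI[where K = K])
    show "A' (\<lambda>x. a * f x + g x) = (\<lambda>x. a * A' f x + A' g x)"
      if "f \<in> ell2 I" "g \<in> ell2 I" for a f g
    proof
      show "A' (\<lambda>x. a * f x + g x) x = a * A' f x + A' g x" for x
        using ip_lin_right[OF AI[OF ket_ell2] that, of x a] that by (simp add: A'_def ell2_lin)
    qed
  qed (use bnd in \<open>auto simp: A'_def\<close>)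
  moreover have "ip (A' f) g = ip f (A g)" if f: "f \<in> ell2 I" and g: "g \<in> ell2 I" for f g
  proof -
    \<comment> \<open>Both terms are linear and bounded in \<open>g\<close>, and they agree at
      \<open>g = ket n\<close> by the choice of \<open>A'\<close>.\<close>
    have "ip (A' f) g - ip f (A g) = 0"
    proof (rule bounded_functional_zero[where I = I and \<phi> = "\<lambda>g. ip (A' f) g - ip f (A g)"
            and K = "K * l2norm f + K * l2norm f", OF _ _ _ g])
      fix g
      assume g: "g \<in> ell2 I"
      have "cmod (ip (A' f) g) \<le> K * l2norm f * l2norm g"
        using cauchy_schwarz[OF bnd(1)[OF f] g] mult_right_mono[OF bnd(2)[OF f] l2norm_nonneg[of g]]
        by linarith
      moreover have "cmod (ip f (A g)) \<le> l2norm f * (K * l2norm g)"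
        using cauchy_schwarz[OF f AI[OF g]] mult_left_mono[OF K(2)[OF g] l2norm_nonneg[of f]]
        by linarith
      ultimately show "cmod (ip (A' f) g - ip f (A g)) \<le> (K * l2norm f + K * l2norm f) * l2norm g"
        using norm_triangle_ineq4[of "ip (A' f) g" "ip f (A g)"] by (simp add: algebra_simps)
    next
      show "ip (A' f) (\<lambda>x. a * g x + h x) - ip f (A (\<lambda>x. a * g x + h x))
          = a * (ip (A' f) g - ip f (A g)) + (ip (A' f) h - ip f (A h))"
        if "g \<in> ell2 I" "h \<in> ell2 I" for a g h
        unfolding bop_lin[OF A that] ip_lin_right[OF bnd(1)[OF f] that]
          ip_lin_right[OF f AI[OF that(1)] AI[OF that(2)]]
        by (simp add: algebra_simps)
      show "ip (A' f) (ket n) - ip f (A (ket n)) = 0" if "n \<in> I" for n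
        using that f by (simp add: ip_ket_right A'_def ip_cnj)
    qed
    then show ?thesis
      by simp
  qed
  ultimately show ?thesis
    by blast
qed

lemma adj_eqI:
  assumes "A' \<in> bop I" "\<And>f g. f \<in> ell2 I \<Longrightarrow> g \<in> ell2 I \<Longrightarrow> ip (A' f) g = ip f (A g)"
  shows "adj I A = A'"
  unfolding adj_def
proof (rule the_equality)
  fix C
  assume C: "C \<in> bop I \<and> (\<forall>f\<in>ell2 I. \<forall>g\<in>ell2 I. ip (C f) g = ip f (A g))"
  show "C = A'"
  proof (rule bop_eqI)
    show "C f = A' f" if f: "f \<in> ell2 I" for f
    proof (rule ell2_eqI)
      show "ip h (C f) = ip h (A' f)" if "h \<in> ell2 I" for h
        using C assms(2)[OF f that] f that by (metis ip_cnj)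
    qed (use C assms(1) f in \<open>auto intro: bop_ell2\<close>)
  qed (use C assms(1) in auto)
qed (use assms in auto)

lemma
  assumes "A \<in> bop I"
  shows adj_bop: "adj I A \<in> bop I"
    and ip_adj_left: "f \<in> ell2 I \<Longrightarrow> g \<in> ell2 I \<Longrightarrow> ip (adj I A f) g = ip f (A g)"
  using adjoint_exists[OF assms] adj_eqI[of _ I A] by auto

lemma ip_adj_right:
  "A \<in> bop I \<Longrightarrow> f \<in> ell2 I \<Longrightarrow> g \<in> ell2 I \<Longrightarrow> ip f (adj I A g) = ip (A f) g"
  using ip_adj_left[of A I g f] by (metis ip_cnj)

lemma adj_comp:
  assumes "A \<in> bop I" "C \<in> bop I"
  shows "adj I (A \<circ> C) = adj I C \<circ> adj I A"
proof (rule adj_eqI)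
  show "ip ((adj I C \<circ> adj I A) f) g = ip f ((A \<circ> C) g)" if "f \<in> ell2 I" "g \<in> ell2 I" for f g
    using that by (simp add: assms ip_adj_left bop_ell2 adj_bop)
qed (intro bop_comp adj_bop assms)

section \<open>Rank-one operators, sums and differences of operators\<close>

lemma l2norm_eq_0: "f \<in> ell2 I \<Longrightarrow> l2norm f = 0 \<Longrightarrow> f = (\<lambda>_. 0)"
  using cmod_le_l2norm[of f I] by (simp add: fun_eq_iff)

lemma outer_apply: "f \<in> ell2 I \<Longrightarrow> outer I \<psi> \<phi> f = (\<lambda>x. ip \<phi> f * \<psi> x)"
  by (simp add: outer_def)

lemma outer_bop:
  assumes "\<psi> \<in> ell2 I" "\<phi> \<in> ell2 I"
  shows "outer I \<psi> \<phi> \<in> bop I"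
proof (rule bopI[where K = "l2norm \<phi> * l2norm \<psi>"])
  fix f
  assume f: "f \<in> ell2 I"
  show "outer I \<psi> \<phi> f \<in> ell2 I"
    using f assms by (simp add: outer_def ell2_scale)
  show "l2norm (outer I \<psi> \<phi> f) \<le> l2norm \<phi> * l2norm \<psi> * l2norm f"
    unfolding outer_apply[OF f] l2norm_scale
    using mult_right_mono[OF cauchy_schwarz[OF assms(2) f] l2norm_nonneg[of \<psi>]]
    by (simp add: mult_ac)
next
  show "outer I \<psi> \<phi> (\<lambda>x. a * f x + g x) = (\<lambda>x. a * outer I \<psi> \<phi> f x + outer I \<psi> \<phi> g x)"
    if "f \<in> ell2 I" "g \<in> ell2 I" for a f g
    using that ip_lin_right[OF assms(2) that, of a]
    by (simp add: outer_def ell2_lin distrib_right mult.assoc)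
qed (simp add: outer_def)

lemma outer_adj:
  assumes "\<psi> \<in> ell2 I" "\<phi> \<in> ell2 I"
  shows "adj I (outer I \<psi> \<phi>) = outer I \<phi> \<psi>"
proof (rule adj_eqI[OF outer_bop[OF assms(2,1)]])
  show "ip (outer I \<phi> \<psi> f) g = ip f (outer I \<psi> \<phi> g)" if "f \<in> ell2 I" "g \<in> ell2 I" for f g
    unfolding outer_apply[OF that(1)] outer_apply[OF that(2)] ip_scale_left ip_scale_right
    by (simp add: ip_cnj mult.commute)
qed

lemma bop_add_op:
  assumes "A \<in> bop I" "C \<in> bop I"
  shows "(\<lambda>f x. A f x + C f x) \<in> bop I"
proof -
  obtain K where K: "\<And>f. f \<in> ell2 I \<Longrightarrow> l2norm (A f) \<le> K * l2norm f"
    using assms(1) by (rule bop_bound) blast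
  obtain L where L: "\<And>f. f \<in> ell2 I \<Longrightarrow> l2norm (C f) \<le> L * l2norm f"
    using assms(2) by (rule bop_bound) blast
  show ?thesis
  proof (rule bopI[where K = "K + L"])
    show "l2norm (\<lambda>x. A f x + C f x) \<le> (K + L) * l2norm f" if "f \<in> ell2 I" for f
      using l2norm_triangle[OF bop_ell2[OF assms(1) that] bop_ell2[OF assms(2) that]]
        K[OF that] L[OF that] by (simp add: distrib_right)
    show "(\<lambda>x. A (\<lambda>x. a * f x + g x) x + C (\<lambda>x. a * f x + g x) x)
        = (\<lambda>x. a * (A f x + C f x) + (A g x + C g x))" if "f \<in> ell2 I" "g \<in> ell2 I" for a f g
      unfolding bop_lin[OF assms(1) that] bop_lin[OF assms(2) that] by (simp add: algebra_simps)
  qed (use assms in \<open>auto simp: ell2_add bop_ell2 bop_outside\<close>)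
qed

lemma bop_uminus:
  assumes "A \<in> bop I"
  shows "(\<lambda>f x. - A f x) \<in> bop I"
proof -
  obtain K where K: "\<And>f. f \<in> ell2 I \<Longrightarrow> l2norm (A f) \<le> K * l2norm f"
    using assms by (rule bop_bound) blast
  have m: "(\<lambda>x. - A f x) = (\<lambda>x. (-1) * A f x)" for f
    by simp
  show ?thesis
    unfolding m
  proof (rule bopI[where K = K])
    show "l2norm (\<lambda>x. (-1) * A f x) \<le> K * l2norm f" if "f \<in> ell2 I" for f
      unfolding l2norm_scale using K[OF that] by simp
    show "(\<lambda>x. (-1) * A (\<lambda>x. a * f x + g x) x) = (\<lambda>x. a * ((-1) * A f x) + (-1) * A g x)"
      if "f \<in> ell2 I" "g \<in> ell2 I" for a f g
      unfolding bop_lin[OF assms that] by (simp add: algebra_simps)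
    show "(\<lambda>x. (-1) * A f x) \<in> ell2 I" if "f \<in> ell2 I" for f
      by (intro ell2_scale bop_ell2[OF assms] that)
  qed (use assms in \<open>simp add: bop_outside\<close>)
qed

lemma bop_diff_op:
  assumes "A \<in> bop I" "C \<in> bop I"
  shows "(\<lambda>f x. A f x - C f x) \<in> bop I"
  using bop_add_op[OF assms(1) bop_uminus[OF assms(2)]] by simp

section \<open>Positive trace-class operators\<close>

text \<open>Cauchy-Schwarz for the form of \<open>\<rho>\<close> makes \<open>\<rho> f\<close>
  orthogonal to every vector.\<close>

lemma positive_kernel:
  assumes "positive I \<rho>" "f \<in> ell2 I" "ip f (\<rho> f) = 0"
  shows "\<rho> f = (\<lambda>_. 0)"
proof (rule ell2_eqI)
  show "ip h (\<rho> f) = ip h (\<lambda>_. 0)" if "h \<in> ell2 I" for h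
    using positive_cauchy_schwarz[OF assms(1) that assms(2)] assms(3) by simp
qed (simp_all add: assms bop_ell2 positive_bop)

text \<open>One step of a Cholesky decomposition.\<close>

lemma rank_one_reduction:
  assumes \<rho>: "positive I \<rho>" and e: "e \<in> I"
  obtains v \<rho>' where "v \<in> ell2 I" "positive I \<rho>'" "\<rho>' (ket e) = (\<lambda>_. 0)"
    "\<And>f. f \<in> ell2 I \<Longrightarrow> \<rho> f = (\<lambda>x. ip v f * v x + \<rho>' f x)"
proof (cases "ip (ket e) (\<rho> (ket e)) = 0")
  case True
  then show thesis
    by (intro that[OF ell2_zero \<rho> positive_kernel[OF \<rho> ket_ell2[OF e]]]) simp_all
next
  case False
  note k = ket_ell2[OF e]
  define r where "r = Re (ip (ket e) (\<rho> (ket e)))"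
  have r: "ip (ket e) (\<rho> (ket e)) = of_real r"
    unfolding r_def by (rule positive_of_real[OF \<rho> k])
  then have r_pos: "0 < r"
    using False positive_Re[OF \<rho> k] unfolding r_def by (metis less_eq_real_def of_real_0)
  \<comment> \<open>The scaling makes the squared modulus of \<open>ip v (ket e)\<close> equal to
    \<open>r\<close>, so that subtracting the rank-one term annihilates the form at
    \<open>ket e\<close>.\<close>
  define v where "v = (\<lambda>x. of_real (1 / sqrt r) * \<rho> (ket e) x)"
  have v: "v \<in> ell2 I"
    unfolding v_def by (intro ell2_scale bop_ell2[OF positive_bop[OF \<rho>]] k)
  define \<rho>' where "\<rho>' = (\<lambda>f x. \<rho> f x - outer I v v f x)"
  have bop: "\<rho>' \<in> bop I"
    unfolding \<rho>'_def by (intro bop_diff_op positive_bop[OF \<rho>] outer_bop v)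
  have quad: "ip f (\<rho>' f) = of_real (Re (ip f (\<rho> f)) - (cmod (ip v f))\<^sup>2)"
    and bnd: "(cmod (ip v f))\<^sup>2 \<le> Re (ip f (\<rho> f))" if f: "f \<in> ell2 I" for f
  proof -
    have "ip f (\<rho>' f) = ip f (\<rho> f) - ip v f * ip f v"
      unfolding \<rho>'_def ip_diff_right[OF f bop_ell2[OF positive_bop[OF \<rho>] f]
          bop_ell2[OF outer_bop[OF v v] f]]
      using f by (simp add: outer_def ip_scale_right)
    moreover have "ip v f * ip f v = of_real ((cmod (ip v f))\<^sup>2)"
      using cmod_sq_eq[of "ip v f"] by (simp add: ip_cnj mult.commute)
    ultimately show "ip f (\<rho>' f) = of_real (Re (ip f (\<rho> f)) - (cmod (ip v f))\<^sup>2)"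
      using positive_of_real[OF \<rho> f] by simp
    have "cmod (ip v f) = cmod (ip f v)"
      by (metis complex_mod_cnj ip_cnj)
    also have "\<dots> = cmod (ip f (\<rho> (ket e))) / sqrt r"
      unfolding v_def ip_scale_right norm_mult using r_pos by (simp add: norm_divide)
    finally have "(cmod (ip v f))\<^sup>2 = (cmod (ip f (\<rho> (ket e))))\<^sup>2 / r"
      using r_pos by (simp add: power_divide)
    \<comment> \<open>This is Cauchy-Schwarz for \<open>\<rho>\<close> at \<open>f\<close> and
      \<open>ket e\<close>, divided by \<open>r\<close>; it is exactly the positivity of
      \<open>\<rho>'\<close>.\<close>
    then show "(cmod (ip v f))\<^sup>2 \<le> Re (ip f (\<rho> f))"
      using positive_cauchy_schwarz[OF \<rho> f k] r_pos
      by (simp add: r_def[symmetric] pos_divide_le_eq)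
  qed
  have pos: "positive I \<rho>'"
    unfolding positive_def
  proof (intro conjI ballI bop)
    show "ip f (\<rho>' f) \<in> \<real>" "0 \<le> Re (ip f (\<rho>' f))" if "f \<in> ell2 I" for f
      unfolding quad[OF that] using bnd[OF that] by simp_all
  qed
  have "cmod (ip v (ket e)) = sqrt r"
  proof -
    have "ip v (ket e) = of_real (1 / sqrt r) * ip (\<rho> (ket e)) (ket e)"
      unfolding v_def ip_scale_left by simp
    also have "ip (\<rho> (ket e)) (ket e) = of_real r"
      using r positive_herm[OF \<rho> k k] by simp
    also have "of_real (1 / sqrt r) * of_real r = complex_of_real (sqrt r)"
      using r_pos by (simp add: real_div_sqrt flip: of_real_mult of_real_divide)
    finally show ?thesis
      using r_pos by simp
  qed
  then have "ip (ket e) (\<rho>' (ket e)) = 0"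
    unfolding quad[OF k] using r_pos by (simp add: r_def)
  then have "\<rho>' (ket e) = (\<lambda>_. 0)"
    by (rule positive_kernel[OF pos k])
  moreover have "\<rho> f = (\<lambda>x. ip v f * v x + \<rho>' f x)" if "f \<in> ell2 I" for f
    using that by (simp add: \<rho>'_def outer_def)
  ultimately show thesis
    using that v pos by blast
qed

lemma gram_reduction:
  assumes \<rho>: "positive I \<rho>" and "finite F" "F \<subseteq> I"
  shows "\<exists>v \<rho>'. (\<forall>k\<in>F. v k \<in> ell2 I) \<and> positive I \<rho>' \<and> (\<forall>k\<in>F. \<rho>' (ket k) = (\<lambda>_. 0))
    \<and> (\<forall>f\<in>ell2 I. \<rho> f = (\<lambda>x. (\<Sum>k\<in>F. ip (v k) f * v k x) + \<rho>' f x))"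
  using assms(2,3)
proof (induction F)
  case empty
  then show ?case
    using \<rho> by auto
next
  case (insert e F)
  then obtain v \<rho>1 where v: "\<forall>k\<in>F. v k \<in> ell2 I" and \<rho>1: "positive I \<rho>1"
    and ker1: "\<forall>k\<in>F. \<rho>1 (ket k) = (\<lambda>_. 0)"
    and eq1: "\<forall>f\<in>ell2 I. \<rho> f = (\<lambda>x. (\<Sum>k\<in>F. ip (v k) f * v k x) + \<rho>1 f x)"
    by auto
  have e: "e \<in> I"
    using insert.prems by simp
  obtain w \<rho>2 where w: "w \<in> ell2 I" and \<rho>2: "positive I \<rho>2" and ker2: "\<rho>2 (ket e) = (\<lambda>_. 0)"
    and eq2: "\<And>f. f \<in> ell2 I \<Longrightarrow> \<rho>1 f = (\<lambda>x. ip w f * w x + \<rho>2 f x)"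
    by (rule rank_one_reduction[OF \<rho>1 e]) (rule that)
  \<comment> \<open>Earlier basis vectors stay in the kernel: at \<open>ket k\<close> the form of
    \<open>\<rho>1\<close> is zero and splits into two nonnegative terms, one of which is the form
    of \<open>\<rho>2\<close>.\<close>
  have "\<rho>2 (ket k) = (\<lambda>_. 0)" if k: "k \<in> F" for k
  proof -
    have kI: "ket k \<in> ell2 I"
      by (rule ket_ell2) (use k insert.prems in auto)
    have "0 = ip (ket k) (\<rho>1 (ket k))"
      using ker1 k by simp
    also have "\<dots> = ip w (ket k) * ip (ket k) w + ip (ket k) (\<rho>2 (ket k))"
      unfolding eq2[OF kI] ip_lin_right[OF kI w bop_ell2[OF positive_bop[OF \<rho>2] kI]] ..
    also have "ip w (ket k) * ip (ket k) w = of_real ((cmod (ip w (ket k)))\<^sup>2)"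
      using cmod_sq_eq[of "ip w (ket k)"] by (simp add: ip_cnj mult.commute)
    finally have "0 = Re (of_real ((cmod (ip w (ket k)))\<^sup>2) + ip (ket k) (\<rho>2 (ket k)))"
      by simp
    then have "Re (ip (ket k) (\<rho>2 (ket k))) = 0"
      using positive_Re[OF \<rho>2 kI] zero_le_power2[of "cmod (ip w (ket k))"]
      unfolding plus_complex.sel Re_complex_of_real by linarith
    then show ?thesis
      using positive_kernel[OF \<rho>2 kI] positive_of_real[OF \<rho>2 kI] by simp
  qed
  moreover have "\<rho> f = (\<lambda>x. (\<Sum>k\<in>insert e F. ip ((v(e := w)) k) f * (v(e := w)) k x) + \<rho>2 f x)"
    if f: "f \<in> ell2 I" for f
  proof -
    have "(\<Sum>k\<in>F. ip ((v(e := w)) k) f * (v(e := w)) k x) = (\<Sum>k\<in>F. ip (v k) f * v k x)" for x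
      by (rule sum.cong) (use insert.hyps in auto)
    then show ?thesis
      using insert.hyps eq1[rule_format, OF f] eq2[OF f] by (simp add: algebra_simps)
  qed
  ultimately show ?case
    using v w \<rho>2 ker2 by (intro exI[of _ "v(e := w)"] exI[of _ \<rho>2]) auto
qed

text \<open>Restricted to positive operators, but without the bound of \<open>density\<close> on the
  trace, so that sums of members remain arguments of a superoperator.\<close>

definition trace_class :: "'i set \<Rightarrow> 'i oper set" where
  "trace_class I = {\<rho>. positive I \<rho> \<and> (\<lambda>n. Re (ip (ket n) (\<rho> (ket n)))) summable_on I}"

definition tr :: "'i set \<Rightarrow> 'i oper \<Rightarrow> real" where
  "tr I \<rho> = (\<Sum>\<^sub>\<infinity>n\<in>I. Re (ip (ket n) (\<rho> (ket n))))"

lemma density_trace_class: "\<rho> \<in> density I \<Longrightarrow> \<rho> \<in> trace_class I"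
  by (auto simp: density_def trace_class_def intro: summable_on_Re)

lemma trace_class_positive: "\<rho> \<in> trace_class I \<Longrightarrow> positive I \<rho>"
  by (simp add: trace_class_def)

lemma trace_class_bop: "\<rho> \<in> trace_class I \<Longrightarrow> \<rho> \<in> bop I"
  by (simp add: trace_class_positive positive_bop)

lemma tr_nonneg: "\<rho> \<in> trace_class I \<Longrightarrow> 0 \<le> tr I \<rho>"
  unfolding tr_def
  by (rule infsum_nonneg, rule positive_Re[OF trace_class_positive]) (auto intro: ket_ell2)

lemma bessel_trace:
  assumes \<rho>: "\<rho> \<in> trace_class I" and X: "finite X" and g: "\<And>j. j \<in> X \<Longrightarrow> g j \<in> ell2 I"
    and bessel: "\<And>v. v \<in> ell2 I \<Longrightarrow> (\<Sum>j\<in>X. (cmod (ip (g j) v))\<^sup>2) \<le> (l2norm v)\<^sup>2"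
  shows "(\<Sum>j\<in>X. Re (ip (g j) (\<rho> (g j)))) \<le> tr I \<rho>"
proof -
  note pos = trace_class_positive[OF \<rho>] and b\<rho> = trace_class_bop[OF \<rho>]
  obtain K where K: "0 \<le> K" "\<And>f. f \<in> ell2 I \<Longrightarrow> l2norm (\<rho> f) \<le> K * l2norm f"
    using b\<rho> by (rule bop_bound) blast
  let ?d = "\<lambda>F j. (\<lambda>x. g j x - (if x \<in> F then g j x else 0))"
  \<comment> \<open>\<open>K\<close> is fixed before \<open>F\<close>, so the error vanishes
    together with the tails \<open>?d F j\<close> as \<open>F\<close> grows.\<close>
  have approx: "(\<Sum>j\<in>X. Re (ip (g j) (\<rho> (g j)))) \<le> tr I \<rho> + (\<Sum>j\<in>X. K * (l2norm (?d F j))\<^sup>2)"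
    if F: "finite F" "F \<subseteq> I" for F
  proof -
    obtain v \<rho>' where v: "\<forall>k\<in>F. v k \<in> ell2 I" and \<rho>': "positive I \<rho>'"
      and ker: "\<forall>k\<in>F. \<rho>' (ket k) = (\<lambda>_. 0)"
      and eq: "\<forall>f\<in>ell2 I. \<rho> f = (\<lambda>x. (\<Sum>k\<in>F. ip (v k) f * v k x) + \<rho>' f x)"
      using gram_reduction[OF pos F] by auto
    have split: "Re (ip f (\<rho> f)) = (\<Sum>k\<in>F. (cmod (ip f (v k)))\<^sup>2) + Re (ip f (\<rho>' f))"
      if f: "f \<in> ell2 I" for f
    proof -
      have "ip f (\<rho> f) = (\<Sum>k\<in>F. ip f (\<lambda>x. ip (v k) f * v k x)) + ip f (\<rho>' f)"
        unfolding eq[rule_format, OF f]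
        by (subst ip_add_right[OF f]; (subst ip_sum_right[OF f])?)
          (simp_all add: v f ell2_sum ell2_scale bop_ell2[OF positive_bop[OF \<rho>']])
      also have "(\<Sum>k\<in>F. ip f (\<lambda>x. ip (v k) f * v k x)) = (\<Sum>k\<in>F. of_real ((cmod (ip f (v k)))\<^sup>2))"
      proof (rule sum.cong[OF refl])
        show "ip f (\<lambda>x. ip (v k) f * v k x) = of_real ((cmod (ip f (v k)))\<^sup>2)" for k
          unfolding ip_scale_right cmod_sq_eq[symmetric] by (simp add: ip_cnj)
      qed
      finally show ?thesis
        by (simp only: plus_complex.sel Re_sum Re_complex_of_real)
    qed
    \<comment> \<open>As a form the remainder lies below \<open>\<rho>\<close>, so the norm bound of
      \<open>\<rho>\<close> serves for all \<open>F\<close> at once.\<close>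
    have le: "Re (ip f (\<rho>' f)) \<le> K * (l2norm f)\<^sup>2" if f: "f \<in> ell2 I" for f
    proof -
      have "Re (ip f (\<rho>' f)) \<le> Re (ip f (\<rho> f))"
        unfolding split[OF f] by (simp add: sum_nonneg)
      also have "\<dots> \<le> cmod (ip f (\<rho> f))"
        by (rule complex_Re_le_cmod)
      also have "\<dots> \<le> l2norm f * l2norm (\<rho> f)"
        by (rule cauchy_schwarz[OF f bop_ell2[OF b\<rho> f]])
      also have "\<dots> \<le> l2norm f * (K * l2norm f)"
        by (intro mult_left_mono K(2) f) simp
      finally show ?thesis
        by (simp add: power2_eq_square mult_ac)
    qed
    \<comment> \<open>\<open>\<rho>'\<close> kills the truncation of \<open>g j\<close> to
      \<open>F\<close>; by symmetry of the form, only the tail \<open>?d F j\<close> contributes in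
      either argument.\<close>
    have tail: "Re (ip (g j) (\<rho>' (g j))) \<le> K * (l2norm (?d F j))\<^sup>2" if j: "j \<in> X" for j
    proof -
      note gj = g[OF j] and b' = positive_bop[OF \<rho>']
      note t = ell2_finite_support[OF F, of "g j"]
      note d = ell2_diff[OF gj t]
      have kF: "ket k \<in> ell2 I" if "k \<in> F" for k
        by (rule ket_ell2) (use that F in auto)
      have "\<rho>' (\<lambda>x. if x \<in> F then g j x else 0) = (\<lambda>x. \<Sum>k\<in>F. \<rho>' (\<lambda>x. g j k * ket k x) x)"
        unfolding truncation_ket_sum[OF F(1)] by (rule bop_sum[OF b']) (rule ell2_scale[OF kF])
      also have "\<dots> = (\<lambda>_. 0)"
        using kF ker by (simp add: bop_scale[OF b'])
      finally have t0: "\<rho>' (\<lambda>x. if x \<in> F then g j x else 0) = (\<lambda>_. 0)" .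
      have d': "\<rho>' (?d F j) = \<rho>' (g j)"
        unfolding bop_diff[OF b' gj t] t0 by simp
      have "ip (?d F j) (\<rho>' (?d F j)) = ip (\<rho>' (?d F j)) (g j)"
        unfolding d' positive_herm[OF \<rho>' d gj] ..
      also have "\<dots> = ip (g j) (\<rho>' (g j))"
        unfolding d' positive_herm[OF \<rho>' gj gj] ..
      finally show ?thesis
        using le[OF d] by simp
    qed
    \<comment> \<open>The diagonal entry of \<open>\<rho>\<close> at \<open>n\<close> dominates the
      sum over \<open>k\<close> of the squared moduli of \<open>v k n\<close>; summing over
      \<open>n\<close> produces the squared norms.\<close>
    have norm_v: "(\<Sum>k\<in>F. (l2norm (v k))\<^sup>2) \<le> tr I \<rho>"
    proof -
      have sm: "(\<lambda>x. (cmod (v k x))\<^sup>2) summable_on I" if "k \<in> F" for k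
        using v that by (auto simp: ell2_def)
      have "(l2norm (v k))\<^sup>2 = (\<Sum>\<^sub>\<infinity>x\<in>I. (cmod (v k x))\<^sup>2)" if "k \<in> F" for k
        unfolding l2norm_sq
        by (rule infsum_cong_neutral) (use ell2_outside[OF v[rule_format, OF that]] in auto)
      then have "(\<Sum>k\<in>F. (l2norm (v k))\<^sup>2) = (\<Sum>k\<in>F. \<Sum>\<^sub>\<infinity>x\<in>I. (cmod (v k x))\<^sup>2)"
        by simp
      also have "\<dots> = (\<Sum>\<^sub>\<infinity>x\<in>I. \<Sum>k\<in>F. (cmod (v k x))\<^sup>2)"
        by (rule infsum_finite_sum[symmetric]) (rule sm)
      also have "\<dots> \<le> tr I \<rho>"
        unfolding tr_def
      proof (rule infsum_mono)
        show "(\<lambda>x. \<Sum>k\<in>F. (cmod (v k x))\<^sup>2) summable_on I"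
          by (rule summable_on_finite_sum) (rule sm)
        show "(\<lambda>n. Re (ip (ket n) (\<rho> (ket n)))) summable_on I"
          using \<rho> by (simp add: trace_class_def)
        show "(\<Sum>k\<in>F. (cmod (v k n))\<^sup>2) \<le> Re (ip (ket n) (\<rho> (ket n)))" if "n \<in> I" for n
          using split[OF ket_ell2[OF that]] positive_Re[OF \<rho>' ket_ell2[OF that]]
          by (simp add: ip_ket_left)
      qed
      finally show ?thesis .
    qed
    have "(\<Sum>j\<in>X. Re (ip (g j) (\<rho> (g j))))
        = (\<Sum>j\<in>X. \<Sum>k\<in>F. (cmod (ip (g j) (v k)))\<^sup>2) + (\<Sum>j\<in>X. Re (ip (g j) (\<rho>' (g j))))"
      by (simp add: split[OF g] sum.distrib)
    \<comment> \<open>After the swap, the assumed Bessel inequality applies to each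
      \<open>v k\<close> separately.\<close>
    also have "(\<Sum>j\<in>X. \<Sum>k\<in>F. (cmod (ip (g j) (v k)))\<^sup>2) = (\<Sum>k\<in>F. \<Sum>j\<in>X. (cmod (ip (g j) (v k)))\<^sup>2)"
      by (rule sum.swap)
    also have "\<dots> \<le> (\<Sum>k\<in>F. (l2norm (v k))\<^sup>2)"
      by (rule sum_mono) (use v bessel in auto)
    also note norm_v
    also have "(\<Sum>j\<in>X. Re (ip (g j) (\<rho>' (g j)))) \<le> (\<Sum>j\<in>X. K * (l2norm (?d F j))\<^sup>2)"
      by (rule sum_mono) (rule tail)
    finally show ?thesis
      by simp
  qed
  have "((\<lambda>F. tr I \<rho> + (\<Sum>j\<in>X. K * (l2norm (?d F j))\<^sup>2)) \<longlongrightarrow> tr I \<rho> + (\<Sum>j\<in>X. K * 0\<^sup>2))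
      (finite_subsets_at_top I)"
    by (intro tendsto_intros truncation_tendsto g)
  moreover have "\<forall>\<^sub>F F in finite_subsets_at_top I.
      (\<Sum>j\<in>X. Re (ip (g j) (\<rho> (g j)))) \<le> tr I \<rho> + (\<Sum>j\<in>X. K * (l2norm (?d F j))\<^sup>2)"
    using approx by (intro eventually_finite_subsets_at_top_weakI) auto
  ultimately have "(\<Sum>j\<in>X. Re (ip (g j) (\<rho> (g j)))) \<le> tr I \<rho> + (\<Sum>j\<in>X. K * 0\<^sup>2)"
    by (intro tendsto_lowerbound) auto
  then show ?thesis
    by simp
qed

text \<open>A single normalised vector satisfies Bessel's inequality, so this is
  \<open>bessel_trace\<close> for a family with the one index \<open>()\<close>.\<close>

lemma quadratic_le_tr:
  assumes "\<rho> \<in> trace_class I" "f \<in> ell2 I"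
  shows "Re (ip f (\<rho> f)) \<le> tr I \<rho> * (l2norm f)\<^sup>2"
proof (cases "l2norm f = 0")
  case True
  then show ?thesis
    using l2norm_eq_0[OF assms(2)] by simp
next
  case False
  let ?a = "of_real (1 / l2norm f) :: complex"
  have "(\<Sum>j\<in>{()}. Re (ip (\<lambda>x. ?a * f x) (\<rho> (\<lambda>x. ?a * f x)))) \<le> tr I \<rho>"
  proof (rule bessel_trace[OF assms(1)])
    show "(\<Sum>j\<in>{()}. (cmod (ip (\<lambda>x. ?a * f x) v))\<^sup>2) \<le> (l2norm v)\<^sup>2" if v: "v \<in> ell2 I" for v
    proof -
      have "cmod (ip (\<lambda>x. ?a * f x) v) \<le> l2norm (\<lambda>x. ?a * f x) * l2norm v"
        by (intro cauchy_schwarz[of _ I] ell2_scale assms v)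
      also have "\<dots> = l2norm v"
        unfolding l2norm_scale using False by (simp add: norm_divide)
      finally show ?thesis
        by (simp add: power_mono)
    qed
  qed (auto intro!: ell2_scale[OF assms(2), of ?a] simp del: of_real_divide)
  moreover have "ip (\<lambda>x. ?a * f x) (\<rho> (\<lambda>x. ?a * f x)) = of_real ((1 / l2norm f)\<^sup>2) * ip f (\<rho> f)"
    unfolding bop_scale[OF trace_class_bop[OF assms(1)] assms(2)] ip_scale_left ip_scale_right
    by (simp add: power2_eq_square)
  ultimately have "Re (ip f (\<rho> f)) / (l2norm f)\<^sup>2 \<le> tr I \<rho>"
    by (simp add: power_divide flip: of_real_power)
  then show ?thesis
    using False by (simp add: field_simps)
qed

text \<open>Cauchy-Schwarz for the form of \<open>\<rho>\<close> at \<open>\<rho> f\<close> and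
  \<open>f\<close> bounds the fourth power of the norm of \<open>\<rho> f\<close> by a product of
  two quadratic values, each at most the trace times a squared norm; cancelling a square leaves the
  claim. This is how bounds on traces become bounds on entries.\<close>

lemma l2norm_le_tr:
  assumes \<rho>: "\<rho> \<in> trace_class I" and f: "f \<in> ell2 I"
  shows "l2norm (\<rho> f) \<le> tr I \<rho> * l2norm f"
proof -
  note rf = bop_ell2[OF trace_class_bop[OF \<rho>] f]
  let ?a = "l2norm (\<rho> f)"
  have "cmod (ip (\<rho> f) (\<rho> f)) = ?a\<^sup>2"
    by (simp add: ip_self[OF rf] norm_power)
  then have "(?a\<^sup>2)\<^sup>2 \<le> Re (ip (\<rho> f) (\<rho> (\<rho> f))) * Re (ip f (\<rho> f))"
    using positive_cauchy_schwarz[OF trace_class_positive[OF \<rho>] rf f] by simp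
  also have "\<dots> \<le> (tr I \<rho> * ?a\<^sup>2) * (tr I \<rho> * (l2norm f)\<^sup>2)"
    by (intro mult_mono quadratic_le_tr \<rho> rf f positive_Re[OF trace_class_positive[OF \<rho>]]
        mult_nonneg_nonneg tr_nonneg) auto
  also have "\<dots> = ?a\<^sup>2 * (tr I \<rho> * l2norm f)\<^sup>2"
    by (simp add: power2_eq_square)
  finally have "?a\<^sup>2 * ?a\<^sup>2 \<le> ?a\<^sup>2 * (tr I \<rho> * l2norm f)\<^sup>2"
    by (simp only: power2_eq_square[of "?a\<^sup>2"])
  then have "?a = 0 \<or> ?a\<^sup>2 \<le> (tr I \<rho> * l2norm f)\<^sup>2"
    by (metis mult_left_le_imp_le power_zero_numeral zero_less_power2)
  then show ?thesis
  proof
    assume "?a\<^sup>2 \<le> (tr I \<rho> * l2norm f)\<^sup>2"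
    then show ?thesis
      by (rule power2_le_imp_le) (simp add: tr_nonneg[OF \<rho>])
  qed (simp add: tr_nonneg[OF \<rho>])
qed

section \<open>Superoperators\<close>

lemma infsum_tail_tendsto:
  fixes t :: "'n \<Rightarrow> real"
  assumes "t summable_on J"
  shows "((\<lambda>N. \<Sum>\<^sub>\<infinity>n\<in>J - N. t n) \<longlongrightarrow> 0) (finite_subsets_at_top J)"
proof -
  have eq: "infsum t J - sum t N = (\<Sum>\<^sub>\<infinity>n\<in>J - N. t n)" if "finite N" "N \<subseteq> J" for N
  proof -
    have "infsum t (N \<union> (J - N)) = infsum t N + infsum t (J - N)"
      by (rule infsum_Un_disjoint) (use that assms in \<open>auto intro: summable_on_subset_banach\<close>)
    then show ?thesis
      using that by (simp add: Un_absorb1)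
  qed
  have "((\<lambda>N. infsum t J - sum t N) \<longlongrightarrow> infsum t J - infsum t J) (finite_subsets_at_top J)"
    by (intro tendsto_intros infsum_tendsto assms)
  then have "((\<lambda>N. infsum t J - sum t N) \<longlongrightarrow> 0) (finite_subsets_at_top J)"
    by simp
  moreover have "\<forall>\<^sub>F N in finite_subsets_at_top J. infsum t J - sum t N = (\<Sum>\<^sub>\<infinity>n\<in>J - N. t n)"
    by (rule eventually_finite_subsets_at_top_weakI) (rule eq)
  ultimately show ?thesis
    by (rule Lim_transform_eventually)
qed

text \<open>Meant for a value \<open>S\<close> that is the image of a whole sum under some map: the
  difference is then the image of the tail, and it only has to be estimated by the tails of a
  summable \<open>t\<close>.\<close>

lemma has_sum_by_tails:
  fixes f :: "'n \<Rightarrow> complex" and t :: "'n \<Rightarrow> real"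
  assumes "t summable_on J"
    and "\<And>N. finite N \<Longrightarrow> N \<subseteq> J \<Longrightarrow> cmod (S - (\<Sum>n\<in>N. f n)) \<le> C * (\<Sum>\<^sub>\<infinity>n\<in>J - N. t n)"
  shows "(f has_sum S) J"
proof -
  have "((\<lambda>N. S - (\<Sum>n\<in>N. f n)) \<longlongrightarrow> 0) (finite_subsets_at_top J)"
  proof (rule Lim_null_comparison)
    show "\<forall>\<^sub>F N in finite_subsets_at_top J. norm (S - (\<Sum>n\<in>N. f n)) \<le> C * (\<Sum>\<^sub>\<infinity>n\<in>J - N. t n)"
      by (rule eventually_finite_subsets_at_top_weakI) (rule assms(2))
    show "((\<lambda>N. C * (\<Sum>\<^sub>\<infinity>n\<in>J - N. t n)) \<longlongrightarrow> 0) (finite_subsets_at_top J)"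
      by (rule tendsto_mult_right_zero[OF infsum_tail_tendsto[OF assms(1)]])
  qed
  then have "((\<lambda>N. S - (S - (\<Sum>n\<in>N. f n))) \<longlongrightarrow> S - 0) (finite_subsets_at_top J)"
    by (rule tendsto_diff[OF tendsto_const])
  then show ?thesis
    by (simp add: has_sum_def)
qed

text \<open>Absolutely convergent series of vectors, summed entrywise. Testing against a truncation
  to a finite \<open>X\<close> makes the exchange of the sum over \<open>n\<close> with the sum over
  \<open>x\<close> a finite one, after which Cauchy-Schwarz bounds each term and
  \<open>ell2_dualI\<close> concludes.\<close>

lemma
  fixes h :: "'n \<Rightarrow> 'i vec"
  assumes h: "\<And>n. n \<in> J \<Longrightarrow> h n \<in> ell2 I" and sm: "(\<lambda>n. l2norm (h n)) summable_on J"
  shows ell2_entry_summable: "(\<lambda>n. h n x) summable_on J"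
    and ell2_infsum: "(\<lambda>x. \<Sum>\<^sub>\<infinity>n\<in>J. h n x) \<in> ell2 I"
    and l2norm_infsum_le: "l2norm (\<lambda>x. \<Sum>\<^sub>\<infinity>n\<in>J. h n x) \<le> (\<Sum>\<^sub>\<infinity>n\<in>J. l2norm (h n))"
proof -
  have sumx: "(\<lambda>n. h n x) summable_on J" for x
  proof (rule abs_summable_summable, rule summable_on_comparison_test[OF sm])
    show "norm (h n x) \<le> l2norm (h n)" if "n \<in> J" for n
      by (rule cmod_le_l2norm[OF h[OF that]])
  qed simp
  then show "(\<lambda>n. h n x) summable_on J" .
  let ?s = "\<lambda>x. \<Sum>\<^sub>\<infinity>n\<in>J. h n x" and ?C = "\<Sum>\<^sub>\<infinity>n\<in>J. l2norm (h n)"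
  have out: "?s x = 0" if "x \<notin> I" for x
    by (rule infsum_0) (use ell2_outside[OF h that] in auto)
  have C: "0 \<le> ?C"
    by (rule infsum_nonneg) simp
  have dual: "(\<Sum>x\<in>X. (cmod (?s x))\<^sup>2) \<le> ?C * l2norm (\<lambda>x. if x \<in> X then ?s x else 0)"
    if X: "finite X" "X \<subseteq> I" for X
  proof -
    let ?g = "\<lambda>x. if x \<in> X then ?s x else 0"
    have g: "?g \<in> ell2 I"
      by (rule ell2_finite_support[OF X])
    have ipg: "ip ?g (h n) = (\<Sum>x\<in>X. cnj (?s x) * h n x)" for n
      using ip_finite_support[OF X(1), of ?g "h n"] by simp
    have le: "cmod (ip ?g (h n)) \<le> l2norm ?g * l2norm (h n)" if "n \<in> J" for n
      by (rule cauchy_schwarz[OF g h[OF that]])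
    have "complex_of_real (\<Sum>x\<in>X. (cmod (?s x))\<^sup>2) = (\<Sum>x\<in>X. cnj (?s x) * ?s x)"
      by (simp only: of_real_sum cmod_sq_eq)
    also have "\<dots> = (\<Sum>x\<in>X. \<Sum>\<^sub>\<infinity>n\<in>J. cnj (?s x) * h n x)"
      by (simp add: infsum_cmult_right')
    also have "\<dots> = (\<Sum>\<^sub>\<infinity>n\<in>J. \<Sum>x\<in>X. cnj (?s x) * h n x)"
      by (rule infsum_finite_sum[symmetric]) (rule summable_on_cmult_right[OF sumx])
    also have "\<dots> = (\<Sum>\<^sub>\<infinity>n\<in>J. ip ?g (h n))"
      by (simp only: ipg)
    finally have "(\<Sum>x\<in>X. (cmod (?s x))\<^sup>2) = Re (\<Sum>\<^sub>\<infinity>n\<in>J. ip ?g (h n))"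
      by (metis Re_complex_of_real)
    also have "\<dots> \<le> cmod (\<Sum>\<^sub>\<infinity>n\<in>J. ip ?g (h n))"
      by (rule complex_Re_le_cmod)
    also have "\<dots> \<le> (\<Sum>\<^sub>\<infinity>n\<in>J. l2norm ?g * l2norm (h n))"
    proof (rule norm_infsum_le[OF has_sum_infsum has_sum_infsum])
      show "(\<lambda>n. l2norm ?g * l2norm (h n)) summable_on J"
        by (rule summable_on_cmult_right[OF sm])
      then have "(\<lambda>n. norm (ip ?g (h n))) summable_on J"
        by (rule summable_on_comparison_test) (use le in auto)
      then show "(\<lambda>n. ip ?g (h n)) summable_on J"
        by (rule abs_summable_summable)
    qed (rule le)
    also have "\<dots> = ?C * l2norm ?g"
      unfolding infsum_cmult_right' by (rule mult.commute)
    finally show ?thesis .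
  qed
  show "?s \<in> ell2 I"
    by (rule ell2_dualI(1)[OF out C dual])
  show "l2norm ?s \<le> ?C"
    by (rule ell2_dualI(2)[OF out C dual])
qed

lemma ip_has_sum:
  fixes h :: "'n \<Rightarrow> 'i vec"
  assumes a: "a \<in> ell2 I"
    and h: "\<And>n. n \<in> J \<Longrightarrow> h n \<in> ell2 I" and sm: "(\<lambda>n. l2norm (h n)) summable_on J"
  shows "((\<lambda>n. ip a (h n)) has_sum ip a (\<lambda>x. \<Sum>\<^sub>\<infinity>n\<in>J. h n x)) J"
proof (rule has_sum_by_tails[OF sm, where C = "l2norm a"])
  fix N
  assume N: "finite N" "N \<subseteq> J"
  have hJ: "h n \<in> ell2 I" if "n \<in> J - N" for n
    using h that by simp
  have smJ: "(\<lambda>n. l2norm (h n)) summable_on J - N"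
    by (rule summable_on_subset_banach[OF sm]) simp
  have hN: "h n \<in> ell2 I" if "n \<in> N" for n
    using h that N by auto
  note tail = ell2_infsum[OF hJ smJ]
  have "(\<Sum>\<^sub>\<infinity>n\<in>J. h n x) = (\<Sum>n\<in>N. h n x) + (\<Sum>\<^sub>\<infinity>n\<in>J - N. h n x)" for x
  proof -
    have "infsum (\<lambda>n. h n x) (N \<union> (J - N)) = infsum (\<lambda>n. h n x) N + infsum (\<lambda>n. h n x) (J - N)"
      by (rule infsum_Un_disjoint) (use N ell2_entry_summable[OF hJ smJ] in auto)
    then show ?thesis
      using N by (simp add: Un_absorb1)
  qed
  then have "ip a (\<lambda>x. \<Sum>\<^sub>\<infinity>n\<in>J. h n x) = (\<Sum>n\<in>N. ip a (h n)) + ip a (\<lambda>x. \<Sum>\<^sub>\<infinity>n\<in>J - N. h n x)"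
    using ip_add_right[OF a ell2_sum[of N h, OF hN] tail] ip_sum_right[OF a, of N h, OF hN] by simp
  then have "cmod (ip a (\<lambda>x. \<Sum>\<^sub>\<infinity>n\<in>J. h n x) - (\<Sum>n\<in>N. ip a (h n)))
      = cmod (ip a (\<lambda>x. \<Sum>\<^sub>\<infinity>n\<in>J - N. h n x))"
    by simp
  also have "\<dots> \<le> l2norm a * l2norm (\<lambda>x. \<Sum>\<^sub>\<infinity>n\<in>J - N. h n x)"
    by (rule cauchy_schwarz[OF a tail])
  also have "\<dots> \<le> l2norm a * (\<Sum>\<^sub>\<infinity>n\<in>J - N. l2norm (h n))"
    by (rule mult_left_mono[OF l2norm_infsum_le[OF hJ smJ]]) simp_all
  finally show "cmod (ip a (\<lambda>x. \<Sum>\<^sub>\<infinity>n\<in>J. h n x) - (\<Sum>n\<in>N. ip a (h n)))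
      \<le> l2norm a * (\<Sum>\<^sub>\<infinity>n\<in>J - N. l2norm (h n))" .
qed

lemma trace_class_norm_summable:
  assumes F: "\<And>n. n \<in> J \<Longrightarrow> F n \<in> trace_class I" and sm: "(\<lambda>n. tr I (F n)) summable_on J"
    and f: "f \<in> ell2 I"
  shows "(\<lambda>n. l2norm (F n f)) summable_on J"
proof (rule summable_on_comparison_test)
  show "(\<lambda>n. tr I (F n) * l2norm f) summable_on J"
    by (rule summable_on_cmult_left[OF sm])
  show "l2norm (F n f) \<le> tr I (F n) * l2norm f" if "n \<in> J" for n
    by (rule l2norm_le_tr[OF F[OF that] f])
qed simp

text \<open>By \<open>l2norm_le_tr\<close>, summable traces make the vectors \<open>F n f\<close>
  summable in norm for each \<open>f\<close>, with the sum of the traces as operator bound. The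
  trace identity is Tonelli for the nonnegative diagonal entries.\<close>

lemma
  assumes F: "\<And>n. n \<in> J \<Longrightarrow> F n \<in> trace_class I" and sm: "(\<lambda>n. tr I (F n)) summable_on J"
  shows trace_class_op_sum: "op_sum J F \<in> trace_class I"
    and tr_op_sum: "tr I (op_sum J F) = (\<Sum>\<^sub>\<infinity>n\<in>J. tr I (F n))"
    and trace_class_entry_summable: "(\<lambda>n. F n f x) summable_on J"
proof -
  note bF = trace_class_bop[OF F]
  have mem: "F n f \<in> ell2 I" if "n \<in> J" "f \<in> ell2 I" for n f
    by (rule bop_ell2[OF bF[OF that(1)] that(2)])
  have nsm: "(\<lambda>n. l2norm (F n f)) summable_on J" if "f \<in> ell2 I" for f
    by (rule trace_class_norm_summable[OF F sm that])
  have esm: "(\<lambda>n. F n f x) summable_on J" for f x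
  proof (cases "f \<in> ell2 I")
    case True
    show ?thesis
      by (rule ell2_entry_summable[OF mem nsm]) (use True in auto)
  next
    case False
    then show ?thesis
      using bop_outside[OF bF] by (simp cong: summable_on_cong)
  qed
  then show "(\<lambda>n. F n f x) summable_on J" .
  have eq: "op_sum J F f = (\<lambda>x. \<Sum>\<^sub>\<infinity>n\<in>J. F n f x)" for f
    by (simp add: op_sum_def)
  have bop: "op_sum J F \<in> bop I"
  proof (rule bopI[where K = "\<Sum>\<^sub>\<infinity>n\<in>J. tr I (F n)"])
    fix f
    assume f: "f \<in> ell2 I"
    show "op_sum J F f \<in> ell2 I"
      unfolding eq by (rule ell2_infsum[OF mem[OF _ f] nsm[OF f]])
    have "l2norm (op_sum J F f) \<le> (\<Sum>\<^sub>\<infinity>n\<in>J. l2norm (F n f))"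
      unfolding eq by (rule l2norm_infsum_le[OF mem[OF _ f] nsm[OF f]])
    also have "\<dots> \<le> (\<Sum>\<^sub>\<infinity>n\<in>J. tr I (F n) * l2norm f)"
      by (intro infsum_mono nsm f summable_on_cmult_left sm l2norm_le_tr F)
    finally show "l2norm (op_sum J F f) \<le> (\<Sum>\<^sub>\<infinity>n\<in>J. tr I (F n)) * l2norm f"
      by (simp add: infsum_cmult_left')
  next
    show "op_sum J F (\<lambda>x. a * f x + g x) = (\<lambda>x. a * op_sum J F f x + op_sum J F g x)"
      if fg: "f \<in> ell2 I" "g \<in> ell2 I" for a f g
    proof
      fix x
      have "(\<Sum>\<^sub>\<infinity>n\<in>J. F n (\<lambda>x. a * f x + g x) x) = (\<Sum>\<^sub>\<infinity>n\<in>J. a * F n f x + F n g x)"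
        by (rule infsum_cong) (simp add: bop_lin[OF bF fg])
      also have "\<dots> = (\<Sum>\<^sub>\<infinity>n\<in>J. a * F n f x) + (\<Sum>\<^sub>\<infinity>n\<in>J. F n g x)"
        by (intro infsum_add summable_on_cmult_right esm)
      finally show "op_sum J F (\<lambda>x. a * f x + g x) x = a * op_sum J F f x + op_sum J F g x"
        by (simp add: eq infsum_cmult_right')
    qed
    show "op_sum J F f = (\<lambda>_. 0)" if "f \<notin> ell2 I" for f
      unfolding eq using bop_outside[OF bF that] by (simp cong: infsum_cong)
  qed
  have hs: "((\<lambda>n. ip f (F n f)) has_sum ip f (op_sum J F f)) J" if f: "f \<in> ell2 I" for f
    unfolding eq by (rule ip_has_sum[OF f mem[OF _ f] nsm[OF f]])
  have posn: "Im (ip f (F n f)) = 0" "0 \<le> Re (ip f (F n f))" if "f \<in> ell2 I" "n \<in> J" for f n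
    by (rule positive_Im[OF trace_class_positive[OF F[OF that(2)]] that(1)],
        rule positive_Re[OF trace_class_positive[OF F[OF that(2)]] that(1)])
  have pos: "positive I (op_sum J F)"
    unfolding positive_def
  proof (intro conjI ballI bop)
    fix f
    assume f: "f \<in> ell2 I"
    have "((\<lambda>n. Im (ip f (F n f))) has_sum Im (ip f (op_sum J F f))) J"
      by (rule has_sum_Im[OF hs[OF f]])
    then have "Im (ip f (op_sum J F f)) = 0"
      by (rule has_sum_unique) (simp add: posn(1)[OF f] cong: has_sum_cong)
    then show "ip f (op_sum J F f) \<in> \<real>"
      by (simp add: complex_is_Real_iff)
    show "0 \<le> Re (ip f (op_sum J F f))"
      by (rule has_sum_nonneg[OF has_sum_Re[OF hs[OF f]]]) (rule posn(2)[OF f])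
  qed
  let ?d = "\<lambda>n x. Re (ip (ket x) (F n (ket x)))"
  have sm2: "(\<lambda>(n, x). ?d n x) summable_on J \<times> I"
  proof (rule summable_on_SigmaI[where g = "\<lambda>n. tr I (F n)"])
    show "((\<lambda>x. case (n, x) of (n, x) \<Rightarrow> ?d n x) has_sum tr I (F n)) I" if "n \<in> J" for n
      using F[OF that] by (simp add: tr_def trace_class_def)
  qed (use sm posn(2)[OF ket_ell2] in auto)
  have sm2': "(\<lambda>(x, n). ?d n x) summable_on I \<times> J"
    using sm2 by (subst summable_on_swap) (simp add: case_prod_unfold)
  have diag: "Re (ip (ket x) (op_sum J F (ket x))) = (\<Sum>\<^sub>\<infinity>n\<in>J. ?d n x)" if "x \<in> I" for x
    using infsumI[OF has_sum_Re[OF hs[OF ket_ell2[OF that]]]] by simp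
  have "(\<lambda>x. \<Sum>\<^sub>\<infinity>n\<in>J. ?d n x) summable_on I"
    using summable_on_Sigma_banach[OF sm2'] by simp
  then show "op_sum J F \<in> trace_class I"
    using pos diag by (simp add: trace_class_def cong: summable_on_cong)
  have "tr I (op_sum J F) = (\<Sum>\<^sub>\<infinity>x\<in>I. \<Sum>\<^sub>\<infinity>n\<in>J. ?d n x)"
    unfolding tr_def by (rule infsum_cong) (rule diag)
  also have "\<dots> = (\<Sum>\<^sub>\<infinity>n\<in>J. \<Sum>\<^sub>\<infinity>x\<in>I. ?d n x)"
    by (rule infsum_swap_banach[OF sm2'])
  finally show "tr I (op_sum J F) = (\<Sum>\<^sub>\<infinity>n\<in>J. tr I (F n))"
    by (simp add: tr_def)
qed

lemma op_sum_remove: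
  assumes F: "\<And>n. n \<in> J \<Longrightarrow> F n \<in> trace_class I" and sm: "(\<lambda>n. tr I (F n)) summable_on J"
    and m: "m \<in> J"
  shows "op_sum J F = (\<lambda>f x. F m f x + op_sum (J - {m}) F f x)"
proof (intro ext)
  fix f x
  have "(\<lambda>n. F n f x) summable_on J - {m}"
    by (rule summable_on_subset_banach[OF trace_class_entry_summable[OF F sm]]) auto
  then have "infsum (\<lambda>n. F n f x) (insert m (J - {m})) = F m f x + infsum (\<lambda>n. F n f x) (J - {m})"
    by (rule infsum_insert) simp
  then show "op_sum J F f x = F m f x + op_sum (J - {m}) F f x"
    using m by (simp add: op_sum_def insert_absorb)
qed

text \<open>
  Countable additivity need not be assumed: it follows from additivity, because the trace of the
  tail of a sum tends to 0.
\<close>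

definition superop :: "'i set \<Rightarrow> ('i oper \<Rightarrow> 'i oper) \<Rightarrow> bool" where
  "superop I S \<longleftrightarrow> (\<forall>\<rho>\<in>trace_class I. S \<rho> \<in> trace_class I \<and> tr I (S \<rho>) \<le> tr I \<rho>)
     \<and> (\<forall>\<rho>\<in>trace_class I. \<forall>\<sigma>\<in>trace_class I.
          S (\<lambda>f x. \<rho> f x + \<sigma> f x) = (\<lambda>f x. S \<rho> f x + S \<sigma> f x))"

lemma superop_trace_class: "superop I S \<Longrightarrow> \<rho> \<in> trace_class I \<Longrightarrow> S \<rho> \<in> trace_class I"
  by (simp add: superop_def)

lemma superop_tr: "superop I S \<Longrightarrow> \<rho> \<in> trace_class I \<Longrightarrow> tr I (S \<rho>) \<le> tr I \<rho>"
  by (simp add: superop_def)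

lemma superop_add:
  "superop I S \<Longrightarrow> \<rho> \<in> trace_class I \<Longrightarrow> \<sigma> \<in> trace_class I
    \<Longrightarrow> S (\<lambda>f x. \<rho> f x + \<sigma> f x) = (\<lambda>f x. S \<rho> f x + S \<sigma> f x)"
  by (simp add: superop_def)

lemma superop_comp:
  assumes "superop I S" "superop I T"
  shows "superop I (S \<circ> T)"
  unfolding superop_def
proof (intro conjI ballI)
  fix \<rho>
  assume \<rho>: "\<rho> \<in> trace_class I"
  note T = superop_trace_class[OF assms(2) \<rho>]
  show "(S \<circ> T) \<rho> \<in> trace_class I"
    using superop_trace_class[OF assms(1) T] by simp
  show "tr I ((S \<circ> T) \<rho>) \<le> tr I \<rho>"
    using superop_tr[OF assms(1) T] superop_tr[OF assms(2) \<rho>] by simp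
  fix \<sigma>
  assume \<sigma>: "\<sigma> \<in> trace_class I"
  show "(S \<circ> T) (\<lambda>f x. \<rho> f x + \<sigma> f x) = (\<lambda>f x. (S \<circ> T) \<rho> f x + (S \<circ> T) \<sigma> f x)"
    using superop_add[OF assms(1) T superop_trace_class[OF assms(2) \<sigma>]]
      superop_add[OF assms(2) \<rho> \<sigma>] by simp
qed

lemma superop_id: "superop I (\<lambda>\<rho>. \<rho>)"
  by (simp add: superop_def)

lemma superop_op_sum:
  assumes S: "superop I S"
    and F: "\<And>n. n \<in> J \<Longrightarrow> F n \<in> trace_class I" and sm: "(\<lambda>n. tr I (F n)) summable_on J"
  shows "S (op_sum J F) = op_sum J (\<lambda>n. S (F n))"
proof (intro ext)
  fix f x
  have FJ: "\<And>n. n \<in> J - N \<Longrightarrow> F n \<in> trace_class I" for N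
    using F by simp
  have smJ: "(\<lambda>n. tr I (F n)) summable_on J - N" for N
    by (rule summable_on_subset_banach[OF sm]) simp
  \<comment> \<open>Additivity peels off the summands in \<open>N\<close> one at a time; what
    remains is \<open>S\<close> applied to the tail.\<close>
  have part: "S (op_sum J F) = (\<lambda>f x. (\<Sum>n\<in>N. S (F n) f x) + S (op_sum (J - N) F) f x)"
    if "finite N" "N \<subseteq> J" for N
    using that
  proof (induction N)
    case (insert m N)
    have m: "m \<in> J - N"
      using insert by simp
    have "J - N - {m} = J - insert m N"
      by auto
    then have "op_sum (J - N) F = (\<lambda>f x. F m f x + op_sum (J - insert m N) F f x)"
      using op_sum_remove[OF FJ[of _ N] smJ m] by simp
    moreover have "op_sum (J - insert m N) F \<in> trace_class I"
      by (rule trace_class_op_sum[OF FJ smJ])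
    ultimately have "S (op_sum (J - N) F) = (\<lambda>f x. S (F m) f x + S (op_sum (J - insert m N) F) f x)"
      using superop_add[OF S FJ[OF m]] by simp
    then show ?case
      using insert by (simp add: add_ac)
  qed simp
  show "S (op_sum J F) f x = op_sum J (\<lambda>n. S (F n)) f x"
  proof (cases "f \<in> ell2 I")
    case f: True
    have "((\<lambda>n. S (F n) f x) has_sum S (op_sum J F) f x) J"
    proof (rule has_sum_by_tails[OF sm, where C = "l2norm f"])
      fix N
      assume N: "finite N" "N \<subseteq> J"
      have t: "op_sum (J - N) F \<in> trace_class I"
        by (rule trace_class_op_sum[OF FJ smJ])
      note St = superop_trace_class[OF S t]
      have "cmod (S (op_sum J F) f x - (\<Sum>n\<in>N. S (F n) f x)) = cmod (S (op_sum (J - N) F) f x)"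
        by (simp add: part[OF N])
      also have "\<dots> \<le> l2norm (S (op_sum (J - N) F) f)"
        by (rule cmod_le_l2norm[OF bop_ell2[OF trace_class_bop[OF St] f]])
      also have "\<dots> \<le> tr I (S (op_sum (J - N) F)) * l2norm f"
        by (rule l2norm_le_tr[OF St f])
      also have "\<dots> \<le> tr I (op_sum (J - N) F) * l2norm f"
        by (intro mult_right_mono superop_tr[OF S t]) simp
      also have "tr I (op_sum (J - N) F) = (\<Sum>\<^sub>\<infinity>n\<in>J - N. tr I (F n))"
        by (rule tr_op_sum[OF FJ smJ])
      finally show "cmod (S (op_sum J F) f x - (\<Sum>n\<in>N. S (F n) f x))
          \<le> l2norm f * (\<Sum>\<^sub>\<infinity>n\<in>J - N. tr I (F n))"
        by (simp add: mult.commute)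
    qed
    then show ?thesis
      by (simp add: op_sum_def infsumI)
  next
    \<comment> \<open>Outside the space, all operators involved take the value 0 by
      extensionality.\<close>
    case f: False
    have "S (op_sum J F) f = (\<lambda>_. 0)"
      by (rule bop_outside[OF trace_class_bop[OF superop_trace_class[OF S trace_class_op_sum[OF F sm]]] f])
    moreover have "S (F n) f = (\<lambda>_. 0)" if "n \<in> J" for n
      by (rule bop_outside[OF trace_class_bop[OF superop_trace_class[OF S F[OF that]]] f])
    ultimately show ?thesis
      by (simp add: op_sum_def cong: infsum_cong)
  qed
qed

lemma op_sum_empty: "op_sum {} F = (\<lambda>_ _. 0)"
  by (simp add: op_sum_def)

lemma zero_trace_class: "(\<lambda>_ _. 0) \<in> trace_class I"
  by (simp add: trace_class_def positive_def zero_bop)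

text \<open>The zero operator is the empty sum, so this is a case of
  \<open>superop_op_sum\<close>.\<close>

lemma superop_zero: "superop I S \<Longrightarrow> S (\<lambda>_ _. 0) = (\<lambda>_ _. 0)"
  using superop_op_sum[of I S "{}"] by (simp add: op_sum_empty)

lemma superop_abort: "superop I (\<lambda>_ _ _. 0)"
  unfolding superop_def using zero_trace_class tr_nonneg by (auto simp: tr_def)

text \<open>One bound on finite partial traces yields the summability that makes the sum
  trace-class, and also the trace bound of the sum. Initialisations, conditionals and loops are all
  instances.\<close>

lemma superop_family:
  assumes S: "\<And>m. m \<in> J \<Longrightarrow> superop I (S m)"
    and le: "\<And>X \<rho>. finite X \<Longrightarrow> X \<subseteq> J \<Longrightarrow> \<rho> \<in> trace_class I \<Longrightarrow> (\<Sum>m\<in>X. tr I (S m \<rho>)) \<le> tr I \<rho>"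
  shows "superop I (\<lambda>\<rho>. op_sum J (\<lambda>m. S m \<rho>))"
    and "\<rho> \<in> trace_class I \<Longrightarrow> (\<lambda>m. tr I (S m \<rho>)) summable_on J"
proof -
  note tc = superop_trace_class[OF S]
  have sm: "(\<lambda>m. tr I (S m \<rho>)) summable_on J" if \<rho>: "\<rho> \<in> trace_class I" for \<rho>
    by (rule nonneg_bounded_partial_sums_imp_summable_on[where C = "tr I \<rho>"])
      (auto intro!: eventually_finite_subsets_at_top_weakI tr_nonneg tc le \<rho>)
  then show "\<rho> \<in> trace_class I \<Longrightarrow> (\<lambda>m. tr I (S m \<rho>)) summable_on J" .
  show "superop I (\<lambda>\<rho>. op_sum J (\<lambda>m. S m \<rho>))"
    unfolding superop_def
  proof (intro conjI ballI)
    fix \<rho>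
    assume \<rho>: "\<rho> \<in> trace_class I"
    show "op_sum J (\<lambda>m. S m \<rho>) \<in> trace_class I"
      by (rule trace_class_op_sum[OF tc[OF _ \<rho>] sm[OF \<rho>]])
    show "tr I (op_sum J (\<lambda>m. S m \<rho>)) \<le> tr I \<rho>"
      using infsum_le_finite_sums[OF sm[OF \<rho>] le[OF _ _ \<rho>]]
      by (simp add: tr_op_sum[OF tc[OF _ \<rho>] sm[OF \<rho>]])
    fix \<sigma>
    assume \<sigma>: "\<sigma> \<in> trace_class I"
    show "op_sum J (\<lambda>m. S m (\<lambda>f x. \<rho> f x + \<sigma> f x))
        = (\<lambda>f x. op_sum J (\<lambda>m. S m \<rho>) f x + op_sum J (\<lambda>m. S m \<sigma>) f x)"
    proof (intro ext)
      fix f x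
      have "(\<Sum>\<^sub>\<infinity>m\<in>J. S m (\<lambda>f x. \<rho> f x + \<sigma> f x) f x) = (\<Sum>\<^sub>\<infinity>m\<in>J. S m \<rho> f x + S m \<sigma> f x)"
        by (rule infsum_cong) (simp add: superop_add[OF S \<rho> \<sigma>])
      also have "\<dots> = (\<Sum>\<^sub>\<infinity>m\<in>J. S m \<rho> f x) + (\<Sum>\<^sub>\<infinity>m\<in>J. S m \<sigma> f x)"
        by (intro infsum_add trace_class_entry_summable[OF tc[OF _ \<rho>] sm[OF \<rho>]]
            trace_class_entry_summable[OF tc[OF _ \<sigma>] sm[OF \<sigma>]])
      finally show "op_sum J (\<lambda>m. S m (\<lambda>f x. \<rho> f x + \<sigma> f x)) f x
          = op_sum J (\<lambda>m. S m \<rho>) f x + op_sum J (\<lambda>m. S m \<sigma>) f x"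
        by (simp add: op_sum_def)
    qed
  qed
qed

section \<open>Sandwiches and Kraus families\<close>

lemma sandwich_comp:
  assumes "A \<in> bop I" "C \<in> bop I"
  shows "sandwich I A (sandwich I C \<rho>) = sandwich I (A \<circ> C) \<rho>"
  by (simp add: sandwich_def adj_comp[OF assms] comp_assoc)

lemma sandwich_add:
  assumes A: "A \<in> bop I" and "\<rho> \<in> bop I" "\<sigma> \<in> bop I"
  shows "sandwich I A (\<lambda>f x. \<rho> f x + \<sigma> f x) = (\<lambda>f x. sandwich I A \<rho> f x + sandwich I A \<sigma> f x)"
proof
  fix f
  have "adj I A f \<in> ell2 I"
    using bop_ell2[OF adj_bop[OF A], of f] bop_outside[OF adj_bop[OF A], of f]
    by (cases "f \<in> ell2 I") simp_all
  then have "\<rho> (adj I A f) \<in> ell2 I" "\<sigma> (adj I A f) \<in> ell2 I"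
    using assms(2,3) by (simp_all add: bop_ell2)
  then show "sandwich I A (\<lambda>f x. \<rho> f x + \<sigma> f x) f = (\<lambda>x. sandwich I A \<rho> f x + sandwich I A \<sigma> f x)"
    by (simp add: sandwich_def bop_add[OF A])
qed

text \<open>The diagonal entry at \<open>x\<close> of the sandwich with \<open>A m\<close> is the
  form of \<open>\<rho>\<close> at \<open>adj I (A m) (ket x)\<close>, and the inner product of that
  vector with \<open>v\<close> is the entry \<open>A m v x\<close>. The norm assumption is therefore
  Bessel's inequality for the vectors indexed by pairs of \<open>x\<close> and \<open>m\<close>, and
  \<open>bessel_trace\<close> applies.\<close>

lemma kraus_family:
  assumes A: "\<And>m. m \<in> X \<Longrightarrow> A m \<in> bop I" and X: "finite X"
    and le: "\<And>f. f \<in> ell2 I \<Longrightarrow> (\<Sum>m\<in>X. (l2norm (A m f))\<^sup>2) \<le> (l2norm f)\<^sup>2"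
    and \<rho>: "\<rho> \<in> trace_class I"
  shows "m \<in> X \<Longrightarrow> sandwich I (A m) \<rho> \<in> trace_class I"
    and "(\<Sum>m\<in>X. tr I (sandwich I (A m) \<rho>)) \<le> tr I \<rho>"
proof -
  note b\<rho> = trace_class_bop[OF \<rho>]
  have bop: "sandwich I (A m) \<rho> \<in> bop I" if "m \<in> X" for m
    unfolding sandwich_def by (intro bop_comp b\<rho> A adj_bop that)
  have quad: "ip f (sandwich I (A m) \<rho> f) = ip (adj I (A m) f) (\<rho> (adj I (A m) f))"
    if "m \<in> X" "f \<in> ell2 I" for m f
    using ip_adj_left[OF A[OF that(1)] that(2)] bop_ell2[OF b\<rho>] bop_ell2[OF adj_bop[OF A[OF that(1)]] that(2)]
    by (simp add: sandwich_def)
  have pos: "positive I (sandwich I (A m) \<rho>)" if "m \<in> X" for m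
    unfolding positive_def
  proof (intro conjI ballI bop that)
    fix f
    assume f: "f \<in> ell2 I"
    note a = bop_ell2[OF adj_bop[OF A[OF that]] f]
    show "ip f (sandwich I (A m) \<rho> f) \<in> \<real>" "0 \<le> Re (ip f (sandwich I (A m) \<rho> f))"
      unfolding quad[OF that f]
      using positive_Im[OF trace_class_positive[OF \<rho>] a] positive_Re[OF trace_class_positive[OF \<rho>] a]
      by (simp_all add: complex_is_Real_iff)
  qed
  \<comment> \<open>\<open>X'\<close> will be \<open>{m}\<close> for the trace-class property of one
    sandwich and \<open>X\<close> for the bound on the total trace.\<close>
  have fin: "(\<Sum>x\<in>Y. \<Sum>m\<in>X'. Re (ip (ket x) (sandwich I (A m) \<rho> (ket x)))) \<le> tr I \<rho>"
    if X': "X' \<subseteq> X" and Y: "finite Y" "Y \<subseteq> I" for X' Y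
  proof -
    let ?g = "\<lambda>p. adj I (A (snd p)) (ket (fst p))"
    have finX': "finite X'"
      using X X' by (rule rev_finite_subset)
    have g: "?g p \<in> ell2 I" if "p \<in> Y \<times> X'" for p
      by (rule bop_ell2[OF adj_bop[OF A] ket_ell2]) (use that X' Y in auto)
    have "(\<Sum>p\<in>Y \<times> X'. Re (ip (?g p) (\<rho> (?g p)))) \<le> tr I \<rho>"
    proof (rule bessel_trace[OF \<rho>])
      show "finite (Y \<times> X')"
        using Y finX' by simp
      fix v
      assume v: "v \<in> ell2 I"
      have "ip (adj I (A m) (ket x)) v = A m v x" if "x \<in> Y" "m \<in> X'" for x m
        by (subst ip_adj_left[OF A ket_ell2 v]) (use that X' Y in \<open>auto simp: ip_ket_left\<close>)
      then have "(\<Sum>p\<in>Y \<times> X'. (cmod (ip (?g p) v))\<^sup>2) = (\<Sum>x\<in>Y. \<Sum>m\<in>X'. (cmod (A m v x))\<^sup>2)"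
        unfolding sum.cartesian_product by (intro sum.cong) auto
      also have "\<dots> = (\<Sum>m\<in>X'. \<Sum>x\<in>Y. (cmod (A m v x))\<^sup>2)"
        by (rule sum.swap)
      also have "\<dots> \<le> (\<Sum>m\<in>X'. (l2norm (A m v))\<^sup>2)"
        by (intro sum_mono sum_sq_le_l2norm[of _ I] bop_ell2[OF A] v Y) (use X' in auto)
      also have "\<dots> \<le> (\<Sum>m\<in>X. (l2norm (A m v))\<^sup>2)"
        by (rule sum_mono2[OF X X']) simp
      also note le[OF v]
      finally show "(\<Sum>p\<in>Y \<times> X'. (cmod (ip (?g p) v))\<^sup>2) \<le> (l2norm v)\<^sup>2" .
    qed (rule g)
    also have "(\<Sum>p\<in>Y \<times> X'. Re (ip (?g p) (\<rho> (?g p))))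
        = (\<Sum>x\<in>Y. \<Sum>m\<in>X'. Re (ip (ket x) (sandwich I (A m) \<rho> (ket x))))"
      unfolding sum.cartesian_product
      by (intro sum.cong) (use X' Y in \<open>auto simp: quad[OF _ ket_ell2] subset_iff\<close>)
    finally show ?thesis .
  qed
  have sm: "(\<lambda>x. Re (ip (ket x) (sandwich I (A m) \<rho> (ket x)))) summable_on I" if m: "m \<in> X" for m
  proof (rule nonneg_bounded_partial_sums_imp_summable_on[where C = "tr I \<rho>"])
    show "0 \<le> Re (ip (ket x) (sandwich I (A m) \<rho> (ket x)))" if "x \<in> I" for x
      by (rule positive_Re[OF pos[OF m] ket_ell2[OF that]])
    show "\<forall>\<^sub>F Y in finite_subsets_at_top I.
        (\<Sum>x\<in>Y. Re (ip (ket x) (sandwich I (A m) \<rho> (ket x)))) \<le> tr I \<rho>"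
      using fin[of "{m}"] m by (intro eventually_finite_subsets_at_top_weakI) simp
  qed
  show "m \<in> X \<Longrightarrow> sandwich I (A m) \<rho> \<in> trace_class I"
    using pos sm by (simp add: trace_class_def)
  have "(\<Sum>m\<in>X. tr I (sandwich I (A m) \<rho>))
      = (\<Sum>\<^sub>\<infinity>x\<in>I. \<Sum>m\<in>X. Re (ip (ket x) (sandwich I (A m) \<rho> (ket x))))"
    unfolding tr_def by (rule infsum_finite_sum[symmetric]) (rule sm)
  also have "\<dots> \<le> tr I \<rho>"
    by (rule infsum_le_finite_sums[OF summable_on_finite_sum]) (use sm fin in auto)
  finally show "(\<Sum>m\<in>X. tr I (sandwich I (A m) \<rho>)) \<le> tr I \<rho>" .
qed

lemma superop_sandwich:
  assumes A: "A \<in> bop I" and le: "\<And>f. f \<in> ell2 I \<Longrightarrow> l2norm (A f) \<le> l2norm f"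
  shows "superop I (sandwich I A)"
proof -
  have "(\<Sum>m\<in>{()}. (l2norm (A f))\<^sup>2) \<le> (l2norm f)\<^sup>2" if "f \<in> ell2 I" for f
    using power_mono[OF le[OF that] l2norm_nonneg] by simp
  note kf = kraus_family[of "{()}" "\<lambda>_. A" I, OF A _ this]
  show ?thesis
    unfolding superop_def
    using kf sandwich_add[OF A trace_class_bop trace_class_bop] by auto
qed

section \<open>Operators on registers\<close>

text \<open>
  The values of \<open>x\<close> on \<open>Q\<close> are irrelevant, so \<open>x\<close> may assign values to all variables in \<open>V\<close> or only to
  those in \<open>V - Q\<close>.
\<close>

definition slice :: "('v \<Rightarrow> 'b set) \<Rightarrow> 'v set \<Rightarrow> ('v \<Rightarrow> 'b) vec \<Rightarrow> ('v \<Rightarrow> 'b) \<Rightarrow> ('v \<Rightarrow> 'b) vec" where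
  "slice B Q f x = (\<lambda>y. if y \<in> idx B Q then f (override_on x y Q) else 0)"

lemma ext_apply:
  "ext B V Q A f x
    = (if f \<in> ell2 (idx B V) \<and> x \<in> idx B V then A (slice B Q f x) (restrict x Q) else 0)"
  by (simp add: ext_def slice_def)

lemma override_idx: "Q \<subseteq> V \<Longrightarrow> x \<in> idx B V \<union> idx B (V - Q) \<Longrightarrow> y \<in> idx B Q \<Longrightarrow> override_on x y Q \<in> idx B V"
  by (auto simp: PiE_iff extensional_def override_on_def)

lemma restrict_override: "y \<in> idx B Q \<Longrightarrow> restrict (override_on x y Q) Q = y"
  by (auto simp: PiE_iff extensional_def override_on_def restrict_def fun_eq_iff)

text \<open>\<open>ext\<close> takes slices at assignments to all of \<open>V\<close>, whereas the
  sums over slices run through assignments to \<open>V - Q\<close>; this equates the two.\<close>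

lemma slice_restrict: "Q \<subseteq> V \<Longrightarrow> x \<in> idx B V \<Longrightarrow> slice B Q f (restrict x (V - Q)) = slice B Q f x"
proof -
  assume "Q \<subseteq> V" "x \<in> idx B V"
  then have "override_on (restrict x (V - Q)) y Q = override_on x y Q" for y
    by (auto simp: override_on_def restrict_def fun_eq_iff PiE_iff extensional_def)
  then show ?thesis
    by (simp add: slice_def cong: if_cong)
qed

lemma slice_override: "slice B Q f (override_on x y Q) = slice B Q f x"
proof -
  have "override_on (override_on x y Q) z Q = override_on x z Q" for z
    by (auto simp: override_on_def)
  then show ?thesis
    by (simp add: slice_def cong: if_cong)
qed

lemma slice_lin: "slice B Q (\<lambda>x. a * f x + g x) x = (\<lambda>y. a * slice B Q f x y + slice B Q g x y)"
  by (auto simp: slice_def)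

text \<open>Together with \<open>override_image\<close>, this is the bijection of index sets behind
  the factorisation of the space over \<open>V\<close> into the spaces over \<open>V - Q\<close> and
  \<open>Q\<close>.\<close>

lemma override_inj:
  "inj_on (\<lambda>(w, y). override_on w y Q) (idx B (V - Q) \<times> idx B Q)"
proof (rule inj_onI, clarify)
  fix w y w' y'
  assume w: "w \<in> idx B (V - Q)" "w' \<in> idx B (V - Q)" and y: "y \<in> idx B Q" "y' \<in> idx B Q"
    and eq: "override_on w y Q = override_on w' y' Q"
  have "y = y'"
    using restrict_override[OF y(1), of w] restrict_override[OF y(2), of w'] eq by simp
  moreover have "w v = w' v" for v
  proof (cases "v \<in> Q")
    case True
    then show ?thesis
      using w by (simp add: PiE_iff extensional_def)
  next
    case False
    then show ?thesis
      using fun_cong[OF eq, of v] by simp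
  qed
  ultimately show "w = w' \<and> y = y'"
    by auto
qed

lemma override_image:
  assumes "Q \<subseteq> V"
  shows "(\<lambda>(w, y). override_on w y Q) ` (idx B (V - Q) \<times> idx B Q) = idx B V"
proof (intro equalityI subsetI)
  fix x
  assume "x \<in> (\<lambda>(w, y). override_on w y Q) ` (idx B (V - Q) \<times> idx B Q)"
  then show "x \<in> idx B V"
  proof (rule imageE)
    fix p
    assume "x = (\<lambda>(w, y). override_on w y Q) p" "p \<in> idx B (V - Q) \<times> idx B Q"
    then show ?thesis
      using override_idx[OF assms UnI2, of "fst p" B "snd p"]
      by (simp add: mem_Times_iff case_prod_unfold)
  qed
next
  fix x
  assume x: "x \<in> idx B V"
  have "x = override_on (restrict x (V - Q)) (restrict x Q) Q"
    using x assms by (auto simp: override_on_def restrict_def fun_eq_iff PiE_iff extensional_def)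
  moreover have "restrict x (V - Q) \<in> idx B (V - Q)" "restrict x Q \<in> idx B Q"
    using x assms by (auto simp: PiE_iff)
  ultimately show "x \<in> (\<lambda>(w, y). override_on w y Q) ` (idx B (V - Q) \<times> idx B Q)"
    by (intro image_eqI[where x = "(restrict x (V - Q), restrict x Q)"]) auto
qed

lemma has_sum_slices:
  fixes F :: "('v \<Rightarrow> 'b) \<Rightarrow> 'c :: {topological_comm_monoid_add, t3_space}"
  assumes "Q \<subseteq> V"
  shows "(F has_sum s) (idx B V)
    \<longleftrightarrow> ((\<lambda>(w, y). F (override_on w y Q)) has_sum s) (idx B (V - Q) \<times> idx B Q)"
  using has_sum_reindex[OF override_inj[where Q = Q and B = B and V = V], where g = F and x = s] unfolding override_image[OF assms]
  by (simp add: comp_def case_prod_unfold)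

lemma slice_ell2_aux:
  assumes Q: "Q \<subseteq> V" and f: "f \<in> ell2 (idx B V)" and w: "w \<in> idx B (V - Q)"
  shows "slice B Q f w \<in> ell2 (idx B Q)"
proof -
  have "(\<lambda>x. (cmod (f x))\<^sup>2) summable_on idx B V"
    using f by (simp add: ell2_def)
  then obtain s where "((\<lambda>x. (cmod (f x))\<^sup>2) has_sum s) (idx B V)"
    by (auto simp: summable_on_def)
  then have "(\<lambda>(w, y). (cmod (f (override_on w y Q)))\<^sup>2) summable_on idx B (V - Q) \<times> idx B Q"
    unfolding has_sum_slices[OF Q] by (rule has_sum_imp_summable)
  from summable_on_SigmaD1[OF this w]
  have "(\<lambda>y. (cmod (f (override_on w y Q)))\<^sup>2) summable_on idx B Q" .
  then have "(\<lambda>y. (cmod (slice B Q f w y))\<^sup>2) summable_on idx B Q"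
    by (simp add: slice_def cong: summable_on_cong)
  then show ?thesis
    by (simp add: ell2_def slice_def)
qed

lemma restrict_idx: "Q \<subseteq> V \<Longrightarrow> x \<in> idx B V \<Longrightarrow> restrict x Q \<in> idx B Q"
  by (auto simp: PiE_iff)

lemma slice_ell2:
  assumes Q: "Q \<subseteq> V" and f: "f \<in> ell2 (idx B V)" and x: "x \<in> idx B V \<union> idx B (V - Q)"
  shows "slice B Q f x \<in> ell2 (idx B Q)"
  using x
proof
  assume x: "x \<in> idx B V"
  have "restrict x (V - Q) \<in> idx B (V - Q)"
    by (rule restrict_idx[OF _ x]) auto
  then show ?thesis
    using slice_ell2_aux[OF Q f] slice_restrict[OF Q x, of f] by metis
qed (rule slice_ell2_aux[OF Q f])

text \<open>Slicing turns the space over \<open>V\<close> into a direct sum of copies of the space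
  over \<open>Q\<close>, one for each assignment to \<open>V - Q\<close>.\<close>

lemma ip_slices:
  assumes Q: "Q \<subseteq> V" and f: "f \<in> ell2 (idx B V)" and g: "g \<in> ell2 (idx B V)"
  shows "((\<lambda>w. ip (slice B Q f w) (slice B Q g w)) has_sum ip f g) (idx B (V - Q))"
proof -
  have "((\<lambda>x. cnj (f x) * g x) has_sum ip f g) UNIV"
    unfolding ip_def by (rule has_sum_infsum[OF ip_summable[OF f g]])
  then have "((\<lambda>x. cnj (f x) * g x) has_sum ip f g) (idx B V)"
    by (rule has_sum_cong_neutral[THEN iffD1, rotated -1]) (use ell2_outside[OF f] in auto)
  then have s: "((\<lambda>(w, y). cnj (f (override_on w y Q)) * g (override_on w y Q)) has_sum ip f g)
      (idx B (V - Q) \<times> idx B Q)"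
    unfolding has_sum_slices[OF Q] .
  show ?thesis
  proof (rule has_sum_SigmaD[OF s])
    fix w
    assume w: "w \<in> idx B (V - Q)"
    have "((\<lambda>y. cnj (slice B Q f w y) * slice B Q g w y) has_sum ip (slice B Q f w) (slice B Q g w)) UNIV"
      unfolding ip_def
      by (rule has_sum_infsum[OF ip_summable[OF slice_ell2_aux[OF Q f w] slice_ell2_aux[OF Q g w]]])
    then show "((\<lambda>y. case (w, y) of (w, y) \<Rightarrow> cnj (f (override_on w y Q)) * g (override_on w y Q))
        has_sum ip (slice B Q f w) (slice B Q g w)) (idx B Q)"
      by (rule has_sum_cong_neutral[THEN iffD1, rotated -1]) (auto simp: slice_def)
  qed
qed

lemma l2norm_slices:
  assumes Q: "Q \<subseteq> V" and f: "f \<in> ell2 (idx B V)"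
  shows "((\<lambda>w. (l2norm (slice B Q f w))\<^sup>2) has_sum (l2norm f)\<^sup>2) (idx B (V - Q))"
proof -
  have "((\<lambda>w. complex_of_real ((l2norm (slice B Q f w))\<^sup>2)) has_sum of_real ((l2norm f)\<^sup>2))
      (idx B (V - Q))"
    using ip_slices[OF Q f f] unfolding ip_self[OF f]
    by (rule has_sum_cong[THEN iffD1, rotated]) (rule ip_self[OF slice_ell2_aux[OF Q f]])
  then show ?thesis
    by (simp only: has_sum_of_real_iff)
qed

lemma ell2_by_slices:
  assumes Q: "Q \<subseteq> V" and out: "\<And>x. x \<notin> idx B V \<Longrightarrow> h x = 0"
    and sl: "\<And>w. w \<in> idx B (V - Q) \<Longrightarrow> slice B Q h w \<in> ell2 (idx B Q)"
    and sm: "(\<lambda>w. (l2norm (slice B Q h w))\<^sup>2) summable_on idx B (V - Q)"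
  shows "h \<in> ell2 (idx B V)"
proof -
  have "(\<lambda>(w, y). (cmod (h (override_on w y Q)))\<^sup>2) summable_on idx B (V - Q) \<times> idx B Q"
  proof (rule summable_on_SigmaI[OF _ sm])
    fix w
    assume w: "w \<in> idx B (V - Q)"
    have "((\<lambda>y. (cmod (slice B Q h w y))\<^sup>2) has_sum (l2norm (slice B Q h w))\<^sup>2) UNIV"
      unfolding l2norm_sq by (rule has_sum_infsum[OF ell2_summable[OF sl[OF w]]])
    then show "((\<lambda>y. case (w, y) of (w, y) \<Rightarrow> (cmod (h (override_on w y Q)))\<^sup>2)
        has_sum (l2norm (slice B Q h w))\<^sup>2) (idx B Q)"
      by (rule has_sum_cong_neutral[THEN iffD1, rotated -1]) (auto simp: slice_def)
  qed auto
  then have "(\<lambda>x. (cmod (h x))\<^sup>2) summable_on idx B V"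
    unfolding summable_on_def has_sum_slices[OF Q] .
  then show ?thesis
    using out by (simp add: ell2_def)
qed

text \<open>In the decomposition into slices, an extension is block diagonal with the same block
  \<open>A\<close> everywhere. Norms, adjoints and products of extensions can therefore be computed
  slice by slice.\<close>

lemma slice_ext:
  assumes Q: "Q \<subseteq> V" and A: "A \<in> bop (idx B Q)" and f: "f \<in> ell2 (idx B V)"
    and x: "x \<in> idx B V \<union> idx B (V - Q)"
  shows "slice B Q (ext B V Q A f) x = A (slice B Q f x)"
proof
  fix y
  show "slice B Q (ext B V Q A f) x y = A (slice B Q f x) y"
  proof (cases "y \<in> idx B Q")
    case True
    then show ?thesis
      using override_idx[OF Q x True] f
      by (simp add: slice_def[of B Q "ext B V Q A f"] ext_apply slice_override restrict_override)
  next
    case False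
    then show ?thesis
      using ell2_outside[OF bop_ell2[OF A slice_ell2[OF Q f x]] False]
      by (simp add: slice_def[of B Q "ext B V Q A f"])
  qed
qed

lemma ext_ell2:
  assumes Q: "Q \<subseteq> V" and A: "A \<in> bop (idx B Q)" and f: "f \<in> ell2 (idx B V)"
  shows "ext B V Q A f \<in> ell2 (idx B V)"
proof (rule ell2_by_slices[OF Q])
  show "ext B V Q A f x = 0" if "x \<notin> idx B V" for x
    using that by (simp add: ext_apply)
  show "slice B Q (ext B V Q A f) w \<in> ell2 (idx B Q)" if "w \<in> idx B (V - Q)" for w
    using bop_ell2[OF A slice_ell2_aux[OF Q f that]] slice_ext[OF Q A f, of w] that by simp
  obtain K where K: "0 \<le> K" "\<And>f. f \<in> ell2 (idx B Q) \<Longrightarrow> l2norm (A f) \<le> K * l2norm f"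
    using A by (rule bop_bound) blast
  show "(\<lambda>w. (l2norm (slice B Q (ext B V Q A f) w))\<^sup>2) summable_on idx B (V - Q)"
  proof (rule summable_on_comparison_test)
    show "(\<lambda>w. K\<^sup>2 * (l2norm (slice B Q f w))\<^sup>2) summable_on idx B (V - Q)"
      by (rule summable_on_cmult_right[OF has_sum_imp_summable[OF l2norm_slices[OF Q f]]])
    show "(l2norm (slice B Q (ext B V Q A f) w))\<^sup>2 \<le> K\<^sup>2 * (l2norm (slice B Q f w))\<^sup>2"
      if "w \<in> idx B (V - Q)" for w
      using power_mono[OF K(2)[OF slice_ell2_aux[OF Q f that]] l2norm_nonneg, of 2] that
      by (simp add: slice_ext[OF Q A f] power_mult_distrib)
  qed simp
qed

text \<open>The family and the factor \<open>c\<close> let one estimate serve the boundedness of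
  extensions, where \<open>c\<close> is the square of an operator bound, as well as contractions and
  Kraus families, where \<open>c = 1\<close>.\<close>

lemma ext_norm_family:
  assumes Q: "Q \<subseteq> V" and A: "\<And>m. m \<in> X \<Longrightarrow> A m \<in> bop (idx B Q)"
    and le: "\<And>h. h \<in> ell2 (idx B Q) \<Longrightarrow> (\<Sum>m\<in>X. (l2norm (A m h))\<^sup>2) \<le> c * (l2norm h)\<^sup>2"
    and f: "f \<in> ell2 (idx B V)"
  shows "(\<Sum>m\<in>X. (l2norm (ext B V Q (A m) f))\<^sup>2) \<le> c * (l2norm f)\<^sup>2"
proof -
  have s1: "((\<lambda>w. \<Sum>m\<in>X. (l2norm (slice B Q (ext B V Q (A m) f) w))\<^sup>2)
      has_sum (\<Sum>m\<in>X. (l2norm (ext B V Q (A m) f))\<^sup>2)) (idx B (V - Q))"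
    by (rule has_sum_finite_sum) (rule l2norm_slices[OF Q ext_ell2[OF Q A f]])
  have s2: "((\<lambda>w. c * (l2norm (slice B Q f w))\<^sup>2) has_sum c * (l2norm f)\<^sup>2) (idx B (V - Q))"
    by (rule has_sum_cmult_right[OF l2norm_slices[OF Q f]])
  show ?thesis
  proof (rule has_sum_mono[OF s1 s2])
    fix w
    assume w: "w \<in> idx B (V - Q)"
    have "slice B Q (ext B V Q (A m) f) w = A m (slice B Q f w)" if "m \<in> X" for m
      by (rule slice_ext[OF Q A[OF that] f]) (use w in simp)
    then show "(\<Sum>m\<in>X. (l2norm (slice B Q (ext B V Q (A m) f) w))\<^sup>2) \<le> c * (l2norm (slice B Q f w))\<^sup>2"
      using le[OF slice_ell2_aux[OF Q f w]] by simp
  qed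
qed

lemma ext_bop:
  assumes Q: "Q \<subseteq> V" and A: "A \<in> bop (idx B Q)"
  shows "ext B V Q A \<in> bop (idx B V)"
proof -
  obtain K where K: "0 \<le> K" "\<And>f. f \<in> ell2 (idx B Q) \<Longrightarrow> l2norm (A f) \<le> K * l2norm f"
    using A by (rule bop_bound) blast
  show ?thesis
  proof (rule bopI[where K = K])
    show "l2norm (ext B V Q A f) \<le> K * l2norm f" if f: "f \<in> ell2 (idx B V)" for f
    proof -
      have "(\<Sum>m\<in>{()}. (l2norm (ext B V Q A f))\<^sup>2) \<le> K\<^sup>2 * (l2norm f)\<^sup>2"
      proof (rule ext_norm_family[OF Q A _ f])
        show "(\<Sum>m\<in>{()}. (l2norm (A h))\<^sup>2) \<le> K\<^sup>2 * (l2norm h)\<^sup>2" if "h \<in> ell2 (idx B Q)" for h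
          using power_mono[OF K(2)[OF that] l2norm_nonneg, of 2] by (simp add: power_mult_distrib)
      qed
      then have "(l2norm (ext B V Q A f))\<^sup>2 \<le> (K * l2norm f)\<^sup>2"
        by (simp add: power_mult_distrib)
      then show ?thesis
        by (rule power2_le_imp_le) (simp add: K(1))
    qed
    show "ext B V Q A (\<lambda>x. a * f x + g x) = (\<lambda>x. a * ext B V Q A f x + ext B V Q A g x)"
      if fg: "f \<in> ell2 (idx B V)" "g \<in> ell2 (idx B V)" for a f g
    proof
      fix x
      show "ext B V Q A (\<lambda>x. a * f x + g x) x = a * ext B V Q A f x + ext B V Q A g x"
      proof (cases "x \<in> idx B V")
        case True
        then show ?thesis
          using fg bop_lin[OF A slice_ell2[OF Q fg(1)] slice_ell2[OF Q fg(2)], of x x a]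
          by (simp add: ext_apply ell2_lin slice_lin)
      qed (simp add: ext_apply)
    qed
    show "ext B V Q A f = (\<lambda>_. 0)" if "f \<notin> ell2 (idx B V)" for f
      using that by (simp add: ext_apply fun_eq_iff)
  qed (rule ext_ell2[OF Q A])
qed

lemma ext_adj:
  assumes Q: "Q \<subseteq> V" and A: "A \<in> bop (idx B Q)"
  shows "adj (idx B V) (ext B V Q A) = ext B V Q (adj (idx B Q) A)"
proof (rule adj_eqI[OF ext_bop[OF Q adj_bop[OF A]]])
  fix f g
  assume f: "f \<in> ell2 (idx B V)" and g: "g \<in> ell2 (idx B V)"
  have "((\<lambda>w. ip (slice B Q (ext B V Q (adj (idx B Q) A) f) w) (slice B Q g w))
      has_sum ip (ext B V Q (adj (idx B Q) A) f) g) (idx B (V - Q))"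
    by (rule ip_slices[OF Q ext_ell2[OF Q adj_bop[OF A] f] g])
  moreover have "ip (slice B Q (ext B V Q (adj (idx B Q) A) f) w) (slice B Q g w)
      = ip (slice B Q f w) (slice B Q (ext B V Q A g) w)" if w: "w \<in> idx B (V - Q)" for w
    using ip_adj_left[OF A slice_ell2_aux[OF Q f w] slice_ell2_aux[OF Q g w]]
      slice_ext[OF Q A g, of w] slice_ext[OF Q adj_bop[OF A] f, of w] w by simp
  ultimately have "((\<lambda>w. ip (slice B Q f w) (slice B Q (ext B V Q A g) w))
      has_sum ip (ext B V Q (adj (idx B Q) A) f) g) (idx B (V - Q))"
    by (simp cong: has_sum_cong)
  then show "ip (ext B V Q (adj (idx B Q) A) f) g = ip f (ext B V Q A g)"
    using ip_slices[OF Q f ext_ell2[OF Q A g]] by (rule has_sum_unique)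
qed

lemma ext_comp:
  assumes Q: "Q \<subseteq> V" and A: "A \<in> bop (idx B Q)" and C: "C \<in> bop (idx B Q)"
  shows "ext B V Q (A \<circ> C) = ext B V Q A \<circ> ext B V Q C"
proof (rule bop_eqI[OF ext_bop[OF Q bop_comp[OF A C]] bop_comp[OF ext_bop[OF Q A] ext_bop[OF Q C]]])
  fix f
  assume f: "f \<in> ell2 (idx B V)"
  show "ext B V Q (A \<circ> C) f = (ext B V Q A \<circ> ext B V Q C) f"
  proof
    show "ext B V Q (A \<circ> C) f x = (ext B V Q A \<circ> ext B V Q C) f x" for x
      using slice_ext[OF Q C f, of x] ext_ell2[OF Q C f] f by (simp add: ext_apply[where A = A] ext_apply[where A = "A \<circ> C"])
  qed
qed

lemma ext_zero: "ext B V Q (\<lambda>_ _. 0) = (\<lambda>_ _. 0)"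
  by (simp add: ext_apply fun_eq_iff)

section \<open>Matrix entries of extensions and commutation on disjoint registers\<close>

lemma ket_override:
  assumes "Q \<subseteq> V" "x \<in> idx B V" "x' \<in> idx B V" "y \<in> idx B Q"
  shows "override_on x' y Q = x \<longleftrightarrow> y = restrict x Q \<and> (\<forall>v\<in>V - Q. x' v = x v)"
proof (intro iffI conjI ballI)
  assume eq: "override_on x' y Q = x"
  show "y = restrict x Q"
    using restrict_override[OF assms(4), of x'] eq by simp
  show "x' v = x v" if "v \<in> V - Q" for v
    using fun_cong[OF eq, of v] that by simp
next
  assume "y = restrict x Q \<and> (\<forall>v\<in>V - Q. x' v = x v)"
  then have "override_on x' y Q v = x v" if "v \<in> V" for v
    using that by (cases "v \<in> Q") auto
  moreover have "override_on x' y Q v = x v" if "v \<notin> V" for v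
    using that assms by (auto simp: override_on_def PiE_iff extensional_def)
  ultimately show "override_on x' y Q = x"
    by blast
qed

lemma ext_ket:
  assumes Q: "Q \<subseteq> V" and A: "A \<in> bop (idx B Q)" and x: "x \<in> idx B V" and x': "x' \<in> idx B V"
  shows "ext B V Q A (ket x) x'
    = (if \<forall>v\<in>V - Q. x' v = x v then A (ket (restrict x Q)) (restrict x' Q) else 0)"
proof -
  have "slice B Q (ket x) x' = (if \<forall>v\<in>V - Q. x' v = x v then ket (restrict x Q) else (\<lambda>_. 0))"
    using ket_override[OF Q x x'] restrict_idx[OF Q x] by (auto simp: slice_def ket_def fun_eq_iff)
  then show ?thesis
    by (simp add: ext_apply ket_ell2[OF x] x' bop_zero_vec[OF A])
qed

text \<open>The matrix entry of the product is one entry of \<open>A\<close> times one entry of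
  \<open>C\<close>, which no longer shows the order of the two operators; \<open>ext_commute\<close>
  reads off this symmetry.\<close>

lemma ext_ext_ket:
  assumes Q: "Q \<subseteq> V" and R: "R \<subseteq> V" and disj: "Q \<inter> R = {}"
    and A: "A \<in> bop (idx B Q)" and C: "C \<in> bop (idx B R)"
    and x: "x \<in> idx B V" and x': "x' \<in> idx B V"
  shows "ext B V Q A (ext B V R C (ket x)) x'
    = (if \<forall>v\<in>V - (Q \<union> R). x' v = x v
       then A (ket (restrict x Q)) (restrict x' Q) * C (ket (restrict x R)) (restrict x' R) else 0)"
proof -
  \<comment> \<open>\<open>C\<close> leaves the variables in \<open>Q\<close> alone, so the
    intermediate vector, sliced along \<open>Q\<close>, is a multiple of one basis vector;
    \<open>c\<close> is that multiple.\<close>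
  define c where "c = (if \<forall>v\<in>V - (Q \<union> R). x' v = x v then C (ket (restrict x R)) (restrict x' R) else 0)"
  have "slice B Q (ext B V R C (ket x)) x' y = c * ket (restrict x Q) y" for y
  proof (cases "y \<in> idx B Q")
    case y: True
    have res: "restrict (override_on x' y Q) R = restrict x' R"
      using disj by (auto simp: override_on_def restrict_def fun_eq_iff)
    have agree: "(\<forall>v\<in>V - R. override_on x' y Q v = x v)
        \<longleftrightarrow> y = restrict x Q \<and> (\<forall>v\<in>V - (Q \<union> R). x' v = x v)"
    proof -
      have "y = restrict x Q \<longleftrightarrow> (\<forall>v\<in>Q. y v = x v)"
        using y by (auto simp: fun_eq_iff PiE_iff extensional_def)
      then show ?thesis
        using Q R disj by (auto simp: override_on_def)
    qed
    have "ext B V R C (ket x) (override_on x' y Q)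
        = (if y = restrict x Q \<and> (\<forall>v\<in>V - (Q \<union> R). x' v = x v)
           then C (ket (restrict x R)) (restrict x' R) else 0)"
      unfolding ext_ket[OF R C x override_idx[OF Q UnI1[OF x'] y]] res agree ..
    then show ?thesis
      using y by (simp add: slice_def c_def ket_def[of "restrict x Q"])
  next
    case False
    then show ?thesis
      using restrict_idx[OF Q x] by (auto simp: slice_def ket_def)
  qed
  then have "slice B Q (ext B V R C (ket x)) x' = (\<lambda>y. c * ket (restrict x Q) y)"
    by blast
  then show ?thesis
    using bop_scale[OF A ket_ell2[OF restrict_idx[OF Q x]], of c] ext_ell2[OF R C ket_ell2[OF x]] x'
    by (simp add: ext_apply[of B V Q] c_def)
qed

lemma ext_commute:
  assumes Q: "Q \<subseteq> V" and R: "R \<subseteq> V" and disj: "Q \<inter> R = {}"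
    and A: "A \<in> bop (idx B Q)" and C: "C \<in> bop (idx B R)"
  shows "ext B V Q A \<circ> ext B V R C = ext B V R C \<circ> ext B V Q A"
proof (rule bop_eq_on_kets[where I = "idx B V"])
  note bops = ext_bop[OF Q A] ext_bop[OF R C]
  show "ext B V Q A \<circ> ext B V R C \<in> bop (idx B V)" "ext B V R C \<circ> ext B V Q A \<in> bop (idx B V)"
    by (intro bop_comp bops)+
  fix x
  assume x: "x \<in> idx B V"
  show "(ext B V Q A \<circ> ext B V R C) (ket x) = (ext B V R C \<circ> ext B V Q A) (ket x)"
  proof
    fix x'
    show "(ext B V Q A \<circ> ext B V R C) (ket x) x' = (ext B V R C \<circ> ext B V Q A) (ket x) x'"
    proof (cases "x' \<in> idx B V")
      case True
      have "R \<inter> Q = {}"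
        using disj by auto
      then show ?thesis
        using ext_ext_ket[OF Q R disj A C x True] ext_ext_ket[OF R Q _ C A x True]
        by (simp add: Un_commute mult.commute)
    qed (simp add: ext_apply)
  qed
qed

text \<open>
  The completeness relation is only given entrywise. On vectors of finite support it can be tested
  against the vector itself; the inequality then extends by density.
\<close>

lemma measurement_norm:
  assumes M: "measurement I J M" and X: "finite X" "X \<subseteq> J" and f: "f \<in> ell2 I"
  shows "(\<Sum>m\<in>X. (l2norm (M m f))\<^sup>2) \<le> (l2norm f)\<^sup>2"
proof -
  have bM: "M m \<in> bop I" if "m \<in> J" for m
    using M that by (simp add: measurement_def)
  let ?t = "\<lambda>F x. if x \<in> F then f x else 0"
  have fin: "(\<Sum>m\<in>X. (l2norm (M m (?t F)))\<^sup>2) \<le> (l2norm f)\<^sup>2" if F: "finite F" "F \<subseteq> I" for F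
  proof -
    note g = ell2_finite_support[OF F, of f]
    \<comment> \<open>Tested against the truncation, completeness involves only the finitely many
      entries in \<open>F\<close>, and each summand becomes a squared norm.\<close>
    have Tip: "(\<Sum>x\<in>F. cnj (f x) * (adj I (M m) \<circ> M m) (?t F) x) = of_real ((l2norm (M m (?t F)))\<^sup>2)"
      if m: "m \<in> J" for m
    proof -
      note Mg = bop_ell2[OF bM[OF m] g]
      have "(\<Sum>x\<in>F. cnj (f x) * (adj I (M m) \<circ> M m) (?t F) x) = ip (?t F) (adj I (M m) (M m (?t F)))"
        using ip_finite_support[OF F(1), of "?t F"] by simp
      also have "\<dots> = ip (M m (?t F)) (M m (?t F))"
        by (rule ip_adj_right[OF bM[OF m] g Mg])
      finally show ?thesis
        by (simp only: ip_self[OF Mg])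
    qed
    have "((\<lambda>m. \<Sum>x\<in>F. cnj (f x) * (adj I (M m) \<circ> M m) (?t F) x)
        has_sum (\<Sum>x\<in>F. cnj (f x) * ?t F x)) J"
      by (intro has_sum_finite_sum has_sum_cmult_right)
        (use M g in \<open>unfold measurement_def, blast\<close>)
    moreover have "(\<Sum>x\<in>F. cnj (f x) * ?t F x) = of_real ((l2norm (?t F))\<^sup>2)"
      unfolding l2norm_sq_finite_support[OF F(1)] of_real_sum cmod_sq_eq[symmetric]
      by (rule sum.cong) auto
    ultimately have "((\<lambda>m. \<Sum>x\<in>F. cnj (f x) * (adj I (M m) \<circ> M m) (?t F) x)
        has_sum of_real ((l2norm (?t F))\<^sup>2)) J"
      by (simp only:)
    then have "((\<lambda>m. complex_of_real ((l2norm (M m (?t F)))\<^sup>2)) has_sum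
        of_real ((l2norm (?t F))\<^sup>2)) J"
      by (rule has_sum_cong[THEN iffD1, rotated]) (rule Tip)
    then have "((\<lambda>m. (l2norm (M m (?t F)))\<^sup>2) has_sum (l2norm (?t F))\<^sup>2) J"
      by (simp only: has_sum_of_real_iff)
    then have "(\<Sum>m\<in>X. (l2norm (M m (?t F)))\<^sup>2) \<le> (l2norm (?t F))\<^sup>2"
      by (rule finite_sum_le_has_sum) (use X in auto)
    also have "\<dots> \<le> (l2norm f)\<^sup>2"
      unfolding l2norm_sq_finite_support[OF F(1)] by (rule sum_sq_le_l2norm[OF f F(1)])
    finally show ?thesis .
  qed
  \<comment> \<open>One outcome at a time is enough because \<open>X\<close> is finite; no limit has
    to be exchanged with a sum over all of \<open>J\<close>.\<close>
  have lim: "((\<lambda>F. l2norm (M m (?t F))) \<longlongrightarrow> l2norm (M m f)) (finite_subsets_at_top I)" if m: "m \<in> X" for m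
  proof -
    have b: "M m \<in> bop I"
      using bM m X by auto
    obtain K where K: "\<And>f. f \<in> ell2 I \<Longrightarrow> l2norm (M m f) \<le> K * l2norm f"
      using b by (rule bop_bound) blast
    have near: "\<bar>l2norm (M m (?t F)) - l2norm (M m f)\<bar> \<le> K * l2norm (\<lambda>x. f x - ?t F x)"
      if F: "finite F" "F \<subseteq> I" for F
    proof -
      note g = ell2_finite_support[OF F, of f]
      note d = ell2_diff[OF f g]
      note Md = bop_ell2[OF b d] and Mg = bop_ell2[OF b g] and Mf = bop_ell2[OF b f]
      have eq: "M m (\<lambda>x. f x - ?t F x) = (\<lambda>x. M m f x - M m (?t F) x)"
        by (rule bop_diff[OF b f g])
      have "l2norm (M m f) \<le> l2norm (M m (\<lambda>x. f x - ?t F x)) + l2norm (M m (?t F))"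
        using l2norm_triangle[OF Md Mg] by (simp add: eq)
      moreover have "l2norm (M m (?t F)) \<le> l2norm (\<lambda>x. (-1) * M m (\<lambda>x. f x - ?t F x) x) + l2norm (M m f)"
        using l2norm_triangle[OF ell2_scale[OF Md, of "-1"] Mf] by (simp add: eq)
      moreover have "l2norm (\<lambda>x. (-1) * M m (\<lambda>x. f x - ?t F x) x) = l2norm (M m (\<lambda>x. f x - ?t F x))"
        unfolding l2norm_scale by simp
      ultimately show ?thesis
        using K[OF d] by linarith
    qed
    have "((\<lambda>F. l2norm (M m (?t F)) - l2norm (M m f)) \<longlongrightarrow> 0) (finite_subsets_at_top I)"
    proof (rule Lim_null_comparison)
      show "\<forall>\<^sub>F F in finite_subsets_at_top I.
          norm (l2norm (M m (?t F)) - l2norm (M m f)) \<le> K * l2norm (\<lambda>x. f x - ?t F x)"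
        unfolding real_norm_def by (rule eventually_finite_subsets_at_top_weakI) (rule near)
      show "((\<lambda>F. K * l2norm (\<lambda>x. f x - ?t F x)) \<longlongrightarrow> 0) (finite_subsets_at_top I)"
        by (rule tendsto_mult_right_zero[OF truncation_tendsto[OF f]])
    qed
    then show ?thesis
      by (rule Lim_null[THEN iffD2])
  qed
  show ?thesis
  proof (rule tendsto_upperbound)
    show "((\<lambda>F. \<Sum>m\<in>X. (l2norm (M m (?t F)))\<^sup>2) \<longlongrightarrow> (\<Sum>m\<in>X. (l2norm (M m f))\<^sup>2))
        (finite_subsets_at_top I)"
      by (intro tendsto_intros lim)
    show "\<forall>\<^sub>F F in finite_subsets_at_top I. (\<Sum>m\<in>X. (l2norm (M m (?t F)))\<^sup>2) \<le> (l2norm f)\<^sup>2"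
      by (rule eventually_finite_subsets_at_top_weakI) (rule fin)
  qed simp
qed

lemma op_sum_cong: "(\<And>n. n \<in> J \<Longrightarrow> F n = H n) \<Longrightarrow> op_sum J F = op_sum J H"
  by (simp add: op_sum_def cong: infsum_cong)

section \<open>Unitaries, orthonormal bases and contractions\<close>

lemma unitary_bop: "unitary I U \<Longrightarrow> U \<in> bop I"
  by (simp add: unitary_def)

lemma unitary_adj:
  assumes "unitary I U" "f \<in> ell2 I"
  shows "adj I U (U f) = f"
proof -
  have "(adj I U \<circ> U) f = idop I f"
    using assms(1) by (simp only: unitary_def)
  then show ?thesis
    using assms(2) by (simp add: idop_def)
qed

lemma unitary_norm:
  assumes U: "unitary I U" and f: "f \<in> ell2 I"
  shows "l2norm (U f) = l2norm f"
proof -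
  note Uf = bop_ell2[OF unitary_bop[OF U] f]
  have "ip (U f) (U f) = ip f f"
    using ip_adj_right[OF unitary_bop[OF U] f Uf] by (simp add: unitary_adj[OF U f])
  then have "(l2norm (U f))\<^sup>2 = (l2norm f)\<^sup>2"
    unfolding ip_self[OF Uf] ip_self[OF f] of_real_eq_iff .
  then show ?thesis
    by simp
qed

lemma pythagoras:
  assumes "finite X" "\<And>i. i \<in> X \<Longrightarrow> g i \<in> ell2 I"
    and "\<And>i j. i \<in> X \<Longrightarrow> j \<in> X \<Longrightarrow> i \<noteq> j \<Longrightarrow> ip (g i) (g j) = 0"
  shows "(l2norm (\<lambda>x. \<Sum>i\<in>X. g i x))\<^sup>2 = (\<Sum>i\<in>X. (l2norm (g i))\<^sup>2)"
proof -
  have s: "(\<lambda>x. \<Sum>i\<in>X. g i x) \<in> ell2 I"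
    by (rule ell2_sum[OF assms(2)])
  have "complex_of_real ((l2norm (\<lambda>x. \<Sum>i\<in>X. g i x))\<^sup>2) = (\<Sum>i\<in>X. ip (g i) (\<lambda>x. \<Sum>i\<in>X. g i x))"
    unfolding ip_self[OF s, symmetric] by (rule ip_sum_left[OF s assms(2)])
  also have "\<dots> = (\<Sum>i\<in>X. of_real ((l2norm (g i))\<^sup>2))"
  proof (rule sum.cong[OF refl])
    fix i
    assume i: "i \<in> X"
    have "ip (g i) (\<lambda>x. \<Sum>j\<in>X. g j x) = (\<Sum>j\<in>X. ip (g i) (g j))"
      by (rule ip_sum_right[OF assms(2)[OF i] assms(2)])
    also have "\<dots> = (\<Sum>j\<in>{i}. ip (g i) (g j))"
      by (rule sum.mono_neutral_right) (use assms i in auto)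
    finally show "ip (g i) (\<lambda>x. \<Sum>j\<in>X. g j x) = of_real ((l2norm (g i))\<^sup>2)"
      using ip_self[OF assms(2)[OF i]] by simp
  qed
  finally show ?thesis
    unfolding of_real_sum[symmetric] of_real_eq_iff .
qed

lemma onb_parseval:
  assumes \<psi>: "onb I d \<psi>" and h: "h \<in> ell2 I"
  shows "(\<Sum>i=1..d. (l2norm (outer I (\<psi> i) (\<psi> i) h))\<^sup>2) = (l2norm h)\<^sup>2"
proof -
  have mem: "\<psi> i \<in> ell2 I" if "i \<in> {1..d}" for i
    using \<psi> that by (simp add: onb_def)
  have "(l2norm (\<lambda>x. \<Sum>i=1..d. ip (\<psi> i) h * \<psi> i x))\<^sup>2
      = (\<Sum>i=1..d. (l2norm (\<lambda>x. ip (\<psi> i) h * \<psi> i x))\<^sup>2)"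
  proof (rule pythagoras)
    show "(\<lambda>x. ip (\<psi> i) h * \<psi> i x) \<in> ell2 I" if "i \<in> {1..d}" for i
      by (rule ell2_scale[OF mem[OF that]])
    show "ip (\<lambda>x. ip (\<psi> i) h * \<psi> i x) (\<lambda>x. ip (\<psi> j) h * \<psi> j x) = 0"
      if "i \<in> {1..d}" "j \<in> {1..d}" "i \<noteq> j" for i j
      unfolding ip_scale_left ip_scale_right using \<psi> that by (simp add: onb_def)
  qed simp
  moreover have "(\<lambda>x. \<Sum>i=1..d. ip (\<psi> i) h * \<psi> i x) = h"
    using \<psi> h by (simp add: onb_def)
  ultimately show ?thesis
    by (simp add: outer_apply[OF h])
qed

lemma onb_projections_orthogonal:
  assumes \<psi>: "onb I d \<psi>" and ij: "i \<in> {1..d}" "j \<in> {1..d}" "i \<noteq> j"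
  shows "outer I (\<psi> i) (\<psi> i) \<circ> outer I (\<psi> j) (\<psi> j) = (\<lambda>_ _. 0)"
proof
  fix f
  have mem: "\<psi> i \<in> ell2 I" "\<psi> j \<in> ell2 I" and orth: "ip (\<psi> i) (\<psi> j) = 0"
    using \<psi> ij by (simp_all add: onb_def)
  show "(outer I (\<psi> i) (\<psi> i) \<circ> outer I (\<psi> j) (\<psi> j)) f = (\<lambda>_. 0)"
  proof (cases "f \<in> ell2 I")
    case True
    have "ip (\<psi> i) (\<lambda>x. ip (\<psi> j) f * \<psi> j x) = 0"
      unfolding ip_scale_right orth by simp
    then show ?thesis
      by (simp add: outer_apply[OF True] outer_apply[OF ell2_scale[OF mem(2)]])
  qed (simp add: outer_def)
qed

lemma bop_sum_op:
  assumes "\<And>i. i \<in> X \<Longrightarrow> A i \<in> bop I"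
  shows "(\<lambda>f x. \<Sum>i\<in>X. A i f x) \<in> bop I"
  using assms by (induction X rule: infinite_finite_induct) (simp_all add: zero_bop bop_add_op)

definition contraction :: "'i set \<Rightarrow> 'i oper \<Rightarrow> bool" where
  "contraction I A \<longleftrightarrow> A \<in> bop I \<and> (\<forall>f\<in>ell2 I. l2norm (A f) \<le> l2norm f)"

lemma contraction_bop: "contraction I A \<Longrightarrow> A \<in> bop I"
  by (simp add: contraction_def)

text \<open>Commutation is asked for on \<open>trace_class\<close> only, which is where the axioms
  of a superoperator hold.\<close>

definition sandwich_commutes :: "'i set \<Rightarrow> ('i oper \<Rightarrow> 'i oper) \<Rightarrow> 'i oper \<Rightarrow> bool" where
  "sandwich_commutes I T A \<longleftrightarrow> (\<forall>\<rho>\<in>trace_class I. T (sandwich I A \<rho>) = sandwich I A (T \<rho>))"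

lemma sandwich_commutesD:
  "sandwich_commutes I T A \<Longrightarrow> \<rho> \<in> trace_class I \<Longrightarrow> T (sandwich I A \<rho>) = sandwich I A (T \<rho>)"
  by (simp add: sandwich_commutes_def)

lemma sandwich_commutes_sandwich:
  assumes "A \<in> bop I" "C \<in> bop I" "A \<circ> C = C \<circ> A"
  shows "sandwich_commutes I (sandwich I A) C"
  using assms by (simp add: sandwich_commutes_def sandwich_comp)

lemma measurement_bop: "measurement I J M \<Longrightarrow> m \<in> J \<Longrightarrow> M m \<in> bop I"
  by (simp add: measurement_def)

context
  fixes B :: "'v \<Rightarrow> 'b set"
    and V :: "'v set"
begin

section \<open>Kraus families on registers\<close>

abbreviation tcl :: "('v \<Rightarrow> 'b) oper set" where "tcl \<equiv> trace_class (idx B V)"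

abbreviation esw :: "'v set \<Rightarrow> ('v \<Rightarrow> 'b) oper \<Rightarrow> ('v \<Rightarrow> 'b) oper \<Rightarrow> ('v \<Rightarrow> 'b) oper" where
  "esw Q A \<equiv> sandwich (idx B V) (ext B V Q A)"

lemma ext_kraus_family:
  assumes Q: "Q \<subseteq> V" and A: "\<And>m. m \<in> X \<Longrightarrow> A m \<in> bop (idx B Q)" and X: "finite X"
    and le: "\<And>h. h \<in> ell2 (idx B Q) \<Longrightarrow> (\<Sum>m\<in>X. (l2norm (A m h))\<^sup>2) \<le> (l2norm h)\<^sup>2"
    and \<rho>: "\<rho> \<in> tcl"
  shows "(\<Sum>m\<in>X. tr (idx B V) (esw Q (A m) \<rho>)) \<le> tr (idx B V) \<rho>"
proof (rule kraus_family(2)[OF _ X _ \<rho>])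
  show "(\<Sum>m\<in>X. (l2norm (ext B V Q (A m) f))\<^sup>2) \<le> (l2norm f)\<^sup>2" if "f \<in> ell2 (idx B V)" for f
  proof -
    have "(\<Sum>m\<in>X. (l2norm (ext B V Q (A m) f))\<^sup>2) \<le> 1 * (l2norm f)\<^sup>2"
      by (rule ext_norm_family[OF Q A _ that]) (use le in simp_all)
    then show ?thesis
      by simp
  qed
qed (rule ext_bop[OF Q A])

lemma superop_esw:
  assumes Q: "Q \<subseteq> V" and A: "contraction (idx B Q) A"
  shows "superop (idx B V) (esw Q A)"
proof (rule superop_sandwich[OF ext_bop[OF Q contraction_bop[OF A]]])
  fix f
  assume f: "f \<in> ell2 (idx B V)"
  have "(\<Sum>m\<in>{()}. (l2norm (ext B V Q A f))\<^sup>2) \<le> 1 * (l2norm f)\<^sup>2"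
    by (rule ext_norm_family[OF Q contraction_bop[OF A] _ f])
      (use A in \<open>simp add: contraction_def power_mono\<close>)
  then show "l2norm (ext B V Q A f) \<le> l2norm f"
    by simp
qed

lemma measurement_contraction:
  assumes "measurement I J M" "m \<in> J"
  shows "contraction I (M m)"
  using measurement_norm[OF assms(1), of "{m}"] assms(2) measurement_bop[OF assms]
  by (simp add: contraction_def)

lemma superop_measurement:
  "Q \<subseteq> V \<Longrightarrow> measurement (idx B Q) J M \<Longrightarrow> m \<in> J \<Longrightarrow> superop (idx B V) (esw Q (M m))"
  by (rule superop_esw[OF _ measurement_contraction])

lemma measurement_tr:
  assumes "Q \<subseteq> V" "measurement (idx B Q) J M" "finite X" "X \<subseteq> J" "\<rho> \<in> tcl"
  shows "(\<Sum>m\<in>X. tr (idx B V) (esw Q (M m) \<rho>)) \<le> tr (idx B V) \<rho>"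
  by (rule ext_kraus_family[OF assms(1) measurement_bop[OF assms(2)] assms(3)
        measurement_norm[OF assms(2,3,4)] assms(5)]) (use assms(4) in auto)

lemma reset_contraction:
  assumes \<psi>: "\<psi> \<in> ell2 I" "l2norm \<psi> = 1" and X: "finite X" "X \<subseteq> I" and h: "h \<in> ell2 I"
  shows "(\<Sum>n\<in>X. (l2norm (outer I \<psi> (ket n) h))\<^sup>2) \<le> (l2norm h)\<^sup>2"
  using sum_sq_le_l2norm[OF h X(1)] by (simp add: outer_apply[OF h] l2norm_scale ip_ket_left \<psi>)

lemma reset_family:
  assumes Q: "Q \<subseteq> V" and \<psi>: "\<psi> \<in> ell2 (idx B Q)" "l2norm \<psi> = 1"
  shows "n \<in> idx B Q \<Longrightarrow> contraction (idx B Q) (outer (idx B Q) \<psi> (ket n))"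
    and "finite X \<Longrightarrow> X \<subseteq> idx B Q \<Longrightarrow> \<rho> \<in> tcl \<Longrightarrow>
      (\<Sum>n\<in>X. tr (idx B V) (esw Q (outer (idx B Q) \<psi> (ket n)) \<rho>)) \<le> tr (idx B V) \<rho>"
proof -
  have bop: "n \<in> idx B Q \<Longrightarrow> outer (idx B Q) \<psi> (ket n) \<in> bop (idx B Q)" for n
    by (rule outer_bop[OF \<psi>(1) ket_ell2])
  show "n \<in> idx B Q \<Longrightarrow> contraction (idx B Q) (outer (idx B Q) \<psi> (ket n))"
    using reset_contraction[OF \<psi>, of "{n}"] bop[of n] by (simp add: contraction_def)
  show "finite X \<Longrightarrow> X \<subseteq> idx B Q \<Longrightarrow> \<rho> \<in> tcl \<Longrightarrow>
      (\<Sum>n\<in>X. tr (idx B V) (esw Q (outer (idx B Q) \<psi> (ket n)) \<rho>)) \<le> tr (idx B V) \<rho>"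
    by (rule ext_kraus_family[OF Q bop _ reset_contraction[OF \<psi>]]) auto
qed

text \<open>The semantics spells out the adjoint of each rank-one operator; in sandwich form,
  initialisation becomes a Kraus family like those of measurements.\<close>

lemma sem_Init_eq:
  assumes Q: "Q \<subseteq> V" and \<psi>: "\<psi> \<in> ell2 (idx B Q)"
  shows "sem B V (Init Q \<psi>) = (\<lambda>\<rho>. op_sum (idx B Q) (\<lambda>n. esw Q (outer (idx B Q) \<psi> (ket n)) \<rho>))"
proof -
  have "ext B V Q (outer (idx B Q) \<psi> (ket n)) \<circ> \<rho> \<circ> ext B V Q (outer (idx B Q) (ket n) \<psi>)
      = esw Q (outer (idx B Q) \<psi> (ket n)) \<rho>" if "n \<in> idx B Q" for n \<rho>
    using ext_adj[OF Q outer_bop[OF \<psi> ket_ell2[OF that]]] outer_adj[OF \<psi> ket_ell2[OF that]]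
    by (simp add: sandwich_def)
  then show ?thesis
    by (simp add: op_sum_def cong: infsum_cong)
qed

lemma superop_funpow: "superop I S \<Longrightarrow> superop I (S ^^ n)"
proof (induction n)
  case 0
  then show ?case
    using superop_id by (simp add: id_def)
next
  case (Suc n)
  show ?case
    unfolding funpow.simps by (rule superop_comp[OF Suc.prems Suc.IH[OF Suc.prems]])
qed

lemma funpow_commute:
  assumes "\<And>x. x \<in> K \<Longrightarrow> T (L x) = L (T x)" "\<And>x. x \<in> K \<Longrightarrow> L x \<in> K" "x \<in> K"
  shows "T ((L ^^ n) x) = (L ^^ n) (T x)"
proof -
  have "(L ^^ n) x \<in> K \<and> T ((L ^^ n) x) = (L ^^ n) (T x)"
    by (induction n) (simp_all add: assms)
  then show ?thesis
    by simp
qed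

text \<open>The bound counts the trace that has left the loop together with the trace still inside
  it; the second term is what lets the induction close.\<close>

lemma loop_tr:
  assumes T: "superop I T" and \<rho>: "\<rho> \<in> trace_class I"
    and le: "\<And>\<rho>. \<rho> \<in> trace_class I \<Longrightarrow> tr I (E \<rho>) + tr I (T \<rho>) \<le> tr I \<rho>"
  shows "(\<Sum>n<N. tr I (E ((T ^^ n) \<rho>))) + tr I ((T ^^ N) \<rho>) \<le> tr I \<rho>"
proof (induction N)
  case (Suc N)
  then show ?case
    using le[OF superop_trace_class[OF superop_funpow[OF T] \<rho>], of N] by simp
qed simp

lemma while_family:
  assumes Q: "Q \<subseteq> V" and M: "binary_measurement (idx B Q) M" and S: "superop (idx B V) S"
  shows "superop (idx B V) (esw Q (M 0) \<circ> (S \<circ> esw Q (M 1)) ^^ n)"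
    and "finite X \<Longrightarrow> \<rho> \<in> tcl \<Longrightarrow>
      (\<Sum>n\<in>X. tr (idx B V) ((esw Q (M 0) \<circ> (S \<circ> esw Q (M 1)) ^^ n) \<rho>)) \<le> tr (idx B V) \<rho>"
proof -
  let ?T = "S \<circ> esw Q (M 1)"
  have E: "superop (idx B V) (esw Q (M 0))" "superop (idx B V) (esw Q (M 1))"
    using superop_measurement[OF Q M] by simp_all
  note T = superop_comp[OF S E(2)]
  show E0T: "superop (idx B V) (esw Q (M 0) \<circ> ?T ^^ n)" for n
    by (rule superop_comp[OF E(1) superop_funpow[OF T]])
  assume X: "finite X" and \<rho>: "\<rho> \<in> tcl"
  \<comment> \<open>\<open>loop_tr\<close> speaks of initial segments; since traces are nonnegative,
    \<open>X\<close> may be enlarged to one.\<close>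
  obtain N where N: "X \<subseteq> {..<N}"
    using finite_nat_bounded[OF X] by auto
  have le: "tr (idx B V) (esw Q (M 0) \<sigma>) + tr (idx B V) (?T \<sigma>) \<le> tr (idx B V) \<sigma>" if \<sigma>: "\<sigma> \<in> tcl" for \<sigma>
    using measurement_tr[OF Q M, of "{0, 1}" \<sigma>] superop_tr[OF S superop_trace_class[OF E(2) \<sigma>]] \<sigma>
    by simp
  have "(\<Sum>n\<in>X. tr (idx B V) ((esw Q (M 0) \<circ> ?T ^^ n) \<rho>))
      \<le> (\<Sum>n<N. tr (idx B V) ((esw Q (M 0) \<circ> ?T ^^ n) \<rho>))"
    by (rule sum_mono2) (use N tr_nonneg[OF superop_trace_class[OF E0T \<rho>]] in auto)
  also have "\<dots> \<le> tr (idx B V) \<rho>"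
    using loop_tr[where T = ?T and E = "esw Q (M 0)", OF T \<rho> le, of N]
      tr_nonneg[OF superop_trace_class[OF superop_funpow[OF T] \<rho>], of N]
    unfolding comp_apply[of "esw Q (M 0)"] by linarith
  finally show "(\<Sum>n\<in>X. tr (idx B V) ((esw Q (M 0) \<circ> ?T ^^ n) \<rho>)) \<le> tr (idx B V) \<rho>" .
qed

lemma if_family:
  assumes Q: "Q \<subseteq> V" and M: "measurement (idx B Q) J M"
    and S: "\<And>m. m \<in> J \<Longrightarrow> superop (idx B V) (S m)"
  shows "m \<in> J \<Longrightarrow> superop (idx B V) (\<lambda>\<rho>. S m (esw Q (M m) \<rho>))"
    and "finite X \<Longrightarrow> X \<subseteq> J \<Longrightarrow> \<rho> \<in> tcl \<Longrightarrow>
      (\<Sum>m\<in>X. tr (idx B V) (S m (esw Q (M m) \<rho>))) \<le> tr (idx B V) \<rho>"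
proof -
  show "m \<in> J \<Longrightarrow> superop (idx B V) (\<lambda>\<rho>. S m (esw Q (M m) \<rho>))"
    using superop_comp[OF S superop_measurement[OF Q M]] by (simp add: comp_def)
  assume X: "finite X" "X \<subseteq> J" and \<rho>: "\<rho> \<in> tcl"
  have "(\<Sum>m\<in>X. tr (idx B V) (S m (esw Q (M m) \<rho>))) \<le> (\<Sum>m\<in>X. tr (idx B V) (esw Q (M m) \<rho>))"
    by (intro sum_mono superop_tr[OF S] superop_trace_class[OF superop_measurement[OF Q M] \<rho>])
      (use X in auto)
  also have "\<dots> \<le> tr (idx B V) \<rho>"
    by (rule measurement_tr[OF Q M X \<rho>])
  finally show "(\<Sum>m\<in>X. tr (idx B V) (S m (esw Q (M m) \<rho>))) \<le> tr (idx B V) \<rho>" .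
qed

section \<open>Conditional statements and Left-Distributivity-II\<close>

lemma sem_cond:
  "sem B V (P0 \<triangleleft> M\<langle>Q\<rangle> \<triangleright> P1) \<rho>
    = (\<lambda>f x. sem B V P0 (esw Q (M 0) \<rho>) f x + sem B V P1 (esw Q (M 1) \<rho>) f x)"
  by (simp add: op_sum_def)

lemma superop_binary:
  assumes "Q \<subseteq> V" "binary_measurement (idx B Q) M"
  shows "superop (idx B V) (esw Q (M 0))" "superop (idx B V) (esw Q (M 1))"
  using superop_measurement[OF assms] by simp_all

text \<open>In a guard the aborting branch contributes zero, so the two assumptions compare single
  outcomes: measuring \<open>M\<close> after \<open>P\<close> gives the same operator as running
  \<open>P'\<close> after the same outcome of \<open>N\<close>. Feeding these equalities to the
  branches \<open>P0\<close> and \<open>P1\<close> and adding gives the claim.\<close>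

lemma seq_cond_swap:
  assumes eq: "B, V \<turnstile> P ;; guard0 M q \<cong> guard0 N r ;; P'" "B, V \<turnstile> P ;; guard1 M q \<cong> guard1 N r ;; P'"
  shows "B, V \<turnstile> P ;; (P0 \<triangleleft> M\<langle>q\<rangle> \<triangleright> P1) \<cong> (P' ;; P0) \<triangleleft> N\<langle>r\<rangle> \<triangleright> (P' ;; P1)"
  unfolding prog_equiv_def
proof
  fix \<rho>
  assume \<rho>: "\<rho> \<in> density (idx B V)"
  have "esw q (M 0) (sem B V P \<rho>) = sem B V P' (esw r (N 0) \<rho>)"
    using bspec[OF eq(1)[unfolded prog_equiv_def] \<rho>]
    unfolding sem.simps(5) comp_apply sem_cond by simp
  moreover have "esw q (M 1) (sem B V P \<rho>) = sem B V P' (esw r (N 1) \<rho>)"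
    using bspec[OF eq(2)[unfolded prog_equiv_def] \<rho>]
    unfolding sem.simps(5) comp_apply sem_cond by simp
  ultimately show "sem B V (P ;; (P0 \<triangleleft> M\<langle>q\<rangle> \<triangleright> P1)) \<rho> = sem B V ((P' ;; P0) \<triangleleft> N\<langle>r\<rangle> \<triangleright> (P' ;; P1)) \<rho>"
    unfolding sem.simps(5) comp_apply sem_cond by simp
qed

lemma gate_cond:
  assumes q: "q \<subseteq> V" and M: "binary_measurement (idx B q) M" and U: "unitary (idx B q) U"
  shows "B, V \<turnstile> Circ (Gate q U) ;; (P0 \<triangleleft> M\<langle>q\<rangle> \<triangleright> P1) \<cong> P0 \<triangleleft> (\<lambda>i. M i \<circ> U)\<langle>q\<rangle> \<triangleright> P1"
  unfolding prog_equiv_def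
proof
  fix \<rho>
  note bU = unitary_bop[OF U]
  have "esw q (M m) (esw q U \<rho>) = esw q (M m \<circ> U) \<rho>" if "m \<in> {0, 1}" for m
    unfolding sandwich_comp[OF ext_bop[OF q measurement_bop[OF M that]] ext_bop[OF q bU]]
      ext_comp[OF q measurement_bop[OF M that] bU] ..
  then show "sem B V (Circ (Gate q U) ;; (P0 \<triangleleft> M\<langle>q\<rangle> \<triangleright> P1)) \<rho>
      = sem B V (P0 \<triangleleft> (\<lambda>i. M i \<circ> U)\<langle>q\<rangle> \<triangleright> P1) \<rho>"
    unfolding sem.simps(5) comp_apply sem_cond by simp
qed

context
  fixes G :: "'v set \<Rightarrow> ('v \<Rightarrow> 'b) oper set"
  assumes gates: "\<And>Q U. Q \<subseteq> V \<Longrightarrow> U \<in> G Q \<Longrightarrow> unitary (idx B Q) U"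
begin

section \<open>Circuits\<close>

lemma QIf_projection_bop:
  assumes "wf_circuit B V G (QIf Q d \<psi> C)" "i \<in> {1..d}"
  shows "outer (idx B Q) (\<psi> i) (\<psi> i) \<in> bop (idx B Q)"
    and "ext B V Q (outer (idx B Q) (\<psi> i) (\<psi> i)) \<in> bop (idx B V)"
proof -
  show "outer (idx B Q) (\<psi> i) (\<psi> i) \<in> bop (idx B Q)"
    by (rule outer_bop) (use assms in \<open>simp_all add: onb_def\<close>)
  then show "ext B V Q (outer (idx B Q) (\<psi> i) (\<psi> i)) \<in> bop (idx B V)"
    by (rule ext_bop[rotated]) (use assms in simp)
qed

lemma csem_bop: "wf_circuit B V G C \<Longrightarrow> csem B V C \<in> bop (idx B V)"
proof (induction C)
  case (Gate Q U)
  then show ?case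
    using gates by (simp add: ext_bop unitary_bop)
next
  case (QIf Q d \<psi> C)
  have "(\<lambda>f x. \<Sum>i=1..d. (ext B V Q (outer (idx B Q) (\<psi> i) (\<psi> i)) \<circ> csem B V (C i)) f x)
      \<in> bop (idx B V)"
  proof (rule bop_sum_op)
    show "ext B V Q (outer (idx B Q) (\<psi> i) (\<psi> i)) \<circ> csem B V (C i) \<in> bop (idx B V)"
      if "i \<in> {1..d}" for i
      by (rule bop_comp[OF QIf_projection_bop(2)[OF QIf.prems that] QIf.IH])
        (use QIf.prems that in auto)
  qed
  then show ?case
    by simp
qed (simp_all add: idop_bop bop_comp)

text \<open>\<open>T\<close> is abstract so that two rounds are possible: with \<open>T\<close> a
  local operator the commutation assumption is \<open>ext_commute\<close>, and the result of that
  round is the assumption when \<open>T\<close> is another circuit.\<close>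

lemma csem_commute:
  assumes "wf_circuit B V G C" and T: "T \<in> bop (idx B V)"
    and "\<And>Q A. Q \<subseteq> V \<Longrightarrow> Q \<subseteq> cqv C \<Longrightarrow> A \<in> bop (idx B Q) \<Longrightarrow> T \<circ> ext B V Q A = ext B V Q A \<circ> T"
  shows "T \<circ> csem B V C = csem B V C \<circ> T"
  using assms(1,3)
proof (induction C)
  case CSkip
  show ?case
  proof (rule bop_eqI)
    show "T \<circ> csem B V CSkip \<in> bop (idx B V)" "csem B V CSkip \<circ> T \<in> bop (idx B V)"
      using bop_comp[OF T idop_bop] bop_comp[OF idop_bop T] by (simp_all only: csem.simps)
    show "(T \<circ> csem B V CSkip) f = (csem B V CSkip \<circ> T) f" if "f \<in> ell2 (idx B V)" for f
      using that bop_ell2[OF T that] by (simp add: idop_def)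
  qed
next
  case (Gate Q U)
  then show ?case
    using gates by (simp add: unitary_bop)
next
  case (CSeq C D)
  have "T \<circ> csem B V C = csem B V C \<circ> T"
    by (rule CSeq.IH(1)) (use CSeq.prems in \<open>simp_all del: comp_apply add: le_supI1\<close>)
  moreover have "T \<circ> csem B V D = csem B V D \<circ> T"
    by (rule CSeq.IH(2)) (use CSeq.prems in \<open>simp_all del: comp_apply add: le_supI2\<close>)
  ultimately show ?case
    unfolding csem.simps by (metis comp_assoc)
next
  case (QIf Q d \<psi> C)
  have C: "wf_circuit B V G (C i)" "Q \<inter> cqv (C i) = {}" if "i \<in> {1..d}" for i
    using QIf.prems(1) that by auto
  have IH: "T \<circ> csem B V (C i) = csem B V (C i) \<circ> T" if "i \<in> {1..d}" for i
    by (rule QIf.IH[OF _ C(1)[OF that] QIf.prems(2)]) (use that in auto)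
  let ?P = "\<lambda>i. ext B V Q (outer (idx B Q) (\<psi> i) (\<psi> i))"
  have TP: "T \<circ> ?P i = ?P i \<circ> T" if "i \<in> {1..d}" for i
    by (rule QIf.prems(2)[OF _ _ QIf_projection_bop(1)[OF QIf.prems(1) that]])
      (use QIf.prems(1) in auto)
  note wf = QIf.prems(1)
  show ?case
  proof (rule bop_eqI)
    show "T \<circ> csem B V (QIf Q d \<psi> C) \<in> bop (idx B V)" "csem B V (QIf Q d \<psi> C) \<circ> T \<in> bop (idx B V)"
      by (intro bop_comp T csem_bop wf)+
    fix f
    assume f: "f \<in> ell2 (idx B V)"
    have "T (\<lambda>x. \<Sum>i=1..d. ?P i (csem B V (C i) f) x)
        = (\<lambda>x. \<Sum>i=1..d. T (?P i (csem B V (C i) f)) x)"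
      by (rule bop_sum[OF T])
        (rule bop_ell2[OF QIf_projection_bop(2)[OF wf] bop_ell2[OF csem_bop[OF C(1)] f]])
    also have "\<dots> = (\<lambda>x. \<Sum>i=1..d. ?P i (csem B V (C i) (T f)) x)"
    proof (intro HOL.ext sum.cong refl)
      show "T (?P i (csem B V (C i) f)) x = ?P i (csem B V (C i) (T f)) x" if "i \<in> {1..d}" for i x
        using fun_cong[OF TP[OF that], of "csem B V (C i) f"] fun_cong[OF IH[OF that], of f] by simp
    qed
    finally show "(T \<circ> csem B V (QIf Q d \<psi> C)) f = (csem B V (QIf Q d \<psi> C) \<circ> T) f"
      by simp
  qed
qed

lemma csem_ext_commute:
  assumes C: "wf_circuit B V G C" and R: "R \<subseteq> V" "R \<inter> cqv C = {}" and A: "A \<in> bop (idx B R)"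
  shows "ext B V R A \<circ> csem B V C = csem B V C \<circ> ext B V R A"
proof (rule csem_commute[OF C ext_bop[OF R(1) A]])
  show "ext B V R A \<circ> ext B V Q D = ext B V Q D \<circ> ext B V R A"
    if "Q \<subseteq> V" "Q \<subseteq> cqv C" "D \<in> bop (idx B Q)" for Q D
    by (rule ext_commute[OF R(1) that(1) _ A that(3)]) (use R that in auto)
qed

lemma csem_csem_commute:
  assumes C: "wf_circuit B V G C" and D: "wf_circuit B V G D" and disj: "cqv C \<inter> cqv D = {}"
  shows "csem B V C \<circ> csem B V D = csem B V D \<circ> csem B V C"
proof (rule csem_commute[OF D csem_bop[OF C]])
  show "csem B V C \<circ> ext B V Q A = ext B V Q A \<circ> csem B V C"
    if "Q \<subseteq> V" "Q \<subseteq> cqv D" "A \<in> bop (idx B Q)" for Q A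
    by (rule csem_ext_commute[OF C that(1) _ that(3), symmetric]) (use disj that in auto)
qed

text \<open>The case with content is the quantum conditional. Its branches end in orthogonal
  subspaces, so squared norms add up; each projection commutes with its branch, which lets the
  induction hypothesis act on the projected input, and Parseval adds the projected inputs back
  together.\<close>

lemma csem_contraction:
  "wf_circuit B V G C \<Longrightarrow> f \<in> ell2 (idx B V) \<Longrightarrow> l2norm (csem B V C f) \<le> l2norm f"
proof (induction C arbitrary: f)
  case CSkip
  then show ?case
    by (simp add: idop_def)
next
  case (Gate Q U)
  then have U: "unitary (idx B Q) U" and Q: "Q \<subseteq> V"
    using gates by auto
  have "(\<Sum>m\<in>{()}. (l2norm (ext B V Q U f))\<^sup>2) \<le> 1 * (l2norm f)\<^sup>2"
    by (rule ext_norm_family[OF Q unitary_bop[OF U] _ Gate.prems(2)])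
      (use unitary_norm[OF U] in simp)
  then show ?case
    by simp
next
  case (CSeq C D)
  have "l2norm (csem B V D (csem B V C f)) \<le> l2norm (csem B V C f)"
    by (rule CSeq.IH(2)) (use CSeq.prems in \<open>simp_all add: bop_ell2 csem_bop\<close>)
  also have "\<dots> \<le> l2norm f"
    by (rule CSeq.IH(1)) (use CSeq.prems in simp_all)
  finally show ?case
    by simp
next
  case (QIf Q d \<psi> C)
  note wf = QIf.prems(1) and f = QIf.prems(2)
  have Q: "Q \<subseteq> V" and \<psi>: "onb (idx B Q) d \<psi>"
    using wf by auto
  have C: "wf_circuit B V G (C i)" "Q \<inter> cqv (C i) = {}" if "i \<in> {1..d}" for i
    using wf that by auto
  let ?O = "\<lambda>i. outer (idx B Q) (\<psi> i) (\<psi> i)"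
  let ?P = "\<lambda>i. ext B V Q (?O i)"
  note O = QIf_projection_bop(1)[OF wf] and P = QIf_projection_bop(2)[OF wf]
  have mem: "csem B V (C i) f \<in> ell2 (idx B V)" if "i \<in> {1..d}" for i
    by (rule bop_ell2[OF csem_bop[OF C(1)[OF that]] f])
  have "(l2norm (\<lambda>x. \<Sum>i=1..d. ?P i (csem B V (C i) f) x))\<^sup>2
      = (\<Sum>i=1..d. (l2norm (?P i (csem B V (C i) f)))\<^sup>2)"
  proof (rule pythagoras)
    show "?P i (csem B V (C i) f) \<in> ell2 (idx B V)" if "i \<in> {1..d}" for i
      by (rule bop_ell2[OF P[OF that] mem[OF that]])
    fix i j
    assume ij: "i \<in> {1..d}" "j \<in> {1..d}" "i \<noteq> j"
    have \<psi>i: "\<psi> i \<in> ell2 (idx B Q)"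
      using \<psi> ij by (simp add: onb_def)
    \<comment> \<open>A self-adjoint operator can be moved across the inner product, where it meets
      an orthogonal projection.\<close>
    have "adj (idx B V) (?P i) = ?P i"
      unfolding ext_adj[OF Q O[OF ij(1)]] outer_adj[OF \<psi>i \<psi>i] ..
    then have "ip (?P i (csem B V (C i) f)) (?P j (csem B V (C j) f))
        = ip (csem B V (C i) f) ((?P i \<circ> ?P j) (csem B V (C j) f))"
      using ip_adj_left[OF P[OF ij(1)] mem[OF ij(1)] bop_ell2[OF P[OF ij(2)] mem[OF ij(2)]]] by simp
    also have "?P i \<circ> ?P j = (\<lambda>_ _. 0)"
      unfolding ext_comp[OF Q O[OF ij(1)] O[OF ij(2)], symmetric] onb_projections_orthogonal[OF \<psi> ij]
      by (rule ext_zero)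
    finally show "ip (?P i (csem B V (C i) f)) (?P j (csem B V (C j) f)) = 0"
      by simp
  qed simp
  also have "\<dots> = (\<Sum>i=1..d. (l2norm (csem B V (C i) (?P i f)))\<^sup>2)"
  proof (rule sum.cong[OF refl])
    show "(l2norm (?P i (csem B V (C i) f)))\<^sup>2 = (l2norm (csem B V (C i) (?P i f)))\<^sup>2" if "i \<in> {1..d}" for i
      using fun_cong[OF csem_ext_commute[OF C(1)[OF that] Q C(2)[OF that] O[OF that]], of f] by simp
  qed
  also have "\<dots> \<le> (\<Sum>i=1..d. (l2norm (?P i f))\<^sup>2)"
    by (intro sum_mono power_mono QIf.IH) (use C in \<open>auto simp: bop_ell2[OF P f]\<close>)
  also have "\<dots> \<le> 1 * (l2norm f)\<^sup>2"
    by (rule ext_norm_family[OF Q O _ f]) (use onb_parseval[OF \<psi>] in auto)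
  finally show ?case
    by simp
qed

section \<open>Programs\<close>

lemma superop_csem: "wf_circuit B V G C \<Longrightarrow> superop (idx B V) (sandwich (idx B V) (csem B V C))"
  by (rule superop_sandwich[OF csem_bop csem_contraction])

lemma superop_sem: "wf_prog B V G P \<Longrightarrow> superop (idx B V) (sem B V P)"
proof (induction P)
  case Skip
  show ?case
    using superop_id by simp
next
  case Abort
  show ?case
    using superop_abort by simp
next
  case (Init Q \<psi>)
  then have Q: "Q \<subseteq> V" and \<psi>: "\<psi> \<in> ell2 (idx B Q)" "l2norm \<psi> = 1"
    by auto
  note fam = reset_family[OF Q \<psi>]
  show ?case
    unfolding sem_Init_eq[OF Q \<psi>(1)]
    by (rule superop_family(1)[OF superop_esw[OF Q fam(1)] fam(2)])
next
  case (Circ C)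
  then show ?case
    using superop_csem by simp
next
  case (Seq P1 P2)
  then show ?case
    unfolding sem.simps by (intro superop_comp) simp_all
next
  case (IfM J M Q P)
  then have Q: "Q \<subseteq> V" and M: "measurement (idx B Q) J M"
    and S: "\<And>m. m \<in> J \<Longrightarrow> superop (idx B V) (sem B V (P m))"
    by auto
  have "superop (idx B V) (\<lambda>\<rho>. op_sum J (\<lambda>m. sem B V (P m) (esw Q (M m) \<rho>)))"
    by (rule superop_family(1)[OF if_family(1)[OF Q M S] if_family(2)[OF Q M S]])
  then show ?case
    by simp
next
  case (WhileM M Q P)
  then have Q: "Q \<subseteq> V" and M: "binary_measurement (idx B Q) M" and S: "superop (idx B V) (sem B V P)"
    by auto
  show ?case
    unfolding sem.simps
    by (rule superop_family(1)[OF while_family(1)[OF Q M S] while_family(2)[OF Q M S]])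
qed

text \<open>\<open>T\<close> is abstract for the same reason as in \<open>csem_commute\<close>.
  Being a superoperator, it passes through the sums of initialisations, conditionals and loops, so
  only the summands have to be commuted; the two assumptions on \<open>T\<close> supply this for the
  sandwiches out of which programs are built.\<close>

lemma sem_commute:
  assumes "wf_prog B V G P" and T: "superop (idx B V) T"
    and "\<And>Q A. Q \<subseteq> V \<Longrightarrow> Q \<subseteq> qv P \<Longrightarrow> contraction (idx B Q) A
      \<Longrightarrow> sandwich_commutes (idx B V) T (ext B V Q A)"
    and "\<And>C. wf_circuit B V G C \<Longrightarrow> cqv C \<subseteq> qv P
      \<Longrightarrow> sandwich_commutes (idx B V) T (csem B V C)"
    and "\<rho> \<in> tcl"
  shows "T (sem B V P \<rho>) = sem B V P (T \<rho>)"
  using assms(1,3-)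
proof (induction P arbitrary: \<rho>)
  case Skip
  show ?case
    by simp
next
  case Abort
  show ?case
    by (simp add: superop_zero[OF T])
next
  case (Init Q \<psi>)
  then have Q: "Q \<subseteq> V" and \<psi>: "\<psi> \<in> ell2 (idx B Q)" "l2norm \<psi> = 1"
    by auto
  note \<rho> = Init.prems(4) and fam = reset_family[OF Q \<psi>]
  let ?E = "\<lambda>n. esw Q (outer (idx B Q) \<psi> (ket n))"
  have E: "superop (idx B V) (?E n)" if "n \<in> idx B Q" for n
    by (rule superop_esw[OF Q fam(1)[OF that]])
  have "T (op_sum (idx B Q) (\<lambda>n. ?E n \<rho>)) = op_sum (idx B Q) (\<lambda>n. T (?E n \<rho>))"
    by (rule superop_op_sum[OF T superop_trace_class[OF E \<rho>] superop_family(2)[OF E fam(2) \<rho>]])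
  also have "\<dots> = op_sum (idx B Q) (\<lambda>n. ?E n (T \<rho>))"
  proof (rule op_sum_cong)
    show "T (?E n \<rho>) = ?E n (T \<rho>)" if "n \<in> idx B Q" for n
      by (rule sandwich_commutesD[OF Init.prems(2)[OF Q _ fam(1)[OF that]] \<rho>]) auto
  qed
  finally show ?case
    by (simp only: sem_Init_eq[OF Q \<psi>(1)])
next
  case (Circ C)
  then show ?case
    using sandwich_commutesD[OF Circ.prems(3)] by simp
next
  case (Seq P1 P2)
  have "T (sem B V P2 (sem B V P1 \<rho>)) = sem B V P2 (T (sem B V P1 \<rho>))"
    by (rule Seq.IH(2)) (use Seq.prems superop_trace_class[OF superop_sem] in \<open>simp_all add: le_supI2\<close>)
  also have "T (sem B V P1 \<rho>) = sem B V P1 (T \<rho>)"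
    by (rule Seq.IH(1)) (use Seq.prems in \<open>simp_all add: le_supI1\<close>)
  finally show ?case
    by simp
next
  case (IfM J M Q P)
  then have Q: "Q \<subseteq> V" and M: "measurement (idx B Q) J M" and P: "\<And>m. m \<in> J \<Longrightarrow> wf_prog B V G (P m)"
    by auto
  note \<rho> = IfM.prems(4) and E = superop_measurement[OF Q M]
  note fam = if_family[OF Q M superop_sem[OF P]]
  have "T (op_sum J (\<lambda>m. sem B V (P m) (esw Q (M m) \<rho>)))
      = op_sum J (\<lambda>m. T (sem B V (P m) (esw Q (M m) \<rho>)))"
    by (rule superop_op_sum[OF T superop_trace_class[OF fam(1) \<rho>] superop_family(2)[OF fam(1) fam(2) \<rho>]])
  also have "\<dots> = op_sum J (\<lambda>m. sem B V (P m) (esw Q (M m) (T \<rho>)))"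
  proof (rule op_sum_cong)
    fix m
    assume m: "m \<in> J"
    have sub: "qv (P m) \<subseteq> qv (IfM J M Q P)"
      using m by auto
    have "T (sem B V (P m) (esw Q (M m) \<rho>)) = sem B V (P m) (T (esw Q (M m) \<rho>))"
    proof (rule IfM.IH[OF _ P[OF m] _ _ superop_trace_class[OF E[OF m] \<rho>]])
      show "sandwich_commutes (idx B V) T (ext B V R A)"
        if "R \<subseteq> V" "R \<subseteq> qv (P m)" "contraction (idx B R) A" for R A
        by (rule IfM.prems(2)[OF that(1) order_trans[OF that(2) sub] that(3)])
      show "sandwich_commutes (idx B V) T (csem B V C)"
        if "wf_circuit B V G C" "cqv C \<subseteq> qv (P m)" for C
        by (rule IfM.prems(3)[OF that(1) order_trans[OF that(2) sub]])
    qed simp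
    also have "T (esw Q (M m) \<rho>) = esw Q (M m) (T \<rho>)"
      by (rule sandwich_commutesD[OF IfM.prems(2)[OF Q _ measurement_contraction[OF M m]] \<rho>]) auto
    finally show "T (sem B V (P m) (esw Q (M m) \<rho>)) = sem B V (P m) (esw Q (M m) (T \<rho>))" .
  qed
  finally show ?case
    by simp
next
  case (WhileM M Q P)
  then have Q: "Q \<subseteq> V" and M: "binary_measurement (idx B Q) M" and P: "wf_prog B V G P"
    by auto
  note \<rho> = WhileM.prems(4) and S = superop_sem[OF P]
  note fam = while_family[OF Q M S]
  let ?L = "sem B V P \<circ> esw Q (M 1)"
  have E1: "superop (idx B V) (esw Q (M 1))"
    using superop_measurement[OF Q M] by simp
  have TE: "T (esw Q (M i) \<sigma>) = esw Q (M i) (T \<sigma>)" if "i \<in> {0, 1}" "\<sigma> \<in> tcl" for i \<sigma>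
    by (rule sandwich_commutesD[OF WhileM.prems(2)[OF Q _ measurement_contraction[OF M that(1)]] that(2)])
      auto
  have TS: "T (sem B V P \<sigma>) = sem B V P (T \<sigma>)" if "\<sigma> \<in> tcl" for \<sigma>
    by (rule WhileM.IH[OF P]) (use WhileM.prems that in \<open>simp_all add: le_supI2\<close>)
  note L = superop_comp[OF S E1]
  \<comment> \<open>Every iterate stays in \<open>tcl\<close>, where commutation of \<open>T\<close>
    with a single round is available.\<close>
  have TL: "T ((?L ^^ n) \<rho>) = (?L ^^ n) (T \<rho>)" for n
  proof (rule funpow_commute[where K = tcl, OF _ _ \<rho>])
    show "T (?L \<sigma>) = ?L (T \<sigma>)" if "\<sigma> \<in> tcl" for \<sigma>
      using TS[OF superop_trace_class[OF E1 that]] TE[of 1 \<sigma>] that by simp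
  qed (rule superop_trace_class[OF L])
  have "T (op_sum UNIV (\<lambda>n. (esw Q (M 0) \<circ> ?L ^^ n) \<rho>))
      = op_sum UNIV (\<lambda>n. T ((esw Q (M 0) \<circ> ?L ^^ n) \<rho>))"
    by (rule superop_op_sum[OF T superop_trace_class[OF fam(1) \<rho>] superop_family(2)[OF fam(1) fam(2) \<rho>]])
  also have "\<dots> = op_sum UNIV (\<lambda>n. (esw Q (M 0) \<circ> ?L ^^ n) (T \<rho>))"
  proof (rule op_sum_cong)
    show "T ((esw Q (M 0) \<circ> ?L ^^ n) \<rho>) = (esw Q (M 0) \<circ> ?L ^^ n) (T \<rho>)" for n
      using TE[of 0, OF _ superop_trace_class[OF superop_funpow[OF L] \<rho>], of n] TL[of n] by simp
  qed
  finally show ?case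
    by simp
qed

lemma sem_esw_commute:
  assumes P: "wf_prog B V G P" and R: "R \<subseteq> V" "R \<inter> qv P = {}" and A: "contraction (idx B R) A"
  shows "sandwich_commutes (idx B V) (sem B V P) (ext B V R A)"
  unfolding sandwich_commutes_def
proof (intro ballI sem_commute[OF P superop_esw[OF R(1) A], symmetric])
  note bA = contraction_bop[OF A]
  show "sandwich_commutes (idx B V) (esw R A) (ext B V Q D)"
    if "Q \<subseteq> V" "Q \<subseteq> qv P" "contraction (idx B Q) D" for Q D
  proof (rule sandwich_commutes_sandwich[OF ext_bop[OF R(1) bA] ext_bop[OF that(1) contraction_bop[OF that(3)]]])
    show "ext B V R A \<circ> ext B V Q D = ext B V Q D \<circ> ext B V R A"
      by (rule ext_commute[OF R(1) that(1) _ bA contraction_bop[OF that(3)]]) (use R that in auto)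
  qed
  show "sandwich_commutes (idx B V) (esw R A) (csem B V C)"
    if "wf_circuit B V G C" "cqv C \<subseteq> qv P" for C
  proof (rule sandwich_commutes_sandwich[OF ext_bop[OF R(1) bA] csem_bop[OF that(1)]])
    show "ext B V R A \<circ> csem B V C = csem B V C \<circ> ext B V R A"
      by (rule csem_ext_commute[OF that(1) R(1) _ bA]) (use R that in auto)
  qed
qed

lemma sem_csem_commute:
  assumes P: "wf_prog B V G P" and C: "wf_circuit B V G C" and disj: "cqv C \<inter> qv P = {}"
  shows "sandwich_commutes (idx B V) (sem B V P) (csem B V C)"
  unfolding sandwich_commutes_def
proof (intro ballI sem_commute[OF P superop_csem[OF C], symmetric])
  show "sandwich_commutes (idx B V) (sandwich (idx B V) (csem B V C)) (ext B V Q A)"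
    if "Q \<subseteq> V" "Q \<subseteq> qv P" "contraction (idx B Q) A" for Q A
  proof (rule sandwich_commutes_sandwich[OF csem_bop[OF C] ext_bop[OF that(1) contraction_bop[OF that(3)]]])
    show "csem B V C \<circ> ext B V Q A = ext B V Q A \<circ> csem B V C"
      by (rule csem_ext_commute[OF C that(1) _ contraction_bop[OF that(3)], symmetric])
        (use disj that in auto)
  qed
  show "sandwich_commutes (idx B V) (sandwich (idx B V) (csem B V C)) (csem B V D)"
    if "wf_circuit B V G D" "cqv D \<subseteq> qv P" for D
  proof (rule sandwich_commutes_sandwich[OF csem_bop[OF C] csem_bop[OF that(1)]])
    show "csem B V C \<circ> csem B V D = csem B V D \<circ> csem B V C"
      by (rule csem_csem_commute[OF C that(1)]) (use disj that in auto)
  qed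
qed

text \<open>The second round: the induction runs over \<open>R\<close> with the semantics of
  \<open>P\<close> as \<open>T\<close>, and what it asks of \<open>T\<close> is provided by
  \<open>sem_esw_commute\<close> and \<open>sem_csem_commute\<close>, whose inductions ran over
  \<open>P\<close>.\<close>

lemma sem_sem_commute:
  assumes P: "wf_prog B V G P" and R: "wf_prog B V G R" and disj: "qv P \<inter> qv R = {}"
    and \<rho>: "\<rho> \<in> tcl"
  shows "sem B V P (sem B V R \<rho>) = sem B V R (sem B V P \<rho>)"
proof (rule sem_commute[OF R superop_sem[OF P] _ _ \<rho>])
  show "sandwich_commutes (idx B V) (sem B V P) (ext B V Q A)"
    if "Q \<subseteq> V" "Q \<subseteq> qv R" "contraction (idx B Q) A" for Q A
    by (rule sem_esw_commute[OF P that(1) _ that(3)]) (use disj that in auto)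
  show "sandwich_commutes (idx B V) (sem B V P) (csem B V C)"
    if "wf_circuit B V G C" "cqv C \<subseteq> qv R" for C
    by (rule sem_csem_commute[OF P that(1)]) (use disj that in auto)
qed

section \<open>Laws\<close>

lemma cond_seq_distrib:
  assumes P: "wf_prog B V G P0" "wf_prog B V G P1" "wf_prog B V G P"
    and Q: "Q \<subseteq> V" and M: "binary_measurement (idx B Q) M"
  shows "B, V \<turnstile> (P0 \<triangleleft> M\<langle>Q\<rangle> \<triangleright> P1) ;; P \<cong> (P0 ;; P) \<triangleleft> M\<langle>Q\<rangle> \<triangleright> (P1 ;; P)"
  unfolding prog_equiv_def
proof
  fix \<rho>
  assume "\<rho> \<in> density (idx B V)"
  then have \<rho>: "\<rho> \<in> tcl"
    by (rule density_trace_class)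
  note E = superop_binary[OF Q M, THEN superop_trace_class, OF \<rho>]
  show "sem B V ((P0 \<triangleleft> M\<langle>Q\<rangle> \<triangleright> P1) ;; P) \<rho> = sem B V ((P0 ;; P) \<triangleleft> M\<langle>Q\<rangle> \<triangleright> (P1 ;; P)) \<rho>"
    unfolding sem.simps(5) comp_apply sem_cond
    by (rule superop_add[OF superop_sem[OF P(3)] superop_trace_class[OF superop_sem[OF P(1)] E(1)]
          superop_trace_class[OF superop_sem[OF P(2)] E(2)]])
qed

lemma seq_cond_distrib:
  assumes P: "wf_prog B V G P"
    and Q: "Q \<subseteq> V" and M: "binary_measurement (idx B Q) M" and disj: "Q \<inter> qv P = {}"
  shows "B, V \<turnstile> P ;; (P0 \<triangleleft> M\<langle>Q\<rangle> \<triangleright> P1) \<cong> (P ;; P0) \<triangleleft> M\<langle>Q\<rangle> \<triangleright> (P ;; P1)"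
  unfolding prog_equiv_def
proof
  fix \<rho>
  assume "\<rho> \<in> density (idx B V)"
  then have \<rho>: "\<rho> \<in> tcl"
    by (rule density_trace_class)
  have "sem B V P (esw Q (M m) \<rho>) = esw Q (M m) (sem B V P \<rho>)" if "m \<in> {0, 1}" for m
    by (rule sandwich_commutesD[OF sem_esw_commute[OF P Q disj measurement_contraction[OF M that]] \<rho>])
  then show "sem B V (P ;; (P0 \<triangleleft> M\<langle>Q\<rangle> \<triangleright> P1)) \<rho> = sem B V ((P ;; P0) \<triangleleft> M\<langle>Q\<rangle> \<triangleright> (P ;; P1)) \<rho>"
    unfolding sem.simps(5) comp_apply sem_cond by simp
qed

text \<open>The branch executed in between avoids \<open>Q\<close>, so the second measurement
  commutes past it and meets the first one directly; the projections then keep the matching outcome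
  and annihilate the other.\<close>

lemma cond_cond:
  assumes P: "wf_prog B V G P0" "wf_prog B V G P1" "wf_prog B V G Q0" "wf_prog B V G Q1"
    and Q: "Q \<subseteq> V" and M: "binary_measurement (idx B Q) M" and proj: "projective (idx B Q) {0, 1} M"
    and disj: "Q \<inter> qv P0 = {}" "Q \<inter> qv P1 = {}"
  shows "B, V \<turnstile> (P0 \<triangleleft> M\<langle>Q\<rangle> \<triangleright> P1) ;; (Q0 \<triangleleft> M\<langle>Q\<rangle> \<triangleright> Q1)
    \<cong> (P0 ;; Q0) \<triangleleft> M\<langle>Q\<rangle> \<triangleright> (P1 ;; Q1)"
  unfolding prog_equiv_def
proof
  fix \<rho>
  assume "\<rho> \<in> density (idx B V)"
  then have \<rho>: "\<rho> \<in> tcl"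
    by (rule density_trace_class)
  let ?E = "\<lambda>m. esw Q (M m)" and ?R = "\<lambda>m. if m = 0 then P0 else P1"
  have E: "superop (idx B V) (?E m)" if "m \<in> {0, 1}" for m
    by (rule superop_measurement[OF Q M that])
  have wfR: "wf_prog B V G (?R m)" and disjR: "Q \<inter> qv (?R m) = {}" for m
    using P disj by simp_all
  have bM: "M m \<in> bop (idx B Q)" if "m \<in> {0, 1}" for m
    by (rule measurement_bop[OF M that])
  have EE: "?E m (?E n \<rho>) = (if m = n then ?E n \<rho> else (\<lambda>_ _. 0))" if "m \<in> {0, 1}" "n \<in> {0, 1}" for m n
  proof -
    have "?E m (?E n \<rho>) = esw Q (M m \<circ> M n) \<rho>"
      unfolding sandwich_comp[OF ext_bop[OF Q bM[OF that(1)]] ext_bop[OF Q bM[OF that(2)]]]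
        ext_comp[OF Q bM[OF that(1)] bM[OF that(2)]] ..
    moreover have "M m \<circ> M n = (if m = n then M n else (\<lambda>_ _. 0))"
      using proj that unfolding projective_def by metis
    moreover have "sandwich (idx B V) (\<lambda>_ _. 0) \<rho> = (\<lambda>_ _. 0)"
      by (simp add: sandwich_def comp_def)
    ultimately show ?thesis
      by (simp add: ext_zero)
  qed
  have comm: "?E m (sem B V (?R n) (?E n \<rho>)) = sem B V (?R n) (?E m (?E n \<rho>))"
    if "m \<in> {0, 1}" "n \<in> {0, 1}" for m n
    by (rule sandwich_commutesD[symmetric, OF sem_esw_commute[OF wfR Q disjR
            measurement_contraction[OF M that(1)]] superop_trace_class[OF E[OF that(2)] \<rho>]])
  \<comment> \<open>At a mismatched outcome the branch is applied to the zero operator, which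
    \<open>superop_zero\<close> evaluates.\<close>
  have pick: "?E m (sem B V (?R n) (?E n \<rho>))
      = (if m = n then sem B V (?R n) (?E n \<rho>) else (\<lambda>_ _. 0))" if "m \<in> {0, 1}" "n \<in> {0, 1}" for m n
    unfolding comm[OF that] EE[OF that] using superop_zero[OF superop_sem[OF wfR], of n]
    by (cases "m = n") simp_all
  have tc: "sem B V (?R n) (?E n \<rho>) \<in> tcl" if "n \<in> {0, 1}" for n
    by (rule superop_trace_class[OF superop_sem[OF wfR] superop_trace_class[OF E[OF that] \<rho>]])
  have "?E m (\<lambda>f x. sem B V P0 (?E 0 \<rho>) f x + sem B V P1 (?E 1 \<rho>) f x) = sem B V (?R m) (?E m \<rho>)"
    if "m \<in> {0, 1}" for m
    using superop_add[OF E[OF that] tc[of 0] tc[of 1]] pick[OF that, of 0] pick[OF that, of 1] that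
    by auto
  from this[of 0] this[of 1]
  show "sem B V ((P0 \<triangleleft> M\<langle>Q\<rangle> \<triangleright> P1) ;; (Q0 \<triangleleft> M\<langle>Q\<rangle> \<triangleright> Q1)) \<rho>
      = sem B V ((P0 ;; Q0) \<triangleleft> M\<langle>Q\<rangle> \<triangleright> (P1 ;; Q1)) \<rho>"
    unfolding sem.simps(5) comp_apply sem_cond by simp
qed

end

end

text \<open>Completeness of \<open>M\<close> is used at the vector \<open>U f\<close>, followed by
  the adjoint of \<open>U\<close>. With two outcomes the sum is finite, so linearity carries the
  adjoint inside.\<close>

lemma measurement_unitary:
  assumes M: "binary_measurement I M" and U: "unitary I U"
  shows "binary_measurement I (\<lambda>i. M i \<circ> U)"
  unfolding measurement_def
proof (intro conjI ballI allI)
  note bU = unitary_bop[OF U]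
  have bM: "M m \<in> bop I" if "m \<in> {0, 1}" for m
    by (rule measurement_bop[OF M that])
  then show "M m \<circ> U \<in> bop I" if "m \<in> {0, 1}" for m
    using that by (intro bop_comp bU)
  fix f x
  assume f: "f \<in> ell2 I"
  note Uf = bop_ell2[OF bU f]
  let ?T = "\<lambda>m. adj I (M m) (M m (U f))"
  have T: "?T m \<in> ell2 I" if "m \<in> {0, 1}" for m
    by (rule bop_ell2[OF adj_bop[OF bM[OF that]] bop_ell2[OF bM[OF that] Uf]])
  have hs: "((\<lambda>m. (adj I (M m) \<circ> M m) (U f) x) has_sum U f x) {0, 1}" for x
    using M Uf by (simp add: measurement_def)
  have "U f x = ?T 0 x + ?T 1 x" for x
    using has_sum_unique[OF hs has_sum_finite, of x] by simp
  then have "U f = (\<lambda>x. ?T 0 x + ?T 1 x)"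
    by (rule HOL.ext)
  then have "adj I U (U f) = adj I U (\<lambda>x. ?T 0 x + ?T 1 x)"
    by (rule arg_cong)
  also have "\<dots> = (\<lambda>x. adj I U (?T 0) x + adj I U (?T 1) x)"
    by (rule bop_add[OF adj_bop[OF bU] T T]) simp_all
  finally have "adj I U (U f) = (\<lambda>x. adj I U (?T 0) x + adj I U (?T 1) x)" .
  moreover have "adj I U (U f) = f"
    by (rule unitary_adj[OF U f])
  ultimately have "f x = adj I U (?T 0) x + adj I U (?T 1) x"
    by (simp only: fun_eq_iff)
  moreover have "(adj I (M m \<circ> U) \<circ> (M m \<circ> U)) f = adj I U (?T m)" if "m \<in> {0, 1}" for m
    by (simp add: adj_comp[OF bM[OF that] bU])
  ultimately have "(\<Sum>m\<in>{0, 1}. (adj I (M m \<circ> U) \<circ> (M m \<circ> U)) f x) = f x"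
    by simp
  then show "((\<lambda>m. (adj I (M m \<circ> U) \<circ> (M m \<circ> U)) f x) has_sum f x) {0, 1}"
    by (intro has_sum_finiteI) simp_all
qed

theorem proposition5p4:
  fixes B :: "'v \<Rightarrow> 'b set"
    and V :: "'v set"
    and G :: "'v set \<Rightarrow> ('v \<Rightarrow> 'b) oper set"
  assumes fin: "finite V"
    and gates: "\<And>Q U. Q \<subseteq> V \<Longrightarrow> U \<in> G Q \<Longrightarrow> unitary (idx B Q) U"
  shows
    \<comment> \<open>(1) Unit and Zero\<close>
    "(\<forall>P. wf_prog B V G P \<longrightarrow>
        (B, V \<turnstile> Skip ;; P \<cong> P ;; Skip) \<and> (B, V \<turnstile> P ;; Skip \<cong> P) \<and>
        (B, V \<turnstile> Abort ;; P \<cong> P ;; Abort) \<and> (B, V \<turnstile> P ;; Abort \<cong> Abort))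
   \<and> \<comment> \<open>(2) Commutativity\<close>
     (\<forall>P1 P2. wf_prog B V G P1 \<longrightarrow> wf_prog B V G P2 \<longrightarrow> qv P1 \<inter> qv P2 = {} \<longrightarrow>
        (B, V \<turnstile> P1 ;; P2 \<cong> P2 ;; P1))
   \<and> \<comment> \<open>(3) Associativity\<close>
     (\<forall>P Q R. wf_prog B V G P \<longrightarrow> wf_prog B V G Q \<longrightarrow> wf_prog B V G R \<longrightarrow>
        (B, V \<turnstile> (P ;; Q) ;; R \<cong> P ;; (Q ;; R)))
   \<and> \<comment> \<open>(4) Sequentiality\<close>
     (\<forall>P0 P1 Q0 Q1 M q. wf_prog B V G P0 \<longrightarrow> wf_prog B V G P1 \<longrightarrow>
        wf_prog B V G Q0 \<longrightarrow> wf_prog B V G Q1 \<longrightarrow>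
        q \<subseteq> V \<longrightarrow> binary_measurement (idx B q) M \<longrightarrow> projective (idx B q) {0, 1} M \<longrightarrow>
        q \<inter> qv P0 = {} \<longrightarrow> q \<inter> qv P1 = {} \<longrightarrow>
        (B, V \<turnstile> (P0 \<triangleleft> M\<langle>q\<rangle> \<triangleright> P1) ;; (Q0 \<triangleleft> M\<langle>q\<rangle> \<triangleright> Q1)
          \<cong> (P0 ;; Q0) \<triangleleft> M\<langle>q\<rangle> \<triangleright> (P1 ;; Q1)))
   \<and> \<comment> \<open>(5) Right-Distributivity\<close>
     (\<forall>P0 P1 P M q. wf_prog B V G P0 \<longrightarrow> wf_prog B V G P1 \<longrightarrow> wf_prog B V G P \<longrightarrow>
        q \<subseteq> V \<longrightarrow> binary_measurement (idx B q) M \<longrightarrow>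
        (B, V \<turnstile> (P0 \<triangleleft> M\<langle>q\<rangle> \<triangleright> P1) ;; P \<cong> (P0 ;; P) \<triangleleft> M\<langle>q\<rangle> \<triangleright> (P1 ;; P)))
   \<and> \<comment> \<open>(6) Left-Distributivity-I\<close>
     (\<forall>P0 P1 P M q. wf_prog B V G P0 \<longrightarrow> wf_prog B V G P1 \<longrightarrow> wf_prog B V G P \<longrightarrow>
        q \<subseteq> V \<longrightarrow> binary_measurement (idx B q) M \<longrightarrow> q \<inter> qv P = {} \<longrightarrow>
        (B, V \<turnstile> P ;; (P0 \<triangleleft> M\<langle>q\<rangle> \<triangleright> P1) \<cong> (P ;; P0) \<triangleleft> M\<langle>q\<rangle> \<triangleright> (P ;; P1)))
   \<and> \<comment> \<open>(7) Left-Distributivity-II\<close>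
     (\<forall>P P' P0 P1 M N q r. wf_prog B V G P \<longrightarrow> wf_prog B V G P' \<longrightarrow>
        wf_prog B V G P0 \<longrightarrow> wf_prog B V G P1 \<longrightarrow>
        q \<subseteq> V \<longrightarrow> binary_measurement (idx B q) M \<longrightarrow>
        r \<subseteq> V \<longrightarrow> binary_measurement (idx B r) N \<longrightarrow>
        (B, V \<turnstile> P ;; guard0 M q \<cong> guard0 N r ;; P') \<longrightarrow>
        (B, V \<turnstile> P ;; guard1 M q \<cong> guard1 N r ;; P') \<longrightarrow>
        (B, V \<turnstile> P ;; (P0 \<triangleleft> M\<langle>q\<rangle> \<triangleright> P1) \<cong> (P' ;; P0) \<triangleleft> N\<langle>r\<rangle> \<triangleright> (P' ;; P1)))
   \<and> \<comment> \<open>(7), the special case of a unitary operator\<close>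
     (\<forall>P0 P1 M U q. wf_prog B V G P0 \<longrightarrow> wf_prog B V G P1 \<longrightarrow>
        q \<subseteq> V \<longrightarrow> binary_measurement (idx B q) M \<longrightarrow> unitary (idx B q) U \<longrightarrow>
        binary_measurement (idx B q) (\<lambda>i. M i \<circ> U) \<and>
        (B, V \<turnstile> Circ (Gate q U) ;; (P0 \<triangleleft> M\<langle>q\<rangle> \<triangleright> P1) \<cong> P0 \<triangleleft> (\<lambda>i. M i \<circ> U)\<langle>q\<rangle> \<triangleright> P1))"
proof (intro conjI allI impI)
  fix P
  assume P: "wf_prog B V G P"
  \<comment> \<open>These hold by unfolding, apart from the one with \<open>Abort\<close> in front
    of \<open>P\<close>, for which \<open>P\<close> must map the zero operator to itself.\<close>
  show "B, V \<turnstile> Skip ;; P \<cong> P ;; Skip" "B, V \<turnstile> P ;; Skip \<cong> P" "B, V \<turnstile> P ;; Abort \<cong> Abort"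
    "B, V \<turnstile> Abort ;; P \<cong> P ;; Abort"
    using superop_zero[OF superop_sem[OF gates P]] by (auto simp: prog_equiv_def)
next
  show "B, V \<turnstile> P1 ;; P2 \<cong> P2 ;; P1"
    if "wf_prog B V G P1" "wf_prog B V G P2" "qv P1 \<inter> qv P2 = {}" for P1 P2
    using sem_sem_commute[OF gates that(2,1)] that(3) density_trace_class
    by (auto simp: prog_equiv_def Int_commute)
  show "B, V \<turnstile> (P ;; Q) ;; R \<cong> P ;; (Q ;; R)" for P Q R
    by (simp add: prog_equiv_def)
qed (use measurement_unitary cond_cond[OF gates] cond_seq_distrib[OF gates] seq_cond_distrib[OF gates]
    seq_cond_swap gate_cond in auto)

end
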